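(* Let $k$ be a commutative associative unital ring and let $A$ be a unital associative commutative $k$-superalgebra. Let $(I,\le)$ be an arbitrary directed set and let $(\mathfrak{sl}(m_i,n_i;A),f_{ji})$ be a directed system of Lie superalgebras over $k$ indexed by $I$, with $m_i+n_i\ge5$ for all $i\in I$. Suppose that for all $(m,n)=(m_i,n_i)$, $i\in I$, the map $$h_{mn}:\mathfrak{uce}(\mathfrak{sl}(m,n;A))\to\mathfrak{sl}(m,n;A)\oplus\mathrm{HC}_1(A),\qquad \langle x,y\rangle\mapsto[x,y]\oplus\tau_{mn}(x,y),$$ is an isomorphism of central extensions of $\mathfrak{sl}(m,n;A)$, where the Lie superalgebra structure on the right is given by the $2$-cocycle $\tau_{mn}$. Denote by $\mathfrak{sl}(I;A):=\varinjlim\mathfrak{sl}(m_i,n_i;A)$ the corresponding direct limit, which is a perfect Lie superalgebra of possibly infinite rank. Then $$\mathfrak{uce}\big(\mathfrak{sl}(I;A)\big)\cong\mathfrak{sl}(I;A)\oplus\mathrm{HC}_1(A)$$ as central extensions, where the Lie superalgebra structure on the right is given by the $2$-cocycle $\tau_I$.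
   Context: A Lie superalgebra over $k$ is a $\mathbb Z/2\mathbb Z$-graded $k$-module $L=L_{\bar 0}\oplus L_{\bar 1}$ with a $k$-bilinear product of degree $0$ such that $[x,y]+(-1)^{|x||y|}[y,x]=0$, $[x_{\bar 0},x_{\bar 0}]=0$ for $x_{\bar 0}\in L_{\bar 0}$, and $(-1)^{|x||z|}[x,[y,z]]+(-1)^{|y||x|}[y,[z,x]]+(-1)^{|z||y|}[z,[x,y]]=0$; here $|\cdot|$ is the degree and such formulas are for homogeneous elements. Commutativity of $A$ means $ab=(-1)^{|a||b|}ba$. A central extension of $L$ is a surjective Lie superalgebra morphism $K\to L$ with kernel in the centre of $K$; an isomorphism of central extensions of $L$ is a Lie superalgebra isomorphism compatible with the maps to $L$. $\mathfrak{uce}(L)=(L\otimes_kL)/\mathcal B_L$, where $\mathcal B_L$ is spanned by $x\otimes y+(-1)^{|x||y|}y\otimes x$; $x_{\bar0}\otimes x_{\bar0}$ for $x_{\bar0}\in L_{\bar0}$; and $(-1)^{|x||z|}x\otimes[y,z]+(-1)^{|y||x|}y\otimes[z,x]+(-1)^{|z||y|}z\otimes[x,y]$. Write $\langle x,y\rangle=x\otimes y+\mathcal B_L$. The product is $[\langle l_1,l_2\rangle,\langle l_3,l_4\rangle]=\langle[l_1,l_2],[l_3,l_4]\rangle$, and for perfect $L$ the map $\mathfrak u:\mathfrak{uce}(L)\to L$, $\langle x,y\rangle\mapsto[x,y]$, is a universal central extension. A $2$-cocycle $\tau:L\times L\to C$ ($C$ a $k$-supermodule) is a $k$-bilinear map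 of degree $0$ with $\tau(x,y)+(-1)^{|x||y|}\tau(y,x)=0=\tau(x_{\bar0},x_{\bar0})$ for $x_{\bar 0}\in L_{\bar 0}$ and $(-1)^{|x||z|}\tau(x,[y,z])+(-1)^{|y||x|}\tau(y,[z,x])+(-1)^{|z||y|}\tau(z,[x,y])=0$. It makes $L\oplus C$ a Lie superalgebra with product $[l_1\oplus c_1,l_2\oplus c_2]=[l_1,l_2]\oplus\tau(l_1,l_2)$, which is a central extension of $L$ via the projection to $L$. $\mathrm{Mat}(m,n;A)$ is the associative superalgebra of $(m+n)\times(m+n)$ matrices over $A$, where the indices $1,\dots,m$ are even and $m+1,\dots,m+n$ are odd, graded by $|E_{ij}(a)|=|i|+|j|+|a|$ ($E_{ij}(a)$ the matrix with entry $a$ at position $(ij)$ and $0$ elsewhere). $\mathfrak{gl}(m,n;A)$ is the same module with product $[x,y]=xy-(-1)^{|x||y|}yx$, and $\mathfrak{sl}(m,n;A)=[\mathfrak{gl}(m,n;A),\mathfrak{gl}(m,n;A)]$; it is perfect if $m+n\ge3$. For commutative $A$, $\mathrm{HC}_1(A)=\,\ll A,A\gg\,=(A\otimes_kA)/\mathcal H$, where $\mathcal H$ is spanned by $a\otimes b+(-1)^{|a||b|}b\otimes a$; $a_{\bar0}\otimes a_{\bar0}$ for $a_{\bar0}\in A_{\bar0}$; and $(-1)^{|a||c|}a\otimes bc+(-1)^{|b||a|}b\otimes ca+(-1)^{|c||b|}c\otimes ab$; write $\ll a,b\gg=a\otimes b+\mathcal H$. The Lie superalgebra $\mathfrak{sl}(m,n;A)$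 has the $2$-cocycle $\tau_{mn}$ with values in $\mathrm{HC}_1(A)$ given, for $x=(x_{ij}),y=(y_{ij})\in\mathfrak{sl}(m,n;A)$, by $$\tau_{mn}(x,y)=\sum_{1\le i\le m,\,1\le j\le m+n}\ll x_{ij},y_{ji}\gg-\sum_{m+1\le i\le m+n,\,1\le j\le m+n}\ll x_{ij},y_{ji}\gg .$$ A directed system has morphisms $f_{ji}$ for $i\le j$ with $f_{ii}=\mathrm{Id}$ and $f_{ki}=f_{kj}\circ f_{ji}$ for $i\le j\le k$. Let $\varphi_i:\mathfrak{sl}(m_i,n_i;A)\to\mathfrak{sl}(I;A)$ be the canonical maps. The $2$-cocycle $\tau_I$ on $\mathfrak{sl}(I;A)$ with values in $\mathrm{HC}_1(A)$ is defined as follows: let $x,y\in\mathfrak{sl}(I;A)$, so $x=\varphi_p(x_p)$ and $y=\varphi_q(y_q)$ for some $p,q\in I$, $x_p\in\mathfrak{sl}(m_p,n_p;A)$, $y_q\in\mathfrak{sl}(m_q,n_q;A)$. There exists $l\in I$ with $l\ge p$ and $l\ge q$, so that $f_{lp}(x_p),f_{lq}(y_q)\in\mathfrak{sl}(m_l,n_l;A)$, and $$\tau_I(x,y)=\tau_{m_l n_l}\big(f_{lp}(x_p),f_{lq}(y_q)\big).$$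
   Formalization: The formula for τ_I is assumed to be independent of the representatives x_p, y_q and of l (equivalently, the maps f_ji preserve the cocycles τ_mn); for arbitrary directed systems, e.g. with zero maps f_ji for i<j, τ_I is undefined and the claim fails. *)

theory Defs
  imports "HOL-Algebra.Module" "HOL-Algebra.AbelCoset" "HOL-Library.Z2"
begin

section \<open>Supermodules and superalgebras\<close>

text \<open>
  Degrees live in \<^typ>\<open>bit\<close>, the field with two elements: degrees are added with \<open>+\<close>, and the
  exponent of a sign \<open>(-1)\<^bsup>|x||y|\<^esup>\<close> is the product of the degrees.  The product of a superalgebra
  is the field \<^const>\<open>mult\<close> of the underlying ring record; for a Lie superalgebra this is the
  bracket, so \<open>x \<otimes> y\<close> below is \<open>[x, y]\<close> (and never a tensor).  The field \<^const>\<open>one\<close> is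
  meaningful for associative unital superalgebras only.
\<close>

record ('k, 'a) supermodule = "('k, 'a) module" +
  homog :: "bit \<Rightarrow> 'a set"

definition ksign :: "('k, 'a, 'z) module_scheme \<Rightarrow> bit \<Rightarrow> 'a \<Rightarrow> 'a"
  where "ksign M d x = (if d = 0 then x else \<ominus>\<^bsub>M\<^esub> x)"

locale supermodule = module R M for R and M (structure) +
  assumes homog_submodule: "submodule (homog M d) R M"
    and homog_sum: "carrier M = homog M 0 <+>\<^bsub>M\<^esub> homog M 1"
    and homog_disjoint: "homog M 0 \<inter> homog M 1 = {\<zero>\<^bsub>M\<^esub>}"

definition hpart :: "('k, 'a, 'z) supermodule_scheme \<Rightarrow> bit \<Rightarrow> 'a \<Rightarrow> 'a"
  where "hpart M d x = (THE y. y \<in> homog M d \<and> (\<exists>z \<in> homog M (d + 1). x = y \<oplus>\<^bsub>M\<^esub> z))"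

definition bilinear_map ::
  "('k, 'r) ring_scheme \<Rightarrow> ('k, 'a, 'x) module_scheme \<Rightarrow> ('k, 'b, 'y) module_scheme \<Rightarrow>
   ('k, 'c, 'z) module_scheme \<Rightarrow> ('a \<Rightarrow> 'b \<Rightarrow> 'c) \<Rightarrow> bool"
  where "bilinear_map R M N P \<beta> \<longleftrightarrow>
    (\<forall>x \<in> carrier M. \<forall>y \<in> carrier N. \<beta> x y \<in> carrier P) \<and>
    (\<forall>x \<in> carrier M. \<forall>x' \<in> carrier M. \<forall>y \<in> carrier N. \<beta> (x \<oplus>\<^bsub>M\<^esub> x') y = \<beta> x y \<oplus>\<^bsub>P\<^esub> \<beta> x' y) \<and>
    (\<forall>x \<in> carrier M. \<forall>y \<in> carrier N. \<forall>y' \<in> carrier N. \<beta> x (y \<oplus>\<^bsub>N\<^esub> y') = \<beta> x y \<oplus>\<^bsub>P\<^esub> \<beta> x y') \<and>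
    (\<forall>r \<in> carrier R. \<forall>x \<in> carrier M. \<forall>y \<in> carrier N.
        \<beta> (r \<odot>\<^bsub>M\<^esub> x) y = r \<odot>\<^bsub>P\<^esub> \<beta> x y \<and> \<beta> x (r \<odot>\<^bsub>N\<^esub> y) = r \<odot>\<^bsub>P\<^esub> \<beta> x y)"

definition degree_zero ::
  "('k, 'a, 'x) supermodule_scheme \<Rightarrow> ('k, 'b, 'y) supermodule_scheme \<Rightarrow>
   ('k, 'c, 'z) supermodule_scheme \<Rightarrow> ('a \<Rightarrow> 'b \<Rightarrow> 'c) \<Rightarrow> bool"
  where "degree_zero M N P \<beta> \<longleftrightarrow>
    (\<forall>a b. \<forall>x \<in> homog M a. \<forall>y \<in> homog N b. \<beta> x y \<in> homog P (a + b))"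

locale superalgebra = supermodule +
  assumes mult_bilinear: "bilinear_map R M M M (mult M)"
    and mult_degree: "degree_zero M M M (mult M)"

locale comm_superalgebra = superalgebra +
  assumes one_closed: "\<one>\<^bsub>M\<^esub> \<in> carrier M"
    and one_mult: "x \<in> carrier M \<Longrightarrow> \<one>\<^bsub>M\<^esub> \<otimes>\<^bsub>M\<^esub> x = x" "x \<in> carrier M \<Longrightarrow> x \<otimes>\<^bsub>M\<^esub> \<one>\<^bsub>M\<^esub> = x"
    and mult_assoc: "\<lbrakk>x \<in> carrier M; y \<in> carrier M; z \<in> carrier M\<rbrakk>
      \<Longrightarrow> (x \<otimes>\<^bsub>M\<^esub> y) \<otimes>\<^bsub>M\<^esub> z = x \<otimes>\<^bsub>M\<^esub> (y \<otimes>\<^bsub>M\<^esub> z)"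
    and supercomm: "\<lbrakk>x \<in> homog M a; y \<in> homog M b\<rbrakk>
      \<Longrightarrow> x \<otimes>\<^bsub>M\<^esub> y = ksign M (a * b) (y \<otimes>\<^bsub>M\<^esub> x)"

locale lie_superalgebra = superalgebra +
  assumes skew: "\<lbrakk>x \<in> homog M a; y \<in> homog M b\<rbrakk>
      \<Longrightarrow> x \<otimes>\<^bsub>M\<^esub> y \<oplus>\<^bsub>M\<^esub> ksign M (a * b) (y \<otimes>\<^bsub>M\<^esub> x) = \<zero>\<^bsub>M\<^esub>"
    and alternating: "x \<in> homog M 0 \<Longrightarrow> x \<otimes>\<^bsub>M\<^esub> x = \<zero>\<^bsub>M\<^esub>"
    and jacobi: "\<lbrakk>x \<in> homog M a; y \<in> homog M b; z \<in> homog M c\<rbrakk>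
      \<Longrightarrow> ksign M (a * c) (x \<otimes>\<^bsub>M\<^esub> (y \<otimes>\<^bsub>M\<^esub> z))
        \<oplus>\<^bsub>M\<^esub> ksign M (b * a) (y \<otimes>\<^bsub>M\<^esub> (z \<otimes>\<^bsub>M\<^esub> x))
        \<oplus>\<^bsub>M\<^esub> ksign M (c * b) (z \<otimes>\<^bsub>M\<^esub> (x \<otimes>\<^bsub>M\<^esub> y)) = \<zero>\<^bsub>M\<^esub>"

definition lie_hom ::
  "('k, 'r) ring_scheme \<Rightarrow> ('k, 'a, 'x) supermodule_scheme \<Rightarrow> ('k, 'b, 'y) supermodule_scheme \<Rightarrow>
   ('a \<Rightarrow> 'b) set"
  where "lie_hom R L L' = {f. f \<in> carrier L \<rightarrow> carrier L' \<and>
    (\<forall>x \<in> carrier L. \<forall>y \<in> carrier L. f (x \<oplus>\<^bsub>L\<^esub> y) = f x \<oplus>\<^bsub>L'\<^esub> f y) \<and>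
    (\<forall>r \<in> carrier R. \<forall>x \<in> carrier L. f (r \<odot>\<^bsub>L\<^esub> x) = r \<odot>\<^bsub>L'\<^esub> f x) \<and>
    (\<forall>x \<in> carrier L. \<forall>y \<in> carrier L. f (x \<otimes>\<^bsub>L\<^esub> y) = f x \<otimes>\<^bsub>L'\<^esub> f y) \<and>
    (\<forall>d. f ` homog L d \<subseteq> homog L' d)}"

definition mod_span :: "('k, 'r) ring_scheme \<Rightarrow> ('k, 'a, 'z) module_scheme \<Rightarrow> 'a set \<Rightarrow> 'a set"
  where "mod_span R M S = \<Inter>{N. submodule N R M \<and> S \<subseteq> N}"

definition derived :: "('k, 'r) ring_scheme \<Rightarrow> ('k, 'a, 'z) module_scheme \<Rightarrow> 'a set"
  where "derived R L = mod_span R L {x \<otimes>\<^bsub>L\<^esub> y | x y. x \<in> carrier L \<and> y \<in> carrier L}"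

definition perfect :: "('k, 'r) ring_scheme \<Rightarrow> ('k, 'a, 'z) module_scheme \<Rightarrow> bool"
  where "perfect R L \<longleftrightarrow> derived R L = carrier L"

definition lie_center :: "('k, 'a, 'z) module_scheme \<Rightarrow> 'a set"
  where "lie_center L = {z \<in> carrier L. \<forall>x \<in> carrier L. z \<otimes>\<^bsub>L\<^esub> x = \<zero>\<^bsub>L\<^esub>}"


section \<open>Central extensions and 2-cocycles\<close>

definition central_extension ::
  "('k, 'r) ring_scheme \<Rightarrow> ('k, 'e, 'y) supermodule_scheme \<Rightarrow> ('e \<Rightarrow> 'a) \<Rightarrow>
   ('k, 'a, 'x) supermodule_scheme \<Rightarrow> bool"
  where "central_extension R E p L \<longleftrightarrow>
    lie_superalgebra R E \<and> lie_superalgebra R L \<and> p \<in> lie_hom R E L \<and>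
    p ` carrier E = carrier L \<and> a_kernel E L p \<subseteq> lie_center E"

definition central_extension_iso ::
  "('k, 'r) ring_scheme \<Rightarrow> ('k, 'a, 'x) supermodule_scheme \<Rightarrow>
   ('k, 'e, 'y) supermodule_scheme \<Rightarrow> ('e \<Rightarrow> 'a) \<Rightarrow>
   ('k, 'd, 'z) supermodule_scheme \<Rightarrow> ('d \<Rightarrow> 'a) \<Rightarrow> ('e \<Rightarrow> 'd) \<Rightarrow> bool"
  where "central_extension_iso R L E p E' p' h \<longleftrightarrow>
    central_extension R E p L \<and> central_extension R E' p' L \<and>
    h \<in> lie_hom R E E' \<and> bij_betw h (carrier E) (carrier E') \<and>
    (\<forall>u \<in> carrier E. p' (h u) = p u)"

definition two_cocycle ::
  "('k, 'r) ring_scheme \<Rightarrow> ('k, 'a, 'x) supermodule_scheme \<Rightarrow> ('k, 'c, 'y) supermodule_scheme \<Rightarrow>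
   ('a \<Rightarrow> 'a \<Rightarrow> 'c) \<Rightarrow> bool"
  where "two_cocycle R L C \<tau> \<longleftrightarrow>
    bilinear_map R L L C \<tau> \<and> degree_zero L L C \<tau> \<and>
    (\<forall>a b. \<forall>x \<in> homog L a. \<forall>y \<in> homog L b. \<tau> x y \<oplus>\<^bsub>C\<^esub> ksign C (a * b) (\<tau> y x) = \<zero>\<^bsub>C\<^esub>) \<and>
    (\<forall>x \<in> homog L 0. \<tau> x x = \<zero>\<^bsub>C\<^esub>) \<and>
    (\<forall>a b c. \<forall>x \<in> homog L a. \<forall>y \<in> homog L b. \<forall>z \<in> homog L c.
        ksign C (a * c) (\<tau> x (y \<otimes>\<^bsub>L\<^esub> z))
        \<oplus>\<^bsub>C\<^esub> ksign C (b * a) (\<tau> y (z \<otimes>\<^bsub>L\<^esub> x))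
        \<oplus>\<^bsub>C\<^esub> ksign C (c * b) (\<tau> z (x \<otimes>\<^bsub>L\<^esub> y)) = \<zero>\<^bsub>C\<^esub>)"

text \<open>\<open>L \<oplus> C\<close> with the product given by \<open>\<tau>\<close>; its projection to \<open>L\<close> is \<^const>\<open>fst\<close>.\<close>

definition cocycle_extension ::
  "('k, 'a, 'x) supermodule_scheme \<Rightarrow> ('k, 'c, 'y) supermodule_scheme \<Rightarrow> ('a \<Rightarrow> 'a \<Rightarrow> 'c) \<Rightarrow>
   ('k, 'a \<times> 'c) supermodule"
  where "cocycle_extension L C \<tau> =
    \<lparr>carrier = carrier L \<times> carrier C,
     mult = (\<lambda>u v. (fst u \<otimes>\<^bsub>L\<^esub> fst v, \<tau> (fst u) (fst v))),
     one = undefined,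
     zero = (\<zero>\<^bsub>L\<^esub>, \<zero>\<^bsub>C\<^esub>),
     add = (\<lambda>u v. (fst u \<oplus>\<^bsub>L\<^esub> fst v, snd u \<oplus>\<^bsub>C\<^esub> snd v)),
     smult = (\<lambda>r u. (r \<odot>\<^bsub>L\<^esub> fst u, r \<odot>\<^bsub>C\<^esub> snd u)),
     homog = (\<lambda>d. homog L d \<times> homog C d)\<rparr>"


section \<open>Tensor products and quotients\<close>

text \<open>
  The tensor product over \<open>R\<close> is built as a quotient of the free \<open>R\<close>-module on
  \<open>carrier M \<times> carrier N\<close>, realised by functions of finite support that vanish off the basis.
\<close>

definition free_mod :: "('k, 'r) ring_scheme \<Rightarrow> 'x set \<Rightarrow> ('k, 'x \<Rightarrow> 'k) module"
  where "free_mod R X =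
    \<lparr>carrier = {g. (\<forall>z \<in> X. g z \<in> carrier R) \<and> (\<forall>z. z \<notin> X \<longrightarrow> g z = \<zero>\<^bsub>R\<^esub>) \<and> finite {z. g z \<noteq> \<zero>\<^bsub>R\<^esub>}},
     mult = undefined,
     one = undefined,
     zero = (\<lambda>z. \<zero>\<^bsub>R\<^esub>),
     add = (\<lambda>g h z. g z \<oplus>\<^bsub>R\<^esub> h z),
     smult = (\<lambda>r g z. r \<otimes>\<^bsub>R\<^esub> g z)\<rparr>"

definition free_gen :: "('k, 'r) ring_scheme \<Rightarrow> 'x \<Rightarrow> 'x \<Rightarrow> 'k"
  where "free_gen R x = (\<lambda>z. if z = x then \<one>\<^bsub>R\<^esub> else \<zero>\<^bsub>R\<^esub>)"

definition quot_mod :: "('k, 'a, 'z) module_scheme \<Rightarrow> 'a set \<Rightarrow> ('k, 'a set) module"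
  where "quot_mod M N =
    \<lparr>carrier = a_rcosets\<^bsub>M\<^esub> N,
     mult = undefined,
     one = undefined,
     zero = N,
     add = (<+>\<^bsub>M\<^esub>),
     smult = (\<lambda>r X. \<Union>x \<in> X. N +>\<^bsub>M\<^esub> (r \<odot>\<^bsub>M\<^esub> x))\<rparr>"

definition with_grading :: "('k, 'a) module \<Rightarrow> (bit \<Rightarrow> 'a set) \<Rightarrow> ('k, 'a) supermodule"
  where "with_grading M g = module.extend M \<lparr>homog = g\<rparr>"

definition quot_supermod :: "('k, 'a, 'z) supermodule_scheme \<Rightarrow> 'a set \<Rightarrow> ('k, 'a set) supermodule"
  where "quot_supermod M N = with_grading (quot_mod M N) (\<lambda>d. (\<lambda>x. N +>\<^bsub>M\<^esub> x) ` homog M d)"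

definition tensor_relations ::
  "('k, 'r) ring_scheme \<Rightarrow> ('k, 'a, 'x) module_scheme \<Rightarrow> ('k, 'b, 'y) module_scheme \<Rightarrow>
   ('a \<times> 'b \<Rightarrow> 'k) set"
  where "tensor_relations R M N =
    (let F = free_mod R (carrier M \<times> carrier N); e = free_gen R in
       mod_span R F
        ({e (x \<oplus>\<^bsub>M\<^esub> x', y) \<ominus>\<^bsub>F\<^esub> (e (x, y) \<oplus>\<^bsub>F\<^esub> e (x', y)) | x x' y.
            x \<in> carrier M \<and> x' \<in> carrier M \<and> y \<in> carrier N} \<union>
         {e (x, y \<oplus>\<^bsub>N\<^esub> y') \<ominus>\<^bsub>F\<^esub> (e (x, y) \<oplus>\<^bsub>F\<^esub> e (x, y')) | x y y'.
            x \<in> carrier M \<and> y \<in> carrier N \<and> y' \<in> carrier N} \<union>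
         {e (r \<odot>\<^bsub>M\<^esub> x, y) \<ominus>\<^bsub>F\<^esub> (r \<odot>\<^bsub>F\<^esub> e (x, y)) | r x y.
            r \<in> carrier R \<and> x \<in> carrier M \<and> y \<in> carrier N} \<union>
         {e (x, r \<odot>\<^bsub>N\<^esub> y) \<ominus>\<^bsub>F\<^esub> (r \<odot>\<^bsub>F\<^esub> e (x, y)) | r x y.
            r \<in> carrier R \<and> x \<in> carrier M \<and> y \<in> carrier N}))"

definition pure_tensor ::
  "('k, 'r) ring_scheme \<Rightarrow> ('k, 'a, 'x) module_scheme \<Rightarrow> ('k, 'b, 'y) module_scheme \<Rightarrow>
   'a \<Rightarrow> 'b \<Rightarrow> ('a \<times> 'b \<Rightarrow> 'k) set"
  where "pure_tensor R M N x y =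
    tensor_relations R M N +>\<^bsub>free_mod R (carrier M \<times> carrier N)\<^esub> free_gen R (x, y)"

definition tensor ::
  "('k, 'r) ring_scheme \<Rightarrow> ('k, 'a, 'x) supermodule_scheme \<Rightarrow> ('k, 'b, 'y) supermodule_scheme \<Rightarrow>
   ('k, ('a \<times> 'b \<Rightarrow> 'k) set) supermodule"
  where "tensor R M N =
    (let T = quot_mod (free_mod R (carrier M \<times> carrier N)) (tensor_relations R M N) in
       with_grading T (\<lambda>d. mod_span R T
         {pure_tensor R M N x y | x y a b. x \<in> homog M a \<and> y \<in> homog N b \<and> a + b = d}))"

text \<open>
  For a bilinear map \<open>\<beta>\<close> into \<open>P\<close>, the linear map \<open>x \<otimes> y \<mapsto> \<beta> x y\<close> on the tensor product,
  evaluated on any representative of the coset \<open>T\<close>.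
\<close>

definition tensor_lift ::
  "('k, 'r) ring_scheme \<Rightarrow> ('k, 'c, 'z) module_scheme \<Rightarrow> ('a \<Rightarrow> 'b \<Rightarrow> 'c) \<Rightarrow>
   ('a \<times> 'b \<Rightarrow> 'k) set \<Rightarrow> 'c"
  where "tensor_lift R P \<beta> T =
    the_elem ((\<lambda>g. \<Oplus>\<^bsub>P\<^esub>z \<in> {z. g z \<noteq> \<zero>\<^bsub>R\<^esub>}. g z \<odot>\<^bsub>P\<^esub> \<beta> (fst z) (snd z)) ` T)"


section \<open>The Lie superalgebra \<open>uce L\<close> and first cyclic homology\<close>

text \<open>
  The submodules defining \<open>uce L\<close> (inside \<open>L \<otimes> L\<close>) and \<open>HC\<^sub>1 A\<close> (inside \<open>A \<otimes> A\<close>) are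
  spanned by literally the same expressions, once formed with the bracket of \<open>L\<close> and once with the
  product of \<open>A\<close>; both are instances of the following definition.
\<close>

definition cyclic_relations ::
  "('k, 'r) ring_scheme \<Rightarrow> ('k, 'a, 'x) supermodule_scheme \<Rightarrow> ('a \<times> 'a \<Rightarrow> 'k) set set"
  where "cyclic_relations R L =
    (let T = tensor R L L; t = pure_tensor R L L in
       mod_span R T
        ({t x y \<oplus>\<^bsub>T\<^esub> ksign T (a * b) (t y x) | x y a b. x \<in> homog L a \<and> y \<in> homog L b} \<union>
         {t x x | x. x \<in> homog L 0} \<union>
         {ksign T (a * c) (t x (y \<otimes>\<^bsub>L\<^esub> z))
          \<oplus>\<^bsub>T\<^esub> ksign T (b * a) (t y (z \<otimes>\<^bsub>L\<^esub> x))
          \<oplus>\<^bsub>T\<^esub> ksign T (c * b) (t z (x \<otimes>\<^bsub>L\<^esub> y)) | x y z a b c.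
            x \<in> homog L a \<and> y \<in> homog L b \<and> z \<in> homog L c}))"

definition cyclic_quotient ::
  "('k, 'r) ring_scheme \<Rightarrow> ('k, 'a, 'x) supermodule_scheme \<Rightarrow>
   ('k, ('a \<times> 'a \<Rightarrow> 'k) set set) supermodule"
  where "cyclic_quotient R L = quot_supermod (tensor R L L) (cyclic_relations R L)"

text \<open>The symbols \<open>\<langle>x, y\<rangle>\<close> of \<open>uce L\<close> and \<open>\<lless>a, b\<ggreater>\<close> of \<open>HC\<^sub>1 A\<close>.\<close>

definition symb ::
  "('k, 'r) ring_scheme \<Rightarrow> ('k, 'a, 'x) supermodule_scheme \<Rightarrow> 'a \<Rightarrow> 'a \<Rightarrow> ('a \<times> 'a \<Rightarrow> 'k) set set"
  where "symb R L x y = cyclic_relations R L +>\<^bsub>tensor R L L\<^esub> pure_tensor R L L x y"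

definition HC1 ::
  "('k, 'r) ring_scheme \<Rightarrow> ('k, 'a, 'x) supermodule_scheme \<Rightarrow>
   ('k, ('a \<times> 'a \<Rightarrow> 'k) set set) supermodule"
  where "HC1 R A = cyclic_quotient R A"

text \<open>The linear map \<open>\<langle>x, y\<rangle> \<mapsto> [x, y]\<close>.\<close>

definition uce_map ::
  "('k, 'r) ring_scheme \<Rightarrow> ('k, 'a, 'x) supermodule_scheme \<Rightarrow> ('a \<times> 'a \<Rightarrow> 'k) set set \<Rightarrow> 'a"
  where "uce_map R L U = the_elem (tensor_lift R L (mult L) ` U)"

text \<open>
  The product of \<open>uce L\<close> is the bilinear extension of \<open>(\<langle>l\<^sub>1, l\<^sub>2\<rangle>, \<langle>l\<^sub>3, l\<^sub>4\<rangle>) \<mapsto> \<langle>[l\<^sub>1, l\<^sub>2], [l\<^sub>3, l\<^sub>4]\<rangle>\<close>;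
  as \<open>\<langle>-, -\<rangle>\<close> is bilinear and \<^const>\<open>uce_map\<close> is linear with \<open>\<langle>x, y\<rangle> \<mapsto> [x, y]\<close>, this extension is
  the map below.
\<close>

definition uce ::
  "('k, 'r) ring_scheme \<Rightarrow> ('k, 'a, 'x) supermodule_scheme \<Rightarrow>
   ('k, ('a \<times> 'a \<Rightarrow> 'k) set set) supermodule"
  where "uce R L = (cyclic_quotient R L)
    \<lparr>mult := (\<lambda>U V. symb R L (uce_map R L U) (uce_map R L V))\<rparr>"


section \<open>Matrix superalgebras\<close>

definition idx_parity :: "nat \<Rightarrow> nat \<Rightarrow> bit"
  where "idx_parity m i = (if i \<le> m then 0 else 1)"

text \<open>
  Matrices are functions that vanish off \<open>{1..m+n} \<times> {1..m+n}\<close>.  Since \<open>E\<^sub>i\<^sub>j(a)\<close> has degree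
  \<open>|i| + |j| + |a|\<close>, a matrix is homogeneous of degree \<open>d\<close> iff its \<open>(i, j)\<close> entry always is
  homogeneous of degree \<open>d + |i| + |j|\<close>.
\<close>

definition Mat :: "nat \<Rightarrow> nat \<Rightarrow> ('k, 'a, 'x) supermodule_scheme \<Rightarrow> ('k, nat \<Rightarrow> nat \<Rightarrow> 'a) supermodule"
  where "Mat m n A = (let J = {1..m+n}; M = {x :: nat \<Rightarrow> nat \<Rightarrow> 'a.
        (\<forall>i \<in> J. \<forall>j \<in> J. x i j \<in> carrier A) \<and>
        (\<forall>i j. i \<notin> J \<or> j \<notin> J \<longrightarrow> x i j = \<zero>\<^bsub>A\<^esub>)} in
    \<lparr>carrier = M,
     mult = (\<lambda>x y i j. if i \<in> J \<and> j \<in> J then \<Oplus>\<^bsub>A\<^esub>l \<in> J. x i l \<otimes>\<^bsub>A\<^esub> y l j else \<zero>\<^bsub>A\<^esub>),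
     one = (\<lambda>i j. if i \<in> J \<and> i = j then \<one>\<^bsub>A\<^esub> else \<zero>\<^bsub>A\<^esub>),
     zero = (\<lambda>i j. \<zero>\<^bsub>A\<^esub>),
     add = (\<lambda>x y i j. x i j \<oplus>\<^bsub>A\<^esub> y i j),
     smult = (\<lambda>r x i j. r \<odot>\<^bsub>A\<^esub> x i j),
     homog = (\<lambda>d. {x \<in> M. \<forall>i \<in> J. \<forall>j \<in> J. x i j \<in> homog A (d + idx_parity m i + idx_parity m j)})\<rparr>)"

text \<open>
  The supercommutator, given by \<open>xy - (-1)\<^bsup>|x||y|\<^esup> yx\<close> on homogeneous elements and extended
  bilinearly through the homogeneous components.
\<close>

definition supercommutator :: "('k, 'a, 'x) supermodule_scheme \<Rightarrow> 'a \<Rightarrow> 'a \<Rightarrow> 'a"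
  where "supercommutator S x y = (\<Oplus>\<^bsub>S\<^esub>a \<in> UNIV. \<Oplus>\<^bsub>S\<^esub>b \<in> UNIV.
    (hpart S a x \<otimes>\<^bsub>S\<^esub> hpart S b y) \<ominus>\<^bsub>S\<^esub> ksign S (a * b) (hpart S b y \<otimes>\<^bsub>S\<^esub> hpart S a x))"

definition gl :: "nat \<Rightarrow> nat \<Rightarrow> ('k, 'a, 'x) supermodule_scheme \<Rightarrow> ('k, nat \<Rightarrow> nat \<Rightarrow> 'a) supermodule"
  where "gl m n A = (Mat m n A)\<lparr>mult := supercommutator (Mat m n A)\<rparr>"

definition sl ::
  "('k, 'r) ring_scheme \<Rightarrow> nat \<Rightarrow> nat \<Rightarrow> ('k, 'a, 'x) supermodule_scheme \<Rightarrow>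
   ('k, nat \<Rightarrow> nat \<Rightarrow> 'a) supermodule"
  where "sl R m n A = (let S = derived R (gl m n A) in
    (gl m n A)\<lparr>carrier := S, homog := (\<lambda>d. homog (gl m n A) d \<inter> S)\<rparr>)"

definition tau ::
  "('k, 'r) ring_scheme \<Rightarrow> nat \<Rightarrow> nat \<Rightarrow> ('k, 'a, 'x) supermodule_scheme \<Rightarrow>
   (nat \<Rightarrow> nat \<Rightarrow> 'a) \<Rightarrow> (nat \<Rightarrow> nat \<Rightarrow> 'a) \<Rightarrow> ('a \<times> 'a \<Rightarrow> 'k) set set"
  where "tau R m n A x y =
    (\<Oplus>\<^bsub>HC1 R A\<^esub>i \<in> {1..m}. \<Oplus>\<^bsub>HC1 R A\<^esub>j \<in> {1..m+n}. symb R A (x i j) (y j i))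
    \<ominus>\<^bsub>HC1 R A\<^esub>
    (\<Oplus>\<^bsub>HC1 R A\<^esub>i \<in> {m+1..m+n}. \<Oplus>\<^bsub>HC1 R A\<^esub>j \<in> {1..m+n}. symb R A (x i j) (y j i))"


section \<open>Direct limits\<close>

definition directed_set :: "'i set \<Rightarrow> ('i \<Rightarrow> 'i \<Rightarrow> bool) \<Rightarrow> bool"
  where "directed_set I leq \<longleftrightarrow> I \<noteq> {} \<and> reflp_on I leq \<and> transp_on I leq \<and>
    (\<forall>i \<in> I. \<forall>j \<in> I. \<exists>l \<in> I. leq i l \<and> leq j l)"

text \<open>As in the indexing \<open>f\<^sub>j\<^sub>i\<close>, the map \<open>f j i\<close> goes from \<open>L i\<close> to \<open>L j\<close>.\<close>

definition lie_directed_system ::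
  "('k, 'r) ring_scheme \<Rightarrow> 'i set \<Rightarrow> ('i \<Rightarrow> 'i \<Rightarrow> bool) \<Rightarrow>
   ('i \<Rightarrow> ('k, 'a, 'x) supermodule_scheme) \<Rightarrow> ('i \<Rightarrow> 'i \<Rightarrow> 'a \<Rightarrow> 'a) \<Rightarrow> bool"
  where "lie_directed_system R I leq L f \<longleftrightarrow>
    (\<forall>i \<in> I. lie_superalgebra R (L i)) \<and>
    (\<forall>i \<in> I. \<forall>j \<in> I. leq i j \<longrightarrow> f j i \<in> lie_hom R (L i) (L j)) \<and>
    (\<forall>i \<in> I. \<forall>x \<in> carrier (L i). f i i x = x) \<and>
    (\<forall>i \<in> I. \<forall>j \<in> I. \<forall>l \<in> I. leq i j \<longrightarrow> leq j l \<longrightarrow>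
        (\<forall>x \<in> carrier (L i). f l i x = f l j (f j i x)))"

text \<open>
  The canonical map from \<open>L i\<close> to the direct limit: it sends \<open>x\<close> to the class of \<open>(i, x)\<close> in the
  disjoint union of the \<open>L j\<close>.
\<close>

definition lim_inj ::
  "'i set \<Rightarrow> ('i \<Rightarrow> 'i \<Rightarrow> bool) \<Rightarrow> ('i \<Rightarrow> ('k, 'a, 'x) supermodule_scheme) \<Rightarrow>
   ('i \<Rightarrow> 'i \<Rightarrow> 'a \<Rightarrow> 'a) \<Rightarrow> 'i \<Rightarrow> 'a \<Rightarrow> ('i \<times> 'a) set"
  where "lim_inj I leq L f i x =
    {(j, y). j \<in> I \<and> y \<in> carrier (L j) \<and> (\<exists>l \<in> I. leq i l \<and> leq j l \<and> f l i x = f l j y)}"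

definition direct_limit ::
  "'i set \<Rightarrow> ('i \<Rightarrow> 'i \<Rightarrow> bool) \<Rightarrow> ('i \<Rightarrow> ('k, 'a, 'x) supermodule_scheme) \<Rightarrow>
   ('i \<Rightarrow> 'i \<Rightarrow> 'a \<Rightarrow> 'a) \<Rightarrow> ('k, ('i \<times> 'a) set) supermodule"
  where "direct_limit I leq L f = (let \<phi> = lim_inj I leq L f in
    \<lparr>carrier = (\<Union>i \<in> I. \<phi> i ` carrier (L i)),
     mult = (\<lambda>X Y. \<Union>{\<phi> l (f l i x \<otimes>\<^bsub>L l\<^esub> f l j y) | i x j y l.
        (i, x) \<in> X \<and> (j, y) \<in> Y \<and> l \<in> I \<and> leq i l \<and> leq j l}),
     one = undefined,
     zero = (\<Union>i \<in> I. \<phi> i \<zero>\<^bsub>L i\<^esub>),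
     add = (\<lambda>X Y. \<Union>{\<phi> l (f l i x \<oplus>\<^bsub>L l\<^esub> f l j y) | i x j y l.
        (i, x) \<in> X \<and> (j, y) \<in> Y \<and> l \<in> I \<and> leq i l \<and> leq j l}),
     smult = (\<lambda>r X. \<Union>{\<phi> i (r \<odot>\<^bsub>L i\<^esub> x) | i x. (i, x) \<in> X}),
     homog = (\<lambda>d. \<Union>i \<in> I. \<phi> i ` homog (L i) d)\<rparr>)"

definition sl_inj ::
  "('k, 'r) ring_scheme \<Rightarrow> ('k, 'a, 'x) supermodule_scheme \<Rightarrow> 'i set \<Rightarrow> ('i \<Rightarrow> 'i \<Rightarrow> bool) \<Rightarrow>
   ('i \<Rightarrow> nat) \<Rightarrow> ('i \<Rightarrow> nat) \<Rightarrow>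
   ('i \<Rightarrow> 'i \<Rightarrow> (nat \<Rightarrow> nat \<Rightarrow> 'a) \<Rightarrow> (nat \<Rightarrow> nat \<Rightarrow> 'a)) \<Rightarrow>
   'i \<Rightarrow> (nat \<Rightarrow> nat \<Rightarrow> 'a) \<Rightarrow> ('i \<times> (nat \<Rightarrow> nat \<Rightarrow> 'a)) set"
  where "sl_inj R A I leq m n f = lim_inj I leq (\<lambda>i. sl R (m i) (n i) A) f"

definition sl_lim ::
  "('k, 'r) ring_scheme \<Rightarrow> ('k, 'a, 'x) supermodule_scheme \<Rightarrow> 'i set \<Rightarrow> ('i \<Rightarrow> 'i \<Rightarrow> bool) \<Rightarrow>
   ('i \<Rightarrow> nat) \<Rightarrow> ('i \<Rightarrow> nat) \<Rightarrow>
   ('i \<Rightarrow> 'i \<Rightarrow> (nat \<Rightarrow> nat \<Rightarrow> 'a) \<Rightarrow> (nat \<Rightarrow> nat \<Rightarrow> 'a)) \<Rightarrow>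
   ('k, ('i \<times> (nat \<Rightarrow> nat \<Rightarrow> 'a)) set) supermodule"
  where "sl_lim R A I leq m n f = direct_limit I leq (\<lambda>i. sl R (m i) (n i) A) f"

text \<open>
  The defining equation of \<open>\<tau>\<^sub>I\<close>.  It has to hold for all representatives \<open>x\<^sub>p\<close>, \<open>y\<^sub>q\<close> and all upper
  bounds \<open>l\<close>, so the existence of such a map is the independence of the right-hand side from these
  choices; on \<open>sl(I;A)\<close> the map is then unique.  Independence is not automatic for arbitrary
  Lie superalgebra morphisms \<open>f\<^sub>j\<^sub>i\<close>: zero maps, for instance, violate it as soon as some
  \<open>\<tau>\<close> on a finite stage is nonzero.
\<close>

definition is_tau_lim ::
  "('k, 'r) ring_scheme \<Rightarrow> ('k, 'a, 'x) supermodule_scheme \<Rightarrow> 'i set \<Rightarrow> ('i \<Rightarrow> 'i \<Rightarrow> bool) \<Rightarrow>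
   ('i \<Rightarrow> nat) \<Rightarrow> ('i \<Rightarrow> nat) \<Rightarrow>
   ('i \<Rightarrow> 'i \<Rightarrow> (nat \<Rightarrow> nat \<Rightarrow> 'a) \<Rightarrow> (nat \<Rightarrow> nat \<Rightarrow> 'a)) \<Rightarrow>
   (('i \<times> (nat \<Rightarrow> nat \<Rightarrow> 'a)) set \<Rightarrow> ('i \<times> (nat \<Rightarrow> nat \<Rightarrow> 'a)) set \<Rightarrow> ('a \<times> 'a \<Rightarrow> 'k) set set) \<Rightarrow> bool"
  where "is_tau_lim R A I leq m n f \<tau> \<longleftrightarrow>
    (\<forall>p \<in> I. \<forall>q \<in> I. \<forall>l \<in> I. leq p l \<longrightarrow> leq q l \<longrightarrow>
      (\<forall>x \<in> carrier (sl R (m p) (n p) A). \<forall>y \<in> carrier (sl R (m q) (n q) A).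
         \<tau> (sl_inj R A I leq m n f p x) (sl_inj R A I leq m n f q y)
         = tau R (m l) (n l) A (f l p x) (f l q y)))"

end

theory Submission
  imports Defs
begin

text \<open>
  The symbols \<open>\<langle>x, y\<rangle>\<close> form the universal 2-cocycle on a Lie superalgebra \<open>L\<close>: a 2-cocycle \<open>\<tau>\<close> with
  values in \<open>C\<close> is the same thing as a degree-preserving linear map out of \<open>uce L\<close> with \<open>\<langle>x, y\<rangle> \<mapsto> \<tau>(x, y)\<close>.  So any
  cocycle \<open>\<tau>\<close> comes with a comparison map \<open>h: \<langle>x, y\<rangle> \<mapsto> [x, y] \<oplus> \<tau>(x, y)\<close> from \<open>uce L\<close> to the extension of
  \<open>L\<close> by \<open>\<tau>\<close>, and the question is when \<open>h\<close> is bijective.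

  Both sides are compatible with direct limits.  Let \<open>\<phi>\<^sub>i\<close> be the canonical maps to the limit and
  \<open>h\<^sub>i\<close> the comparison map of stage \<open>i\<close>.  The equation that defines \<open>\<tau>\<^sub>I\<close>, read for two
  elements of stage \<open>i\<close> and the upper bounds \<open>i\<close> and \<open>j\<close>, says that \<open>\<phi>\<^sub>i\<close> and the transition map
  \<open>f\<^sub>j\<^sub>i\<close> respect the cocycles, so the comparison maps are natural for all of them (\<open>uce_to_extension_natural\<close>).

  Surjectivity in the limit: an element \<open>\<phi>\<^sub>i(x) \<oplus> c\<close> is the image of \<open>x \<oplus> c\<close>, which \<open>h\<^sub>i\<close> reaches.
  Injectivity: an element of \<open>uce\<close> of the limit involves finitely many symbols, hence comes from some
  \<open>V\<close> at a stage \<open>i\<close> (\<open>cyclic_quotient_stage\<close>).  If its image vanishes, then the component of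
  \<open>h\<^sub>i(V)\<close> in the coefficients is zero and the other one dies at a later stage \<open>j\<close>; so \<open>h\<^sub>j\<close> kills the
  image of \<open>V\<close> at stage \<open>j\<close>, and this image is zero because \<open>h\<^sub>j\<close> is injective.  This is
  \<open>limit_comparison_bij\<close>.

  Once the comparison map is bijective, everything else follows (\<open>uce_iso_extension\<close>).  It
  preserves degrees, so the even and the odd part of \<open>uce\<close> meet in zero only, which is the one axiom
  of a Lie superalgebra that is not formal for \<open>uce\<close>; and composed with the projection it is the
  canonical map of \<open>uce\<close>, which is therefore surjective, so the limit is perfect.

  The argument is carried out for an arbitrary directed system of Lie superalgebras, in the locale
  \<open>lie_directed_limit\<close>; the special linear ones are then substituted.
\<close>

(* The default simp rules turn sums and products of degrees into bit operations; signs and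
   degrees are compared syntactically here. *)
declare add_bit_eq_xor [simp del] mult_bit_eq_and [simp del]

section \<open>Linear maps, submodules and quotients\<close>

definition linear_map ::
  "('k, 'r) ring_scheme \<Rightarrow> ('k, 'a, 'x) module_scheme \<Rightarrow> ('k, 'b, 'y) module_scheme \<Rightarrow>
   ('a \<Rightarrow> 'b) \<Rightarrow> bool"
  where "linear_map R M N f \<longleftrightarrow> f \<in> carrier M \<rightarrow> carrier N \<and>
    (\<forall>x \<in> carrier M. \<forall>y \<in> carrier M. f (x \<oplus>\<^bsub>M\<^esub> y) = f x \<oplus>\<^bsub>N\<^esub> f y) \<and>
    (\<forall>r \<in> carrier R. \<forall>x \<in> carrier M. f (r \<odot>\<^bsub>M\<^esub> x) = r \<odot>\<^bsub>N\<^esub> f x)"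

lemma linear_map_closed: "linear_map R M N f \<Longrightarrow> x \<in> carrier M \<Longrightarrow> f x \<in> carrier N"
  and linear_map_add: "linear_map R M N f \<Longrightarrow> x \<in> carrier M \<Longrightarrow> y \<in> carrier M \<Longrightarrow>
    f (x \<oplus>\<^bsub>M\<^esub> y) = f x \<oplus>\<^bsub>N\<^esub> f y"
  and linear_map_smult: "linear_map R M N f \<Longrightarrow> r \<in> carrier R \<Longrightarrow> x \<in> carrier M \<Longrightarrow>
    f (r \<odot>\<^bsub>M\<^esub> x) = r \<odot>\<^bsub>N\<^esub> f x"
  by (auto simp: linear_map_def)

lemma linear_map_comp:
  assumes "linear_map R M N f" "linear_map R N P g"
  shows "linear_map R M P (\<lambda>x. g (f x))"
  using assms by (auto simp: linear_map_def Pi_iff)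

lemma lie_hom_linear: "f \<in> lie_hom R L L' \<Longrightarrow> linear_map R L L' f"
  by (auto simp: lie_hom_def linear_map_def)

lemma linear_map_zero:
  assumes "module R M" "module R N" "linear_map R M N f"
  shows "f \<zero>\<^bsub>M\<^esub> = \<zero>\<^bsub>N\<^esub>"
proof -
  interpret M: module R M by fact
  interpret N: module R N by fact
  have "f \<zero>\<^bsub>M\<^esub> = f (\<zero>\<^bsub>R\<^esub> \<odot>\<^bsub>M\<^esub> \<zero>\<^bsub>M\<^esub>)" by simp
  also have "\<dots> = \<zero>\<^bsub>R\<^esub> \<odot>\<^bsub>N\<^esub> f \<zero>\<^bsub>M\<^esub>" by (rule linear_map_smult[OF assms(3)]) auto
  finally show ?thesis using linear_map_closed[OF assms(3)] by simp
qed

lemma linear_map_minus: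
  assumes "module R M" "module R N" "linear_map R M N f" "x \<in> carrier M"
  shows "f (\<ominus>\<^bsub>M\<^esub> x) = \<ominus>\<^bsub>N\<^esub> f x"
proof -
  interpret M: module R M by fact
  interpret N: module R N by fact
  have "f (\<ominus>\<^bsub>M\<^esub> x) \<oplus>\<^bsub>N\<^esub> f x = f (\<ominus>\<^bsub>M\<^esub> x \<oplus>\<^bsub>M\<^esub> x)"
    using assms by (simp add: linear_map_add)
  also have "\<dots> = \<zero>\<^bsub>N\<^esub>" using assms by (simp add: M.l_neg linear_map_zero)
  finally show ?thesis
    using assms linear_map_closed[OF assms(3)] by (simp add: N.minus_equality)
qed

lemma linear_map_ksign:
  assumes "module R M" "module R N" "linear_map R M N f" "x \<in> carrier M"
  shows "f (ksign M d x) = ksign N d (f x)"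
  using linear_map_minus[OF assms] by (simp add: ksign_def)

lemma ksign_closed: "abelian_group M \<Longrightarrow> x \<in> carrier M \<Longrightarrow> ksign M d x \<in> carrier M"
  by (simp add: ksign_def abelian_group.a_inv_closed)

lemma submodule_closed:
  assumes "module R M" "submodule N R M"
  shows "x \<in> N \<Longrightarrow> x \<in> carrier M" "\<zero>\<^bsub>M\<^esub> \<in> N" "x \<in> N \<Longrightarrow> y \<in> N \<Longrightarrow> x \<oplus>\<^bsub>M\<^esub> y \<in> N"
    "r \<in> carrier R \<Longrightarrow> x \<in> N \<Longrightarrow> r \<odot>\<^bsub>M\<^esub> x \<in> N" "x \<in> N \<Longrightarrow> \<ominus>\<^bsub>M\<^esub> x \<in> N"
    "x \<in> N \<Longrightarrow> ksign M d x \<in> N"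
proof -
  note E = module.submoduleE[OF assms]
  show "x \<in> N \<Longrightarrow> x \<in> carrier M" "x \<in> N \<Longrightarrow> y \<in> N \<Longrightarrow> x \<oplus>\<^bsub>M\<^esub> y \<in> N"
    "r \<in> carrier R \<Longrightarrow> x \<in> N \<Longrightarrow> r \<odot>\<^bsub>M\<^esub> x \<in> N" "x \<in> N \<Longrightarrow> \<ominus>\<^bsub>M\<^esub> x \<in> N"
    using E by auto
  then show "x \<in> N \<Longrightarrow> ksign M d x \<in> N" by (simp add: ksign_def)
  show "\<zero>\<^bsub>M\<^esub> \<in> N"
    using subgroup.one_closed[OF submodule.axioms(1)[OF assms(2)]] by simp
qed

text \<open>
  Negation is multiplication by the scalar \<open>-1\<close>.
\<close>

lemma submoduleI_no_minus:
  assumes "module R M" "N \<subseteq> carrier M" "\<zero>\<^bsub>M\<^esub> \<in> N"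
    "\<And>x y. x \<in> N \<Longrightarrow> y \<in> N \<Longrightarrow> x \<oplus>\<^bsub>M\<^esub> y \<in> N"
    "\<And>r x. r \<in> carrier R \<Longrightarrow> x \<in> N \<Longrightarrow> r \<odot>\<^bsub>M\<^esub> x \<in> N"
  shows "submodule N R M"
proof -
  interpret module R M by fact
  have "\<ominus>\<^bsub>M\<^esub> x \<in> N" if "x \<in> N" for x
  proof -
    have "\<ominus>\<^bsub>M\<^esub> x = (\<ominus>\<^bsub>R\<^esub> \<one>\<^bsub>R\<^esub>) \<odot>\<^bsub>M\<^esub> x"
      using that assms(2) smult_l_minus[of "\<one>\<^bsub>R\<^esub>" x] by auto
    then show ?thesis using that assms(5) by simp
  qed
  then show ?thesis using assms(2-) by (intro submoduleI) auto
qed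

lemma submodule_vimage:
  assumes "module R M" "module R N" "linear_map R M N f" "submodule S R N"
  shows "submodule {x \<in> carrier M. f x \<in> S} R M"
proof -
  interpret M: module R M by fact
  show ?thesis
    using linear_map_zero[OF assms(1-3)] linear_map_add[OF assms(3)] linear_map_smult[OF assms(3)]
      submodule_closed[OF assms(2,4)]
    by (intro submoduleI_no_minus[OF assms(1)]) auto
qed

lemma submodule_image:
  assumes "module R M" "module R N" "linear_map R M N f" "submodule S R M"
  shows "submodule (f ` S) R N"
proof (rule submoduleI_no_minus[OF assms(2)])
  note S = submodule_closed[OF assms(1,4)]
  show "f ` S \<subseteq> carrier N" using S(1) linear_map_closed[OF assms(3)] by auto
  show "\<zero>\<^bsub>N\<^esub> \<in> f ` S" using S(2) linear_map_zero[OF assms(1-3)] by (metis imageI)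
  show "x \<oplus>\<^bsub>N\<^esub> y \<in> f ` S" if "x \<in> f ` S" "y \<in> f ` S" for x y
    using that S(1,3) linear_map_add[OF assms(3)] by (smt (verit) imageE imageI)
  show "r \<odot>\<^bsub>N\<^esub> x \<in> f ` S" if "r \<in> carrier R" "x \<in> f ` S" for r x
    using that S(1,4) linear_map_smult[OF assms(3)] by (smt (verit) imageE imageI)
qed

lemma mod_span_superset: "S \<subseteq> mod_span R M S"
  by (auto simp: mod_span_def)

lemma mod_span_least: "submodule N R M \<Longrightarrow> S \<subseteq> N \<Longrightarrow> mod_span R M S \<subseteq> N"
  by (auto simp: mod_span_def)

lemma mod_span_submodule:
  assumes "module R M" "S \<subseteq> carrier M"
  shows "submodule (mod_span R M S) R M"
proof (rule submoduleI_no_minus[OF assms(1)])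
  show "mod_span R M S \<subseteq> carrier M"
    using assms module.carrier_is_submodule by (intro mod_span_least) auto
qed (auto simp: mod_span_def dest: submodule_closed(2-)[OF assms(1)])

lemma zero_submodule: "module R M \<Longrightarrow> submodule {\<zero>\<^bsub>M\<^esub>} R M"
  by (rule submoduleI_no_minus) (auto simp: module_def abelian_group_def abelian_monoid.zero_closed
      abelian_monoid.l_zero module.smult_r_null)

text \<open>
  The module axioms are equations, and the negative of \<open>p x\<close> is \<open>p (-x)\<close>.  Quotients get
  their module axioms from this.
\<close>

lemma module_of_surjection:
  assumes "module R M" "linear_map R M N p" "p ` carrier M = carrier N" "p \<zero>\<^bsub>M\<^esub> = \<zero>\<^bsub>N\<^esub>"
  shows "module R N"
proof -
  interpret M: module R M by fact
  note [simp] = linear_map_add[OF assms(2), symmetric] linear_map_smult[OF assms(2), symmetric]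
    assms(4)[symmetric]
  show ?thesis
  proof (rule moduleI[OF M.R.is_cring])
    show "abelian_group N"
    proof (rule abelian_groupI)
      fix x assume "x \<in> carrier N"
      then obtain x' where "x' \<in> carrier M" "x = p x'" using assms(3) by auto
      then show "\<exists>y \<in> carrier N. y \<oplus>\<^bsub>N\<^esub> x = \<zero>\<^bsub>N\<^esub>"
        using linear_map_closed[OF assms(2)] by (intro bexI[of _ "p (\<ominus>\<^bsub>M\<^esub> x')"]) (auto simp: M.l_neg)
    qed (auto simp flip: assms(3) simp: M.a_ac)
  qed (auto simp flip: assms(3) simp: M.smult_l_distr M.smult_r_distr M.smult_assoc1)
qed

lemma module_cong:
  assumes "module R M" "carrier M' = carrier M" "add M' = add M" "zero M' = zero M"
    "smult M' = smult M"
  shows "module R M'"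
proof (rule module_of_surjection[OF assms(1)])
  interpret M: module R M by fact
  show "linear_map R M M' (\<lambda>x. x)" using assms by (auto simp: linear_map_def)
qed (use assms in auto)

lemma coset_sum:
  assumes "module R M" "submodule N R M" "x \<in> carrier M" "y \<in> carrier M"
  shows "(N +>\<^bsub>M\<^esub> x) <+>\<^bsub>M\<^esub> (N +>\<^bsub>M\<^esub> y) = N +>\<^bsub>M\<^esub> (x \<oplus>\<^bsub>M\<^esub> y)"
proof -
  interpret M: module R M by fact
  interpret abelian_subgroup N M
    using assms(2) M.abelian_group_axioms
    by (intro abelian_subgroupI3 additive_subgroupI) (auto dest: submodule.axioms)
  show ?thesis using a_rcos_sum assms by blast
qed

text \<open>
  The elements of \<open>N + x\<close> are the sums \<open>h + x\<close> with \<open>h \<in> N\<close>.  This makes the value that \<^const>\<open>the_elem\<close>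
  selects well defined when a linear map descends to a quotient.
\<close>

lemma linear_map_coset:
  assumes "module R M" "submodule N R M" "module R P" "linear_map R M P f"
    "\<And>h. h \<in> N \<Longrightarrow> f h = \<zero>\<^bsub>P\<^esub>" "x \<in> carrier M"
  shows "f ` (N +>\<^bsub>M\<^esub> x) = {f x}"
proof -
  interpret P: abelian_group P using assms(3) by (simp add: module_def)
  have N: "h \<in> carrier M" if "h \<in> N" for h using that submodule_closed[OF assms(1,2)] by auto
  have "f (h \<oplus>\<^bsub>M\<^esub> x) = f x" if "h \<in> N" for h
    using that N assms(6) linear_map_add[OF assms(4)] linear_map_closed[OF assms(4)]
    by (simp add: assms(5))
  then have "(\<lambda>h. f (h \<oplus>\<^bsub>M\<^esub> x)) ` N = (\<lambda>h. f x) ` N" by (rule image_cong[OF refl])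
  moreover have "N \<noteq> {}" using submodule_closed(2)[OF assms(1,2)] by auto
  ultimately show ?thesis by (simp add: a_r_coset_def' image_image image_constant_conv UNION_singleton_eq_range)
qed

lemma
  assumes "module R M" "submodule N R M"
  shows quot_mod_module: "module R (quot_mod M N)"
    and quot_proj_linear: "linear_map R M (quot_mod M N) (\<lambda>x. N +>\<^bsub>M\<^esub> x)"
    and quot_proj_surj: "(\<lambda>x. N +>\<^bsub>M\<^esub> x) ` carrier M = carrier (quot_mod M N)"
    and quot_proj_zero: "x \<in> N \<Longrightarrow> N +>\<^bsub>M\<^esub> x = \<zero>\<^bsub>quot_mod M N\<^esub>"
proof -
  interpret M: module R M by fact
  have sg: "subgroup N (add_monoid M)" using assms(2) by (rule submodule.axioms)
  note N = submodule_closed[OF assms]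
  show z: "x \<in> N \<Longrightarrow> N +>\<^bsub>M\<^esub> x = \<zero>\<^bsub>quot_mod M N\<^esub>" for x
    using M.a_coset_join2 N sg by (simp add: quot_mod_def)
  show s: "(\<lambda>x. N +>\<^bsub>M\<^esub> x) ` carrier M = carrier (quot_mod M N)"
    by (auto simp: quot_mod_def A_RCOSETS_def')
  \<comment> \<open>Multiplication by \<open>r\<close> maps \<open>N\<close> into \<open>N\<close>, so all cosets in the union coincide.\<close>
  have sm: "(\<Union>y \<in> N +>\<^bsub>M\<^esub> x. N +>\<^bsub>M\<^esub> (r \<odot>\<^bsub>M\<^esub> y)) = N +>\<^bsub>M\<^esub> (r \<odot>\<^bsub>M\<^esub> x)"
    if "r \<in> carrier R" "x \<in> carrier M" for r x
  proof -
    have "N +>\<^bsub>M\<^esub> (r \<odot>\<^bsub>M\<^esub> (h \<oplus>\<^bsub>M\<^esub> x)) = N +>\<^bsub>M\<^esub> (r \<odot>\<^bsub>M\<^esub> x)" if "h \<in> N" for h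
    proof -
      have "r \<odot>\<^bsub>M\<^esub> (h \<oplus>\<^bsub>M\<^esub> x) \<in> N +>\<^bsub>M\<^esub> (r \<odot>\<^bsub>M\<^esub> x)"
        using that \<open>r \<in> carrier R\<close> \<open>x \<in> carrier M\<close> N by (auto simp: M.smult_r_distr a_r_coset_def')
      then show ?thesis
        using M.a_repr_independence[OF _ _ sg] \<open>r \<in> carrier R\<close> \<open>x \<in> carrier M\<close> by simp
    qed
    then show ?thesis using N(2) by (auto simp: a_r_coset_def')
  qed
  show l: "linear_map R M (quot_mod M N) (\<lambda>x. N +>\<^bsub>M\<^esub> x)"
    using s sm coset_sum[OF assms] by (auto simp: linear_map_def quot_mod_def)
  show "module R (quot_mod M N)"
    by (rule module_of_surjection[OF assms(1) l s z]) (rule N)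
qed

lemma with_grading_simps [simp]:
  "carrier (with_grading M g) = carrier M" "\<zero>\<^bsub>with_grading M g\<^esub> = \<zero>\<^bsub>M\<^esub>"
  "add (with_grading M g) = add M" "smult (with_grading M g) = smult M"
  "homog (with_grading M g) = g"
  by (simp_all add: with_grading_def module.extend_def)

lemma with_grading_module: "module R M \<Longrightarrow> module R (with_grading M g)"
  by (erule module_cong) simp_all

lemma with_grading_linear_from: "linear_map R (with_grading M g) N f \<longleftrightarrow> linear_map R M N f"
  by (simp add: linear_map_def)

lemma with_grading_linear_to: "linear_map R N (with_grading M g) f \<longleftrightarrow> linear_map R N M f"
  by (simp add: linear_map_def)

lemma quot_proj_eq:
  assumes "module R M" "submodule N R M" "a \<in> carrier M" "b \<in> carrier M" "a \<ominus>\<^bsub>M\<^esub> b \<in> N"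
  shows "N +>\<^bsub>M\<^esub> a = N +>\<^bsub>M\<^esub> b"
proof -
  interpret M: module R M by fact
  have "(a \<ominus>\<^bsub>M\<^esub> b) \<oplus>\<^bsub>M\<^esub> b = a"
    using assms(3,4) by (simp add: a_minus_def M.a_assoc M.l_neg)
  then have "a \<in> N +>\<^bsub>M\<^esub> b" using assms(5) unfolding a_r_coset_def' by blast
  then show ?thesis
    using M.a_repr_independence assms(2,4) by (metis submodule.axioms(1))
qed

lemma quot_lift_proj:
  assumes "module R M" "submodule N R M" "module R P" "linear_map R M P f"
    "\<And>h. h \<in> N \<Longrightarrow> f h = \<zero>\<^bsub>P\<^esub>" "x \<in> carrier M"
  shows "the_elem (f ` (N +>\<^bsub>M\<^esub> x)) = f x"
  by (simp add: linear_map_coset[OF assms])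

lemma quot_lift_linear:
  assumes "module R M" "submodule N R M" "module R P" "linear_map R M P f"
    "\<And>h. h \<in> N \<Longrightarrow> f h = \<zero>\<^bsub>P\<^esub>"
  shows "linear_map R (quot_mod M N) P (\<lambda>T. the_elem (f ` T))"
proof -
  interpret M: module R M by fact
  note proj = quot_lift_proj[OF assms]
  note lin = quot_proj_linear[OF assms(1,2)]
  show ?thesis
    unfolding linear_map_def quot_proj_surj[OF assms(1,2), symmetric]
    using linear_map_closed[OF assms(4)] linear_map_add[OF assms(4)] linear_map_smult[OF assms(4)]
    by (auto simp: proj linear_map_add[OF lin, symmetric] linear_map_smult[OF lin, symmetric])
qed


lemma with_grading_submodule: "submodule N R (with_grading M g) \<longleftrightarrow> submodule N R M"
  by (simp add: submodule_def submodule_axioms_def subgroup_def m_inv_def)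

lemma with_grading_mod_span: "mod_span R (with_grading M g) S = mod_span R M S"
  by (simp add: mod_span_def with_grading_submodule)

section \<open>Free modules\<close>

lemma free_mod_simps [simp]:
  "carrier (free_mod R X) =
    {g. (\<forall>z \<in> X. g z \<in> carrier R) \<and> (\<forall>z. z \<notin> X \<longrightarrow> g z = \<zero>\<^bsub>R\<^esub>) \<and> finite {z. g z \<noteq> \<zero>\<^bsub>R\<^esub>}}"
  "\<zero>\<^bsub>free_mod R X\<^esub> = (\<lambda>z. \<zero>\<^bsub>R\<^esub>)"
  "g \<oplus>\<^bsub>free_mod R X\<^esub> h = (\<lambda>z. g z \<oplus>\<^bsub>R\<^esub> h z)"
  "r \<odot>\<^bsub>free_mod R X\<^esub> g = (\<lambda>z. r \<otimes>\<^bsub>R\<^esub> g z)"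
  by (simp_all add: free_mod_def)

lemma free_mod_coeff:
  assumes "cring R" "g \<in> carrier (free_mod R X)"
  shows "g z \<in> carrier R"
proof -
  interpret cring R by fact
  show ?thesis using assms(2) by (cases "z \<in> X") auto
qed

lemma free_mod_module:
  assumes "cring R"
  shows "module R (free_mod R X)"
proof -
  interpret cring R by fact
  let ?F = "free_mod R X"
  note c = free_mod_coeff[OF assms, where X = X]
  have add: "(\<lambda>z. g z \<oplus>\<^bsub>R\<^esub> h z) \<in> carrier ?F" if "g \<in> carrier ?F" "h \<in> carrier ?F" for g h
  proof -
    have "finite ({z. g z \<noteq> \<zero>\<^bsub>R\<^esub>} \<union> {z. h z \<noteq> \<zero>\<^bsub>R\<^esub>})" using that by simp
    then have "finite {z. g z \<oplus>\<^bsub>R\<^esub> h z \<noteq> \<zero>\<^bsub>R\<^esub>}" by (rule finite_subset[rotated]) auto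
    then show ?thesis using that by auto
  qed
  have smult: "(\<lambda>z. r \<otimes>\<^bsub>R\<^esub> g z) \<in> carrier ?F" if "r \<in> carrier R" "g \<in> carrier ?F" for g r
  proof -
    have "finite {z. g z \<noteq> \<zero>\<^bsub>R\<^esub>}" using that by simp
    then have "finite {z. r \<otimes>\<^bsub>R\<^esub> g z \<noteq> \<zero>\<^bsub>R\<^esub>}" by (rule finite_subset[rotated]) (use that in auto)
    then show ?thesis using that by auto
  qed
  show ?thesis
  proof (rule moduleI[OF assms])
    show "abelian_group ?F"
    proof (rule abelian_groupI)
      fix g assume g: "g \<in> carrier ?F"
      have "(\<lambda>z. (\<ominus>\<^bsub>R\<^esub> \<one>\<^bsub>R\<^esub>) \<otimes>\<^bsub>R\<^esub> g z) \<in> carrier ?F" using g by (intro smult) auto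
      moreover have "(\<lambda>z. (\<ominus>\<^bsub>R\<^esub> \<one>\<^bsub>R\<^esub>) \<otimes>\<^bsub>R\<^esub> g z \<oplus>\<^bsub>R\<^esub> g z) = (\<lambda>z. \<zero>\<^bsub>R\<^esub>)"
        using c[OF g] by (intro ext) (simp add: l_minus l_neg)
      ultimately show "\<exists>y\<in>carrier ?F. y \<oplus>\<^bsub>?F\<^esub> g = \<zero>\<^bsub>?F\<^esub>"
        by (intro bexI[of _ "\<lambda>z. (\<ominus>\<^bsub>R\<^esub> \<one>\<^bsub>R\<^esub>) \<otimes>\<^bsub>R\<^esub> g z"]) (simp_all only: free_mod_simps(2,3))
    next
      show "\<zero>\<^bsub>?F\<^esub> \<in> carrier ?F" by simp
    qed (use add c in \<open>simp_all add: a_ac del: free_mod_simps(1)\<close>)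
  qed (use smult c in \<open>simp_all add: l_distr r_distr m_assoc del: free_mod_simps(1)\<close>)
qed

lemma free_gen_carrier:
  assumes "cring R" "x \<in> X"
  shows "free_gen R x \<in> carrier (free_mod R X)"
proof -
  interpret cring R by fact
  have "finite {z. free_gen R x z \<noteq> \<zero>\<^bsub>R\<^esub>}"
    by (rule finite_subset[of _ "{x}"]) (auto simp: free_gen_def)
  then show ?thesis using assms(2) by (auto simp: free_gen_def)
qed

text \<open>
  By induction on a finite set that contains the support: clearing one coefficient of
  \<open>g\<close> subtracts a multiple of a generator.
\<close>

lemma free_mod_induct [consumes 2, case_names zero gen add]:
  assumes R: "cring R" and g: "g \<in> carrier (free_mod R X)"
    and zero: "P \<zero>\<^bsub>free_mod R X\<^esub>"
    and gen: "\<And>r x. r \<in> carrier R \<Longrightarrow> x \<in> X \<Longrightarrow> P (r \<odot>\<^bsub>free_mod R X\<^esub> free_gen R x)"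
    and add: "\<And>g h. g \<in> carrier (free_mod R X) \<Longrightarrow> h \<in> carrier (free_mod R X) \<Longrightarrow> P g \<Longrightarrow> P h \<Longrightarrow>
      P (g \<oplus>\<^bsub>free_mod R X\<^esub> h)"
  shows "P g"
proof -
  interpret cring R by fact
  have "\<forall>g. g \<in> carrier (free_mod R X) \<longrightarrow> {z. g z \<noteq> \<zero>\<^bsub>R\<^esub>} \<subseteq> S \<longrightarrow> P g"
    if "finite S" for S
    using that
  proof (induction S)
    case empty
    show ?case
    proof (intro allI impI)
      fix g assume "g \<in> carrier (free_mod R X)" "{z. g z \<noteq> \<zero>\<^bsub>R\<^esub>} \<subseteq> {}"
      then have "g = \<zero>\<^bsub>free_mod R X\<^esub>" by (intro ext) (auto simp del: free_mod_simps(1))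
      then show "P g" using zero by simp
    qed
  next
    case (insert x S)
    show ?case
    proof (intro allI impI)
      fix g assume g: "g \<in> carrier (free_mod R X)" "{z. g z \<noteq> \<zero>\<^bsub>R\<^esub>} \<subseteq> insert x S"
      show "P g"
      proof (cases "x \<in> X")
        case False
        then have "{z. g z \<noteq> \<zero>\<^bsub>R\<^esub>} \<subseteq> S" using g by auto
        then show ?thesis using insert.IH g(1) by blast
      next
        case True
        let ?g = "g(x := \<zero>\<^bsub>R\<^esub>)" and ?e = "g x \<odot>\<^bsub>free_mod R X\<^esub> free_gen R x"
        have "finite {z. ?g z \<noteq> \<zero>\<^bsub>R\<^esub>}"
          by (rule finite_subset[of _ "{z. g z \<noteq> \<zero>\<^bsub>R\<^esub>}"]) (use g(1) in auto)
        then have g': "?g \<in> carrier (free_mod R X)" using g(1) by auto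
        have "{z. ?g z \<noteq> \<zero>\<^bsub>R\<^esub>} \<subseteq> S" using g(2) by auto
        then have "P ?g" using insert.IH g' by blast
        have gx: "g x \<in> carrier R" using free_mod_coeff[OF R g(1)] .
        have e: "?e \<in> carrier (free_mod R X)"
          using module.smult_closed[OF free_mod_module[OF R] gx free_gen_carrier[OF R True]] .
        have "?g \<oplus>\<^bsub>free_mod R X\<^esub> ?e = g"
          using free_mod_coeff[OF R g(1)] by (auto simp: free_gen_def fun_eq_iff)
        then show ?thesis using add[OF g' e \<open>P ?g\<close> gen[OF gx True]] by simp
      qed
    qed
  qed
  then show ?thesis using g by auto
qed

definition free_lift :: "('k, 'r) ring_scheme \<Rightarrow> ('k, 'c, 'z) module_scheme \<Rightarrow> ('x \<Rightarrow> 'c) \<Rightarrow>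
   ('x \<Rightarrow> 'k) \<Rightarrow> 'c"
  where "free_lift R P b g = (\<Oplus>\<^bsub>P\<^esub>z \<in> {z. g z \<noteq> \<zero>\<^bsub>R\<^esub>}. g z \<odot>\<^bsub>P\<^esub> b z)"

text \<open>
  The sum may be taken over any finite set containing the support; a common such set for two
  functions makes additivity a statement about finite sums.
\<close>

lemma free_lift_superset:
  assumes "module R P" "b \<in> X \<rightarrow> carrier P" "g \<in> carrier (free_mod R X)"
    "finite S" "S \<subseteq> X" "{z. g z \<noteq> \<zero>\<^bsub>R\<^esub>} \<subseteq> S"
  shows "free_lift R P b g = (\<Oplus>\<^bsub>P\<^esub>z \<in> S. g z \<odot>\<^bsub>P\<^esub> b z)"
proof -
  interpret P: module R P by fact
  note c = free_mod_coeff[OF P.R.is_cring assms(3)]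
  show ?thesis unfolding free_lift_def
  proof (rule P.M.add.finprod_mono_neutral_cong_left[OF assms(4,6)])
    have b: "b z \<in> carrier P" if "z \<in> S" for z
      using funcset_mem[OF assms(2) subsetD[OF assms(5) that]] .
    show "g i \<odot>\<^bsub>P\<^esub> b i = \<zero>\<^bsub>P\<^esub>" if "i \<in> S - {z. g z \<noteq> \<zero>\<^bsub>R\<^esub>}" for i
      using that b[of i] by simp
    show "(\<lambda>z. g z \<odot>\<^bsub>P\<^esub> b z) \<in> S \<rightarrow> carrier P"
      using c b by (intro funcsetI P.smult_closed)
  qed (rule refl)
qed

lemma free_lift_linear:
  assumes "module R P" "b \<in> X \<rightarrow> carrier P"
  shows "linear_map R (free_mod R X) P (free_lift R P b)"
proof -
  interpret P: module R P by fact
  interpret F: module R "free_mod R X" by (rule free_mod_module[OF P.R.is_cring])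
  note c = free_mod_coeff[OF P.R.is_cring]
  note sup = free_lift_superset[OF assms]
  have supp: "finite {z. g z \<noteq> \<zero>\<^bsub>R\<^esub>}" "{z. g z \<noteq> \<zero>\<^bsub>R\<^esub>} \<subseteq> X" if "g \<in> carrier (free_mod R X)" for g
    using that by simp_all blast
  have b: "b z \<in> carrier P" if "z \<in> S" "S \<subseteq> X" for z S
    using funcset_mem[OF assms(2) subsetD[OF that(2,1)]] .
  have bS: "(\<lambda>z. g z \<odot>\<^bsub>P\<^esub> b z) \<in> S \<rightarrow> carrier P" if "g \<in> carrier (free_mod R X)" "S \<subseteq> X" for g S
    using c[OF that(1)] b[OF _ that(2)] by (intro funcsetI P.smult_closed)
  show ?thesis unfolding linear_map_def
  proof (intro conjI ballI)
    show "free_lift R P b \<in> carrier (free_mod R X) \<rightarrow> carrier P"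
    proof
      fix g assume g: "g \<in> carrier (free_mod R X)"
      show "free_lift R P b g \<in> carrier P"
        unfolding free_lift_def by (rule P.M.finsum_closed[OF bS[OF g supp(2)[OF g]]])
    qed
  next
    fix g h assume gh: "g \<in> carrier (free_mod R X)" "h \<in> carrier (free_mod R X)"
    let ?S = "{z. g z \<noteq> \<zero>\<^bsub>R\<^esub>} \<union> {z. h z \<noteq> \<zero>\<^bsub>R\<^esub>}"
    have S: "finite ?S" "?S \<subseteq> X" using supp[OF gh(1)] supp[OF gh(2)] by auto
    have "free_lift R P b (g \<oplus>\<^bsub>free_mod R X\<^esub> h) = (\<Oplus>\<^bsub>P\<^esub>z \<in> ?S. (g z \<oplus>\<^bsub>R\<^esub> h z) \<odot>\<^bsub>P\<^esub> b z)"
      by (subst sup[OF F.M.a_closed[OF gh] S]) auto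
    also have "\<dots> = (\<Oplus>\<^bsub>P\<^esub>z \<in> ?S. g z \<odot>\<^bsub>P\<^esub> b z \<oplus>\<^bsub>P\<^esub> h z \<odot>\<^bsub>P\<^esub> b z)"
      using c[OF gh(1)] c[OF gh(2)] b[OF _ S(2)]
      by (intro P.M.finsum_cong' refl) (auto simp: P.smult_l_distr)
    also have "\<dots> = (\<Oplus>\<^bsub>P\<^esub>z \<in> ?S. g z \<odot>\<^bsub>P\<^esub> b z) \<oplus>\<^bsub>P\<^esub> (\<Oplus>\<^bsub>P\<^esub>z \<in> ?S. h z \<odot>\<^bsub>P\<^esub> b z)"
      by (intro P.M.finsum_addf bS gh S)
    also have "\<dots> = free_lift R P b g \<oplus>\<^bsub>P\<^esub> free_lift R P b h"
      using sup[OF gh(1) S] sup[OF gh(2) S] by auto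
    finally show "free_lift R P b (g \<oplus>\<^bsub>free_mod R X\<^esub> h) = free_lift R P b g \<oplus>\<^bsub>P\<^esub> free_lift R P b h" .
  next
    fix r g assume r: "r \<in> carrier R" and g: "g \<in> carrier (free_mod R X)"
    let ?S = "{z. g z \<noteq> \<zero>\<^bsub>R\<^esub>}"
    have "free_lift R P b (r \<odot>\<^bsub>free_mod R X\<^esub> g) = (\<Oplus>\<^bsub>P\<^esub>z \<in> ?S. (r \<otimes>\<^bsub>R\<^esub> g z) \<odot>\<^bsub>P\<^esub> b z)"
      using r by (subst sup[OF F.smult_closed[OF r g] supp[OF g]]) auto
    also have "\<dots> = (\<Oplus>\<^bsub>P\<^esub>z \<in> ?S. r \<odot>\<^bsub>P\<^esub> (g z \<odot>\<^bsub>P\<^esub> b z))"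
      using c[OF g] b[OF _ supp(2)[OF g]] r
      by (intro P.M.finsum_cong' refl) (auto simp: P.smult_assoc1)
    also have "\<dots> = r \<odot>\<^bsub>P\<^esub> free_lift R P b g"
      unfolding free_lift_def using supp[OF g] r bS[OF g]
      by (intro P.finsum_smult_ldistr[symmetric]) auto
    finally show "free_lift R P b (r \<odot>\<^bsub>free_mod R X\<^esub> g) = r \<odot>\<^bsub>P\<^esub> free_lift R P b g" .
  qed
qed

lemma free_lift_gen:
  assumes "module R P" "b \<in> X \<rightarrow> carrier P" "x \<in> X"
  shows "free_lift R P b (free_gen R x) = b x"
proof -
  have supp: "{z. free_gen R x z \<noteq> \<zero>\<^bsub>R\<^esub>} \<subseteq> {x}" by (auto simp: free_gen_def)
  have x: "finite {x}" "{x} \<subseteq> X" using assms(3) by auto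
  have bx: "b x \<in> carrier P" using funcset_mem[OF assms(2,3)] .
  interpret P: module R P by fact
  note g = free_gen_carrier[OF P.R.is_cring assms(3)]
  have "free_lift R P b (free_gen R x) = (\<Oplus>\<^bsub>P\<^esub>z \<in> {x}. free_gen R x z \<odot>\<^bsub>P\<^esub> b z)"
    by (rule free_lift_superset[OF assms(1,2) g x supp])
  also have "\<dots> = free_gen R x x \<odot>\<^bsub>P\<^esub> b x"
    using P.M.finsum_insert[of "{}" x "\<lambda>z. free_gen R x z \<odot>\<^bsub>P\<^esub> b z"]
      P.smult_closed[OF free_mod_coeff[OF P.R.is_cring g] bx] by simp
  also have "\<dots> = b x"
    using bx unfolding free_gen_def by simp
  finally show ?thesis .
qed

section \<open>Bilinear maps and the tensor product\<close>

lemma bilinear_map_linear: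
  assumes "bilinear_map R M N P b"
  shows "y \<in> carrier N \<Longrightarrow> linear_map R M P (\<lambda>x. b x y)"
    "x \<in> carrier M \<Longrightarrow> linear_map R N P (b x)"
  using assms by (auto simp: bilinear_map_def linear_map_def)

lemma bilinear_mapI:
  assumes "\<And>y. y \<in> carrier N \<Longrightarrow> linear_map R M P (\<lambda>x. b x y)"
    "\<And>x. x \<in> carrier M \<Longrightarrow> linear_map R N P (b x)"
  shows "bilinear_map R M N P b"
  using assms by (auto simp: bilinear_map_def linear_map_def Pi_iff)

lemma bilinear_map_closed:
  "bilinear_map R M N P b \<Longrightarrow> x \<in> carrier M \<Longrightarrow> y \<in> carrier N \<Longrightarrow> b x y \<in> carrier P"
  by (auto simp: bilinear_map_def)

lemma
  assumes "module R M" "module R N"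
  shows tensor_relations_submodule:
      "submodule (tensor_relations R M N) R (free_mod R (carrier M \<times> carrier N))"
    and pure_tensor_bilinear: "bilinear_map R M N (tensor R M N) (pure_tensor R M N)"
proof -
  interpret M: module R M by fact
  interpret N: module R N by fact
  let ?F = "free_mod R (carrier M \<times> carrier N)" and ?e = "free_gen R"
    and ?K = "tensor_relations R M N"
  have F: "module R ?F" by (rule free_mod_module[OF M.R.is_cring])
  interpret F: module R ?F by (rule F)
  have e: "?e (x, y) \<in> carrier ?F" if "x \<in> carrier M" "y \<in> carrier N" for x y
    by (rule free_gen_carrier[OF M.R.is_cring]) (use that in simp)
  have ee: "?e (x, y) \<oplus>\<^bsub>?F\<^esub> ?e (x', y') \<in> carrier ?F"
    if "x \<in> carrier M" "y \<in> carrier N" "x' \<in> carrier M" "y' \<in> carrier N" for x y x' y'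
    by (rule F.M.a_closed[OF e[OF that(1,2)] e[OF that(3,4)]])
  have re: "r \<odot>\<^bsub>?F\<^esub> ?e (x, y) \<in> carrier ?F"
    if "r \<in> carrier R" "x \<in> carrier M" "y \<in> carrier N" for r x y
    by (rule F.smult_closed[OF that(1) e[OF that(2,3)]])
  show K: "submodule ?K R ?F"
    unfolding tensor_relations_def Let_def
    by (rule mod_span_submodule[OF F], (rule Un_least)+)
      (clarify, intro F.M.minus_closed e ee re M.M.a_closed N.M.a_closed M.smult_closed
        N.smult_closed; assumption)+
  note lin = quot_proj_linear[OF F K]
  note eq = quot_proj_eq[OF F K]
  have gens:
    "\<And>x x' y. \<lbrakk>x \<in> carrier M; x' \<in> carrier M; y \<in> carrier N\<rbrakk> \<Longrightarrow>
       ?e (x \<oplus>\<^bsub>M\<^esub> x', y) \<ominus>\<^bsub>?F\<^esub> (?e (x, y) \<oplus>\<^bsub>?F\<^esub> ?e (x', y)) \<in> ?K"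
    "\<And>x y y'. \<lbrakk>x \<in> carrier M; y \<in> carrier N; y' \<in> carrier N\<rbrakk> \<Longrightarrow>
       ?e (x, y \<oplus>\<^bsub>N\<^esub> y') \<ominus>\<^bsub>?F\<^esub> (?e (x, y) \<oplus>\<^bsub>?F\<^esub> ?e (x, y')) \<in> ?K"
    "\<And>r x y. \<lbrakk>r \<in> carrier R; x \<in> carrier M; y \<in> carrier N\<rbrakk> \<Longrightarrow>
       ?e (r \<odot>\<^bsub>M\<^esub> x, y) \<ominus>\<^bsub>?F\<^esub> (r \<odot>\<^bsub>?F\<^esub> ?e (x, y)) \<in> ?K"
    "\<And>r x y. \<lbrakk>r \<in> carrier R; x \<in> carrier M; y \<in> carrier N\<rbrakk> \<Longrightarrow>
       ?e (x, r \<odot>\<^bsub>N\<^esub> y) \<ominus>\<^bsub>?F\<^esub> (r \<odot>\<^bsub>?F\<^esub> ?e (x, y)) \<in> ?K"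
    unfolding tensor_relations_def Let_def
    by (rule subsetD[OF mod_span_superset], blast)+
  have "linear_map R M (quot_mod ?F ?K) (\<lambda>x. ?K +>\<^bsub>?F\<^esub> ?e (x, y))" if "y \<in> carrier N" for y
    unfolding linear_map_def
  proof (intro conjI ballI funcsetI)
    show "?K +>\<^bsub>?F\<^esub> ?e (x, y) \<in> carrier (quot_mod ?F ?K)" if "x \<in> carrier M" for x
      by (rule linear_map_closed[OF lin e]) fact+
    show "?K +>\<^bsub>?F\<^esub> ?e (x \<oplus>\<^bsub>M\<^esub> x', y) =
        (?K +>\<^bsub>?F\<^esub> ?e (x, y)) \<oplus>\<^bsub>quot_mod ?F ?K\<^esub> (?K +>\<^bsub>?F\<^esub> ?e (x', y))"
      if "x \<in> carrier M" "x' \<in> carrier M" for x x'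
      unfolding linear_map_add[OF lin e[OF that(1) \<open>y \<in> carrier N\<close>] e[OF that(2) \<open>y \<in> carrier N\<close>], symmetric]
      by (rule eq[OF e ee gens(1)]) (use that \<open>y \<in> carrier N\<close> in simp_all)
    show "?K +>\<^bsub>?F\<^esub> ?e (r \<odot>\<^bsub>M\<^esub> x, y) = r \<odot>\<^bsub>quot_mod ?F ?K\<^esub> (?K +>\<^bsub>?F\<^esub> ?e (x, y))"
      if "r \<in> carrier R" "x \<in> carrier M" for r x
      unfolding linear_map_smult[OF lin that(1) e[OF that(2) \<open>y \<in> carrier N\<close>], symmetric]
      by (rule eq[OF e re gens(3)]) (use that \<open>y \<in> carrier N\<close> in simp_all)
  qed
  moreover
  have "linear_map R N (quot_mod ?F ?K) (\<lambda>y. ?K +>\<^bsub>?F\<^esub> ?e (x, y))" if "x \<in> carrier M" for x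
    unfolding linear_map_def
  proof (intro conjI ballI funcsetI)
    show "?K +>\<^bsub>?F\<^esub> ?e (x, y) \<in> carrier (quot_mod ?F ?K)" if "y \<in> carrier N" for y
      by (rule linear_map_closed[OF lin e]) fact+
    show "?K +>\<^bsub>?F\<^esub> ?e (x, y \<oplus>\<^bsub>N\<^esub> y') =
        (?K +>\<^bsub>?F\<^esub> ?e (x, y)) \<oplus>\<^bsub>quot_mod ?F ?K\<^esub> (?K +>\<^bsub>?F\<^esub> ?e (x, y'))"
      if "y \<in> carrier N" "y' \<in> carrier N" for y y'
      unfolding linear_map_add[OF lin e[OF \<open>x \<in> carrier M\<close> that(1)] e[OF \<open>x \<in> carrier M\<close> that(2)], symmetric]
      by (rule eq[OF e ee gens(2)]) (use that \<open>x \<in> carrier M\<close> in simp_all)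
    show "?K +>\<^bsub>?F\<^esub> ?e (x, r \<odot>\<^bsub>N\<^esub> y) = r \<odot>\<^bsub>quot_mod ?F ?K\<^esub> (?K +>\<^bsub>?F\<^esub> ?e (x, y))"
      if "r \<in> carrier R" "y \<in> carrier N" for r y
      unfolding linear_map_smult[OF lin that(1) e[OF \<open>x \<in> carrier M\<close> that(2)], symmetric]
      by (rule eq[OF e re gens(4)]) (use that \<open>x \<in> carrier M\<close> in simp_all)
  qed
  ultimately show "bilinear_map R M N (tensor R M N) (pure_tensor R M N)"
    by (intro bilinear_mapI) (simp_all add: tensor_def Let_def with_grading_linear_to pure_tensor_def[abs_def])
qed

lemma tensor_module:
  assumes "module R M" "module R N"
  shows "module R (tensor R M N)"
  unfolding tensor_def Let_def using assms
  by (intro with_grading_module quot_mod_module free_mod_module tensor_relations_submodule)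
    (simp add: module_def)

text \<open>
  A multiple of a pure tensor is again pure, because the scalar can be moved into the first factor;
  so there is no case for scalar multiplication, and none for zero, which is \<open>0 \<otimes> 0\<close>.
\<close>

lemma tensor_induct [consumes 3, case_names pure add]:
  assumes M: "module R M" and N: "module R N" and T: "T \<in> carrier (tensor R M N)"
    and pure: "\<And>x y. x \<in> carrier M \<Longrightarrow> y \<in> carrier N \<Longrightarrow> P (pure_tensor R M N x y)"
    and add: "\<And>U V. U \<in> carrier (tensor R M N) \<Longrightarrow> V \<in> carrier (tensor R M N) \<Longrightarrow> P U \<Longrightarrow> P V \<Longrightarrow>
      P (U \<oplus>\<^bsub>tensor R M N\<^esub> V)"
  shows "P T"
proof -
  interpret M: module R M by fact
  interpret N: module R N by fact
  let ?F = "free_mod R (carrier M \<times> carrier N)" and ?K = "tensor_relations R M N"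
    and ?T = "tensor R M N"
  note F = free_mod_module[OF M.R.is_cring, of "carrier M \<times> carrier N"]
  note K = tensor_relations_submodule[OF M N]
  note bil = bilinear_map_linear[OF pure_tensor_bilinear[OF M N]]
  have lin: "linear_map R ?F ?T (\<lambda>g. ?K +>\<^bsub>?F\<^esub> g)"
    using quot_proj_linear[OF F K] by (simp add: tensor_def Let_def with_grading_linear_from with_grading_linear_to)
  have "T \<in> (\<lambda>g. ?K +>\<^bsub>?F\<^esub> g) ` carrier ?F"
    using T quot_proj_surj[OF F K] by (simp add: tensor_def Let_def)
  then obtain g where g: "g \<in> carrier ?F" "T = ?K +>\<^bsub>?F\<^esub> g" by blast
  from M.R.is_cring g(1) have "P (?K +>\<^bsub>?F\<^esub> g)"
  proof (induction rule: free_mod_induct)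
    case zero
    have "?K +>\<^bsub>?F\<^esub> \<zero>\<^bsub>?F\<^esub> = \<zero>\<^bsub>?T\<^esub>" by (rule linear_map_zero[OF F tensor_module[OF M N] lin])
    also have "\<dots> = pure_tensor R M N \<zero>\<^bsub>M\<^esub> \<zero>\<^bsub>N\<^esub>"
      using linear_map_zero[OF M tensor_module[OF M N] bil(1)] by simp
    finally show ?case using pure by simp
  next
    case (gen r z)
    obtain x y where z: "z = (x, y)" "x \<in> carrier M" "y \<in> carrier N" using gen(2) by blast
    have "?K +>\<^bsub>?F\<^esub> (r \<odot>\<^bsub>?F\<^esub> free_gen R z) = r \<odot>\<^bsub>?T\<^esub> pure_tensor R M N x y"
      using linear_map_smult[OF lin gen(1) free_gen_carrier[OF M.R.is_cring gen(2)]] z(1)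
      by (simp add: pure_tensor_def)
    also have "\<dots> = pure_tensor R M N (r \<odot>\<^bsub>M\<^esub> x) y"
      using linear_map_smult[OF bil(1)] gen(1) z by simp
    finally show ?case using pure[of "r \<odot>\<^bsub>M\<^esub> x" y] gen(1) z(2,3) by simp
  next
    case (add g h)
    show ?case unfolding linear_map_add[OF lin add(1,2)]
      using assms(5) linear_map_closed[OF lin] add by simp
  qed
  then show ?thesis using g(2) by simp
qed

text \<open>
  Universal property of the tensor product: the linear extension of a bilinear map to the free
  module vanishes on the relations.
\<close>

lemma
  assumes "module R M" "module R N" "module R P" "bilinear_map R M N P b"
  shows tensor_lift_linear: "linear_map R (tensor R M N) P (tensor_lift R P b)"
    and tensor_lift_pure: "x \<in> carrier M \<Longrightarrow> y \<in> carrier N \<Longrightarrow>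
      tensor_lift R P b (pure_tensor R M N x y) = b x y"
proof -
  interpret M: module R M by fact
  interpret N: module R N by fact
  interpret P: module R P by fact
  let ?X = "carrier M \<times> carrier N"
  let ?F = "free_mod R ?X" and ?e = "free_gen R" and ?K = "tensor_relations R M N"
    and ?b = "\<lambda>z. b (fst z) (snd z)"
  let ?f = "free_lift R P ?b"
  have F: "module R ?F" by (rule free_mod_module[OF M.R.is_cring])
  interpret F: module R ?F by (rule F)
  note K = tensor_relations_submodule[OF assms(1,2)]
  note bc = bilinear_map_closed[OF assms(4)]
  have b: "?b \<in> ?X \<rightarrow> carrier P" using bc by (intro funcsetI) (simp add: mem_Times_iff)
  note lin = free_lift_linear[OF assms(3) b]
  have e: "?e (x, y) \<in> carrier ?F" if "x \<in> carrier M" "y \<in> carrier N" for x y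
    by (rule free_gen_carrier[OF M.R.is_cring]) (use that in simp)
  have fe: "?f (?e (x, y)) = b x y" if "x \<in> carrier M" "y \<in> carrier N" for x y
    using free_lift_gen[OF assms(3) b, of "(x, y)"] that by simp
  have vanish: "?f (u \<ominus>\<^bsub>?F\<^esub> v) = \<zero>\<^bsub>P\<^esub>"
    if "u \<in> carrier ?F" "v \<in> carrier ?F" "?f u = ?f v" for u v
  proof -
    have "?f (u \<ominus>\<^bsub>?F\<^esub> v) = ?f u \<oplus>\<^bsub>P\<^esub> \<ominus>\<^bsub>P\<^esub> ?f v"
      unfolding a_minus_def linear_map_add[OF lin that(1) F.M.a_inv_closed[OF that(2)]]
        linear_map_minus[OF F assms(3) lin that(2)] ..
    then show ?thesis using that(3) linear_map_closed[OF lin that(2)] by (simp add: P.M.r_neg)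
  qed
  note bl = bilinear_map_linear[OF assms(4)]
  have fK: "?f g = \<zero>\<^bsub>P\<^esub>" if "g \<in> ?K" for g
  proof -
    have kills: "S \<subseteq> {g \<in> carrier ?F. ?f g \<in> {\<zero>\<^bsub>P\<^esub>}} \<Longrightarrow> mod_span R ?F S \<subseteq> {g \<in> carrier ?F. ?f g \<in> {\<zero>\<^bsub>P\<^esub>}}" for S
      by (rule mod_span_least[OF submodule_vimage[OF F assms(3) lin zero_submodule[OF assms(3)]]])
    have "?K \<subseteq> {g \<in> carrier ?F. ?f g \<in> {\<zero>\<^bsub>P\<^esub>}}"
      unfolding tensor_relations_def Let_def
    proof (rule kills, (rule Un_least)+; safe)
      fix x x' y assume 1: "x \<in> carrier M" "x' \<in> carrier M" "y \<in> carrier N"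
      let ?u = "?e (x \<oplus>\<^bsub>M\<^esub> x', y)" and ?v = "?e (x, y) \<oplus>\<^bsub>?F\<^esub> ?e (x', y)"
      have uv: "?u \<in> carrier ?F" "?v \<in> carrier ?F"
        using 1 by (auto intro!: F.M.a_closed e simp del: free_mod_simps)
      show "?u \<ominus>\<^bsub>?F\<^esub> ?v \<in> carrier ?F" by (rule F.M.minus_closed[OF uv])
      have "?f ?u = ?f ?v" unfolding linear_map_add[OF lin e[OF 1(1,3)] e[OF 1(2,3)]]
        using 1 linear_map_add[OF bl(1)] by (simp add: fe)
      then show "?f (?u \<ominus>\<^bsub>?F\<^esub> ?v) = \<zero>\<^bsub>P\<^esub>" by (rule vanish[OF uv])
    next
      fix x y y' assume 1: "x \<in> carrier M" "y \<in> carrier N" "y' \<in> carrier N"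
      let ?u = "?e (x, y \<oplus>\<^bsub>N\<^esub> y')" and ?v = "?e (x, y) \<oplus>\<^bsub>?F\<^esub> ?e (x, y')"
      have uv: "?u \<in> carrier ?F" "?v \<in> carrier ?F"
        using 1 by (auto intro!: F.M.a_closed e simp del: free_mod_simps)
      show "?u \<ominus>\<^bsub>?F\<^esub> ?v \<in> carrier ?F" by (rule F.M.minus_closed[OF uv])
      have "?f ?u = ?f ?v" unfolding linear_map_add[OF lin e[OF 1(1,2)] e[OF 1(1,3)]]
        using 1 linear_map_add[OF bl(2)] by (simp add: fe)
      then show "?f (?u \<ominus>\<^bsub>?F\<^esub> ?v) = \<zero>\<^bsub>P\<^esub>" by (rule vanish[OF uv])
    next
      fix r x y assume 1: "r \<in> carrier R" "x \<in> carrier M" "y \<in> carrier N"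
      let ?u = "?e (r \<odot>\<^bsub>M\<^esub> x, y)" and ?v = "r \<odot>\<^bsub>?F\<^esub> ?e (x, y)"
      have uv: "?u \<in> carrier ?F" "?v \<in> carrier ?F"
        using 1 by (auto intro!: F.smult_closed e simp del: free_mod_simps)
      show "?u \<ominus>\<^bsub>?F\<^esub> ?v \<in> carrier ?F" by (rule F.M.minus_closed[OF uv])
      have "?f ?u = ?f ?v" unfolding linear_map_smult[OF lin 1(1) e[OF 1(2,3)]]
        using 1 linear_map_smult[OF bl(1)] by (simp add: fe)
      then show "?f (?u \<ominus>\<^bsub>?F\<^esub> ?v) = \<zero>\<^bsub>P\<^esub>" by (rule vanish[OF uv])
    next
      fix r x y assume 1: "r \<in> carrier R" "x \<in> carrier M" "y \<in> carrier N"
      let ?u = "?e (x, r \<odot>\<^bsub>N\<^esub> y)" and ?v = "r \<odot>\<^bsub>?F\<^esub> ?e (x, y)"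
      have uv: "?u \<in> carrier ?F" "?v \<in> carrier ?F"
        using 1 by (auto intro!: F.smult_closed e simp del: free_mod_simps)
      show "?u \<ominus>\<^bsub>?F\<^esub> ?v \<in> carrier ?F" by (rule F.M.minus_closed[OF uv])
      have "?f ?u = ?f ?v" unfolding linear_map_smult[OF lin 1(1) e[OF 1(2,3)]]
        using 1 linear_map_smult[OF bl(2)] by (simp add: fe)
      then show "?f (?u \<ominus>\<^bsub>?F\<^esub> ?v) = \<zero>\<^bsub>P\<^esub>" by (rule vanish[OF uv])
    qed
    then show ?thesis using that by blast
  qed
  \<comment> \<open>The sum in the definition of \<^const>\<open>tensor_lift\<close> is the linear extension to the free module.\<close>
  have eq: "tensor_lift R P b = (\<lambda>T. the_elem (?f ` T))"
    by (simp add: fun_eq_iff tensor_lift_def free_lift_def[abs_def])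
  show "linear_map R (tensor R M N) P (tensor_lift R P b)"
    using quot_lift_linear[OF F K assms(3) lin fK]
    by (simp add: eq tensor_def Let_def with_grading_linear_from with_grading_linear_to)
  show "tensor_lift R P b (pure_tensor R M N x y) = b x y" if "x \<in> carrier M" "y \<in> carrier N"
    using quot_lift_proj[OF F K assms(3) lin fK e[OF that]] fe[OF that]
    by (simp add: eq pure_tensor_def)
qed

lemma homog_tensor:
  "homog (tensor R M N) d = mod_span R (tensor R M N)
    {pure_tensor R M N x y | x y a b. x \<in> homog M a \<and> y \<in> homog N b \<and> a + b = d}"
  unfolding tensor_def Let_def with_grading_mod_span with_grading_simps ..

section \<open>Supermodules and 2-cocycles\<close>

lemma supermodule_facts:
  assumes "supermodule R M"
  shows "module R M" "submodule (homog M d) R M" "x \<in> homog M d \<Longrightarrow> x \<in> carrier M"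
    "x \<in> carrier M \<Longrightarrow> \<exists>y \<in> homog M 0. \<exists>z \<in> homog M 1. x = y \<oplus>\<^bsub>M\<^esub> z"
    "x \<in> homog M 0 \<Longrightarrow> x \<in> homog M 1 \<Longrightarrow> x = \<zero>\<^bsub>M\<^esub>"
proof -
  interpret supermodule R M by fact
  show m: "module R M" by (rule module_axioms)
  show s: "submodule (homog M d) R M" for d by (rule homog_submodule)
  show "x \<in> homog M d \<Longrightarrow> x \<in> carrier M" by (rule submodule_closed(1)[OF m s])
  show "x \<in> carrier M \<Longrightarrow> \<exists>y \<in> homog M 0. \<exists>z \<in> homog M 1. x = y \<oplus>\<^bsub>M\<^esub> z"
    unfolding homog_sum set_add_def' by simp
  show "x \<in> homog M 0 \<Longrightarrow> x \<in> homog M 1 \<Longrightarrow> x = \<zero>\<^bsub>M\<^esub>"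
    using homog_disjoint by auto
qed

lemma supermoduleI:
  assumes "module R M" "\<And>d. submodule (homog M d) R M"
    "\<And>x. x \<in> carrier M \<Longrightarrow> \<exists>y \<in> homog M 0. \<exists>z \<in> homog M 1. x = y \<oplus>\<^bsub>M\<^esub> z"
    "\<And>x. x \<in> homog M 0 \<Longrightarrow> x \<in> homog M 1 \<Longrightarrow> x = \<zero>\<^bsub>M\<^esub>"
  shows "supermodule R M"
proof (intro supermodule.intro supermodule_axioms.intro)
  note c = submodule_closed[OF assms(1,2)]
  interpret M: module R M by fact
  show "carrier M = homog M 0 <+>\<^bsub>M\<^esub> homog M 1"
    unfolding set_add_def' using assms(3) c(1) by auto
  show "homog M 0 \<inter> homog M 1 = {\<zero>\<^bsub>M\<^esub>}" using assms(4) c(2) by auto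
qed (use assms in auto)

lemma superalgebra_facts:
  assumes "superalgebra R M"
  shows "supermodule R M" "bilinear_map R M M M (mult M)" "degree_zero M M M (mult M)"
    "x \<in> carrier M \<Longrightarrow> y \<in> carrier M \<Longrightarrow> x \<otimes>\<^bsub>M\<^esub> y \<in> carrier M"
    "x \<in> homog M a \<Longrightarrow> y \<in> homog M b \<Longrightarrow> x \<otimes>\<^bsub>M\<^esub> y \<in> homog M (a + b)"
proof -
  interpret superalgebra R M by fact
  show "supermodule R M" "bilinear_map R M M M (mult M)" "degree_zero M M M (mult M)"
    by (rule supermodule_axioms mult_bilinear mult_degree)+
  then show "x \<in> carrier M \<Longrightarrow> y \<in> carrier M \<Longrightarrow> x \<otimes>\<^bsub>M\<^esub> y \<in> carrier M"
    "x \<in> homog M a \<Longrightarrow> y \<in> homog M b \<Longrightarrow> x \<otimes>\<^bsub>M\<^esub> y \<in> homog M (a + b)"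
    by (auto simp: bilinear_map_def degree_zero_def)
qed

lemma two_cocycleD:
  assumes "two_cocycle R L C \<tau>"
  shows "bilinear_map R L L C \<tau>" "degree_zero L L C \<tau>"
    "x \<in> carrier L \<Longrightarrow> y \<in> carrier L \<Longrightarrow> \<tau> x y \<in> carrier C"
    "x \<in> homog L a \<Longrightarrow> y \<in> homog L b \<Longrightarrow> \<tau> x y \<in> homog C (a + b)"
    "x \<in> homog L a \<Longrightarrow> y \<in> homog L b \<Longrightarrow> \<tau> x y \<oplus>\<^bsub>C\<^esub> ksign C (a * b) (\<tau> y x) = \<zero>\<^bsub>C\<^esub>"
    "x \<in> homog L 0 \<Longrightarrow> \<tau> x x = \<zero>\<^bsub>C\<^esub>"
    "x \<in> homog L a \<Longrightarrow> y \<in> homog L b \<Longrightarrow> z \<in> homog L c \<Longrightarrow>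
      ksign C (a * c) (\<tau> x (y \<otimes>\<^bsub>L\<^esub> z)) \<oplus>\<^bsub>C\<^esub> ksign C (b * a) (\<tau> y (z \<otimes>\<^bsub>L\<^esub> x))
        \<oplus>\<^bsub>C\<^esub> ksign C (c * b) (\<tau> z (x \<otimes>\<^bsub>L\<^esub> y)) = \<zero>\<^bsub>C\<^esub>"
  using assms unfolding two_cocycle_def by (simp_all add: bilinear_map_def degree_zero_def)

lemma two_cocycleI:
  assumes "bilinear_map R L L C \<tau>"
    "\<And>a b x y. x \<in> homog L a \<Longrightarrow> y \<in> homog L b \<Longrightarrow> \<tau> x y \<in> homog C (a + b)"
    "\<And>a b x y. x \<in> homog L a \<Longrightarrow> y \<in> homog L b \<Longrightarrow>
      \<tau> x y \<oplus>\<^bsub>C\<^esub> ksign C (a * b) (\<tau> y x) = \<zero>\<^bsub>C\<^esub>"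
    "\<And>x. x \<in> homog L 0 \<Longrightarrow> \<tau> x x = \<zero>\<^bsub>C\<^esub>"
    "\<And>a b c x y z. x \<in> homog L a \<Longrightarrow> y \<in> homog L b \<Longrightarrow> z \<in> homog L c \<Longrightarrow>
      ksign C (a * c) (\<tau> x (y \<otimes>\<^bsub>L\<^esub> z)) \<oplus>\<^bsub>C\<^esub> ksign C (b * a) (\<tau> y (z \<otimes>\<^bsub>L\<^esub> x))
        \<oplus>\<^bsub>C\<^esub> ksign C (c * b) (\<tau> z (x \<otimes>\<^bsub>L\<^esub> y)) = \<zero>\<^bsub>C\<^esub>"
  shows "two_cocycle R L C \<tau>"
  unfolding two_cocycle_def degree_zero_def using assms by blast

text \<open>
  Thanks to this equivalence each construction of 2-cocycles below (pullback, change of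
  coefficients, pairing, passage to a limit) is also a construction of Lie superalgebras.
\<close>

lemma lie_superalgebra_iff:
  "lie_superalgebra R L \<longleftrightarrow> supermodule R L \<and> two_cocycle R L L (mult L)"
proof
  assume "lie_superalgebra R L"
  then interpret lie_superalgebra R L .
  show "supermodule R L \<and> two_cocycle R L L (mult L)"
    using supermodule_axioms mult_bilinear mult_degree skew alternating jacobi
    by (simp add: two_cocycle_def)
next
  assume *: "supermodule R L \<and> two_cocycle R L L (mult L)"
  note D = two_cocycleD[OF conjunct2[OF *]]
  show "lie_superalgebra R L"
    by (intro lie_superalgebra.intro superalgebra.intro superalgebra_axioms.intro
        lie_superalgebra_axioms.intro) (use * D in blast)+
qed

lemma lie_superalgebra_superalgebra: "lie_superalgebra R L \<Longrightarrow> superalgebra R L"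
  by (rule lie_superalgebra.axioms)

lemma lie_homD:
  assumes "f \<in> lie_hom R L L'"
  shows "linear_map R L L' f" "x \<in> carrier L \<Longrightarrow> f x \<in> carrier L'"
    "x \<in> carrier L \<Longrightarrow> y \<in> carrier L \<Longrightarrow> f (x \<otimes>\<^bsub>L\<^esub> y) = f x \<otimes>\<^bsub>L'\<^esub> f y"
    "x \<in> homog L d \<Longrightarrow> f x \<in> homog L' d"
  using assms lie_hom_linear[OF assms] unfolding lie_hom_def by (auto simp: image_subset_iff)

lemma lie_homI:
  assumes "linear_map R L L' f"
    "\<And>x y. x \<in> carrier L \<Longrightarrow> y \<in> carrier L \<Longrightarrow> f (x \<otimes>\<^bsub>L\<^esub> y) = f x \<otimes>\<^bsub>L'\<^esub> f y"
    "\<And>d x. x \<in> homog L d \<Longrightarrow> f x \<in> homog L' d"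
  shows "f \<in> lie_hom R L L'"
  using assms unfolding lie_hom_def linear_map_def by (auto simp: image_subset_iff)

lemma bilinear_map_comp:
  assumes "linear_map R L L' f" "bilinear_map R L' L' C \<tau>"
  shows "bilinear_map R L L C (\<lambda>x y. \<tau> (f x) (f y))"
  using linear_map_comp[OF assms(1) bilinear_map_linear(1)[OF assms(2)]]
    linear_map_comp[OF assms(1) bilinear_map_linear(2)[OF assms(2)]]
    linear_map_closed[OF assms(1)]
  by (intro bilinear_mapI) auto

lemma two_cocycle_pullback:
  assumes "supermodule R L" "f \<in> lie_hom R L L'" "two_cocycle R L' C \<tau>"
  shows "two_cocycle R L C (\<lambda>x y. \<tau> (f x) (f y))"
proof -
  note c = supermodule_facts(3)[OF assms(1)]
  note f = lie_homD[OF assms(2)]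
  note D = two_cocycleD[OF assms(3)]
  show ?thesis
    by (rule two_cocycleI) (simp_all add: c f D bilinear_map_comp[OF f(1) D(1)])
qed

lemma two_cocycle_postcomp:
  assumes "supermodule R L" "superalgebra R L" "module R C" "module R D" "linear_map R C D g"
    "\<And>d c. c \<in> homog C d \<Longrightarrow> g c \<in> homog D d" "two_cocycle R L C \<tau>"
  shows "two_cocycle R L D (\<lambda>x y. g (\<tau> x y))"
proof -
  note sa = superalgebra_facts[OF assms(2)]
  note c = supermodule_facts(3)[OF assms(1)]
  note T = two_cocycleD[OF assms(7)]
  have ab: "abelian_group C" using assms(3) by (rule module.axioms)
  interpret C: abelian_group C by (rule ab)
  note k = ksign_closed[OF ab T(3)]
  note gk = linear_map_ksign[OF assms(3,4,5) T(3), symmetric]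
  note ga = linear_map_add[OF assms(5), symmetric]
  note g0 = linear_map_zero[OF assms(3,4,5)]
  show ?thesis
  proof (rule two_cocycleI)
    show "bilinear_map R L L D (\<lambda>x y. g (\<tau> x y))"
      by (intro bilinear_mapI linear_map_comp[OF _ assms(5)] bilinear_map_linear[OF T(1)])
  qed (simp_all add: c k gk ga g0 T(3-) assms(6) sa(4))
qed

section \<open>The universal 2-cocycle\<close>

lemma homog_tensor_submodule:
  assumes "supermodule R M" "supermodule R N"
  shows "submodule (homog (tensor R M N) d) R (tensor R M N)"
proof -
  note M = supermodule_facts[OF assms(1)] and N = supermodule_facts[OF assms(2)]
  show ?thesis unfolding homog_tensor
    by (rule mod_span_submodule[OF tensor_module[OF M(1) N(1)]])
      (use M(3) N(3) bilinear_map_closed[OF pure_tensor_bilinear[OF M(1) N(1)]] in blast)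
qed

lemma cyclic_quotient_eq:
  "cyclic_quotient R L = with_grading (quot_mod (tensor R L L) (cyclic_relations R L))
    (\<lambda>d. (\<lambda>x. cyclic_relations R L +>\<^bsub>tensor R L L\<^esub> x) ` homog (tensor R L L) d)"
  by (simp add: cyclic_quotient_def quot_supermod_def)

text \<open>
  The three families of generators of the relations are the three identities of a 2-cocycle,
  evaluated at the pure tensors; they become zero in the quotient, which makes the symbol a cocycle.
\<close>

lemma
  assumes "superalgebra R L"
  shows cyclic_relations_submodule: "submodule (cyclic_relations R L) R (tensor R L L)"
    and cyclic_quotient_module: "module R (cyclic_quotient R L)"
    and cyclic_proj_linear: "linear_map R (tensor R L L) (cyclic_quotient R L)
      (\<lambda>x. cyclic_relations R L +>\<^bsub>tensor R L L\<^esub> x)"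
    and homog_cyclic_submodule: "submodule (homog (cyclic_quotient R L) d) R (cyclic_quotient R L)"
    and symb_two_cocycle: "two_cocycle R L (cyclic_quotient R L) (symb R L)"
proof -
  note sa = superalgebra_facts[OF assms]
  note sm = supermodule_facts[OF sa(1)]
  let ?T = "tensor R L L" and ?t = "pure_tensor R L L" and ?C = "cyclic_relations R L"
    and ?Q = "cyclic_quotient R L"
  let ?p = "\<lambda>x. ?C +>\<^bsub>?T\<^esub> x"
  have T: "module R ?T" by (rule tensor_module[OF sm(1,1)])
  then have Tg: "abelian_group ?T" by (rule module.axioms)
  interpret T: abelian_group ?T by (rule Tg)
  note bil = pure_tensor_bilinear[OF sm(1,1)]
  note t = bilinear_map_closed[OF bil sm(3) sm(3)]
  have t3: "?t x (y \<otimes>\<^bsub>L\<^esub> z) \<in> carrier ?T"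
    if "x \<in> homog L a" "y \<in> homog L b" "z \<in> homog L c" for x y z a b c
    using t[OF that(1) sa(5)[OF that(2,3)]] .
  show C: "submodule ?C R ?T"
    unfolding cyclic_relations_def Let_def
    by (rule mod_span_submodule[OF T], (rule Un_least)+)
      (clarify, intro T.a_closed ksign_closed[OF Tg] t t3; assumption)+
  show Q: "module R ?Q"
    unfolding cyclic_quotient_eq by (rule with_grading_module[OF quot_mod_module[OF T C]])
  show p: "linear_map R ?T ?Q ?p"
    unfolding cyclic_quotient_eq with_grading_linear_to by (rule quot_proj_linear[OF T C])
  have h: "homog ?Q d = ?p ` homog ?T d" for d unfolding cyclic_quotient_eq by simp
  show "submodule (homog ?Q d) R ?Q"
    unfolding h by (rule submodule_image[OF T Q p homog_tensor_submodule[OF sa(1,1)]])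
  have p0: "?p g = \<zero>\<^bsub>?Q\<^esub>" if "g \<in> ?C" for g
    using quot_proj_zero[OF T C that] unfolding cyclic_quotient_eq by simp
  have s: "symb R L = (\<lambda>x y. ?p (?t x y))" by (simp add: fun_eq_iff symb_def)
  note pk = linear_map_ksign[OF T Q p]
  show "two_cocycle R L ?Q (symb R L)"
  proof (rule two_cocycleI)
    show "bilinear_map R L L ?Q (symb R L)"
      unfolding s
      by (intro bilinear_mapI linear_map_comp[OF _ p] bilinear_map_linear[OF bil])
    show "symb R L x y \<in> homog ?Q (a + b)" if "x \<in> homog L a" "y \<in> homog L b" for x y a b
    proof -
      have "?t x y \<in> homog ?T (a + b)"
        unfolding homog_tensor by (rule subsetD[OF mod_span_superset]) (use that in blast)
      then show ?thesis unfolding h s by (rule imageI)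
    qed
    show "symb R L x y \<oplus>\<^bsub>?Q\<^esub> ksign ?Q (a * b) (symb R L y x) = \<zero>\<^bsub>?Q\<^esub>"
      if 1: "x \<in> homog L a" "y \<in> homog L b" for x y a b
    proof -
      have "?t x y \<oplus>\<^bsub>?T\<^esub> ksign ?T (a * b) (?t y x) \<in> ?C"
        unfolding cyclic_relations_def Let_def
        by (rule subsetD[OF mod_span_superset]) (use 1 in blast)
      from p0[OF this] show ?thesis
        unfolding linear_map_add[OF p t[OF 1] ksign_closed[OF Tg t[OF 1(2,1)]]] pk[OF t[OF 1(2,1)]] s .
    qed
    show "symb R L x x = \<zero>\<^bsub>?Q\<^esub>" if 1: "x \<in> homog L 0" for x
    proof -
      have "?t x x \<in> ?C"
        unfolding cyclic_relations_def Let_def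
        by (rule subsetD[OF mod_span_superset]) (use 1 in blast)
      from p0[OF this] show ?thesis unfolding s .
    qed
    show "ksign ?Q (a * c) (symb R L x (y \<otimes>\<^bsub>L\<^esub> z)) \<oplus>\<^bsub>?Q\<^esub> ksign ?Q (b * a) (symb R L y (z \<otimes>\<^bsub>L\<^esub> x))
        \<oplus>\<^bsub>?Q\<^esub> ksign ?Q (c * b) (symb R L z (x \<otimes>\<^bsub>L\<^esub> y)) = \<zero>\<^bsub>?Q\<^esub>"
      if 1: "x \<in> homog L a" "y \<in> homog L b" "z \<in> homog L c" for x y z a b c
    proof -
      note u = t3[OF 1(1,2,3)] t3[OF 1(2,3,1)] t3[OF 1(3,1,2)]
      note k = ksign_closed[OF Tg u(1)] ksign_closed[OF Tg u(2)] ksign_closed[OF Tg u(3)]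
      have "ksign ?T (a * c) (?t x (y \<otimes>\<^bsub>L\<^esub> z)) \<oplus>\<^bsub>?T\<^esub> ksign ?T (b * a) (?t y (z \<otimes>\<^bsub>L\<^esub> x))
        \<oplus>\<^bsub>?T\<^esub> ksign ?T (c * b) (?t z (x \<otimes>\<^bsub>L\<^esub> y)) \<in> ?C"
        unfolding cyclic_relations_def Let_def
        by (rule subsetD[OF mod_span_superset]) (use 1 in blast)
      from p0[OF this] show ?thesis
        unfolding linear_map_add[OF p T.a_closed[OF k(1,2)] k(3)] linear_map_add[OF p k(1,2)]
          pk[OF u(1)] pk[OF u(2)] pk[OF u(3)] s .
    qed
  qed
qed

text \<open>
  The symbols generate the quotient additively, as the pure tensors generate the tensor product.
\<close>

lemma cyclic_quotient_induct [consumes 2, case_names symb add]: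
  assumes L: "superalgebra R L" and U: "U \<in> carrier (cyclic_quotient R L)"
    and symb: "\<And>x y. x \<in> carrier L \<Longrightarrow> y \<in> carrier L \<Longrightarrow> P (symb R L x y)"
    and add: "\<And>U V. U \<in> carrier (cyclic_quotient R L) \<Longrightarrow> V \<in> carrier (cyclic_quotient R L) \<Longrightarrow>
      P U \<Longrightarrow> P V \<Longrightarrow> P (U \<oplus>\<^bsub>cyclic_quotient R L\<^esub> V)"
  shows "P U"
proof -
  note sm = supermodule_facts[OF superalgebra_facts(1)[OF L]]
  let ?T = "tensor R L L" and ?p = "\<lambda>x. cyclic_relations R L +>\<^bsub>tensor R L L\<^esub> x"
  note p = cyclic_proj_linear[OF L]
  have "U \<in> ?p ` carrier ?T"
    using U quot_proj_surj[OF tensor_module[OF sm(1,1)] cyclic_relations_submodule[OF L]]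
    unfolding cyclic_quotient_eq by simp
  then obtain T where T: "T \<in> carrier ?T" "U = ?p T" by blast
  from sm(1) sm(1) T(1) have "P (?p T)"
  proof (induction rule: tensor_induct)
    case (pure x y)
    then show ?case using symb by (simp add: symb_def)
  next
    case (add V W)
    show ?case unfolding linear_map_add[OF p add(1,2)]
      using assms(4) linear_map_closed[OF p] add by simp
  qed
  then show ?thesis using T(2) by simp
qed

text \<open>
  The linear map \<open>\<langle>x, y\<rangle> \<mapsto> \<tau>(x, y)\<close>, read off from any representative in the tensor product, as in
  \<^const>\<open>uce_map\<close>, which is the special case where \<open>\<tau>\<close> is the product.
\<close>

definition cocycle_lift ::
  "('k, 'r) ring_scheme \<Rightarrow> ('k, 'c, 'z) module_scheme \<Rightarrow> ('a \<Rightarrow> 'a \<Rightarrow> 'c) \<Rightarrow>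
   ('a \<times> 'a \<Rightarrow> 'k) set set \<Rightarrow> 'c"
  where "cocycle_lift R P \<tau> U = the_elem (tensor_lift R P \<tau> ` U)"

lemma uce_map_eq: "uce_map R L = cocycle_lift R L (mult L)"
  by (simp add: fun_eq_iff uce_map_def cocycle_lift_def)

text \<open>
  Universality of the symbol: the cocycle identities of \<open>\<tau>\<close> say that its extension to the tensor
  product kills the generators of the relations.
\<close>

lemma
  assumes "superalgebra R L" "module R C" "two_cocycle R L C \<tau>"
  shows cocycle_lift_linear: "linear_map R (cyclic_quotient R L) C (cocycle_lift R C \<tau>)"
    and cocycle_lift_symb: "x \<in> carrier L \<Longrightarrow> y \<in> carrier L \<Longrightarrow>
      cocycle_lift R C \<tau> (symb R L x y) = \<tau> x y"
    and cocycle_lift_homog: "(\<And>d. submodule (homog C d) R C) \<Longrightarrow>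
      U \<in> homog (cyclic_quotient R L) d \<Longrightarrow> cocycle_lift R C \<tau> U \<in> homog C d"
proof -
  note sa = superalgebra_facts[OF assms(1)]
  note sm = supermodule_facts[OF sa(1)]
  note D = two_cocycleD[OF assms(3)]
  let ?T = "tensor R L L" and ?t = "pure_tensor R L L" and ?C = "cyclic_relations R L"
  let ?f = "tensor_lift R C \<tau>"
  have T: "module R ?T" by (rule tensor_module[OF sm(1,1)])
  then have Tg: "abelian_group ?T" by (rule module.axioms)
  interpret T: abelian_group ?T by (rule Tg)
  note t = bilinear_map_closed[OF pure_tensor_bilinear[OF sm(1,1)]]
  note f = tensor_lift_linear[OF sm(1,1) assms(2) D(1)]
  note ft = tensor_lift_pure[OF sm(1,1) assms(2) D(1)]
  have fk: "?f (ksign ?T d (?t x y)) = ksign C d (\<tau> x y)" "ksign ?T d (?t x y) \<in> carrier ?T"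
    if "x \<in> carrier L" "y \<in> carrier L" for d x y
    using linear_map_ksign[OF T assms(2) f t[OF that]] ft[OF that] ksign_closed[OF Tg t[OF that]]
    by auto
  note fadd = linear_map_add[OF f]
  note K = cyclic_relations_submodule[OF assms(1)]
  have fK: "?f g = \<zero>\<^bsub>C\<^esub>" if "g \<in> ?C" for g
  proof -
    have kills: "mod_span R ?T S \<subseteq> {g \<in> carrier ?T. ?f g \<in> {\<zero>\<^bsub>C\<^esub>}}"
      if "S \<subseteq> {g \<in> carrier ?T. ?f g \<in> {\<zero>\<^bsub>C\<^esub>}}" for S
      using that
      by (rule mod_span_least[OF submodule_vimage[OF T assms(2) f zero_submodule[OF assms(2)]]])
    have "?C \<subseteq> {g \<in> carrier ?T. ?f g \<in> {\<zero>\<^bsub>C\<^esub>}}"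
      unfolding cyclic_relations_def Let_def
      by (rule kills, (rule Un_least)+; safe)
        (simp_all add: fadd fk ft t sm(3) sa(4) D T.a_closed)
    then show ?thesis using that by blast
  qed
  show "linear_map R (cyclic_quotient R L) C (cocycle_lift R C \<tau>)"
    using quot_lift_linear[OF T K assms(2) f fK]
    unfolding cyclic_quotient_eq with_grading_linear_from cocycle_lift_def[abs_def] .
  have proj: "the_elem (?f ` (?C +>\<^bsub>?T\<^esub> V)) = ?f V" if "V \<in> carrier ?T" for V
    by (rule quot_lift_proj[OF T K assms(2) f fK that])
  show "cocycle_lift R C \<tau> (symb R L x y) = \<tau> x y" if "x \<in> carrier L" "y \<in> carrier L"
    using proj[OF t[OF that]] ft[OF that] by (simp add: cocycle_lift_def symb_def)
  show "cocycle_lift R C \<tau> U \<in> homog C d"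
    if C: "\<And>d. submodule (homog C d) R C" and U: "U \<in> homog (cyclic_quotient R L) d"
  proof -
    obtain V where V: "V \<in> homog ?T d" "U = ?C +>\<^bsub>?T\<^esub> V"
      using U unfolding cyclic_quotient_eq by auto
    have "homog ?T d \<subseteq> {V \<in> carrier ?T. ?f V \<in> homog C d}"
      unfolding homog_tensor
      by (rule mod_span_least[OF submodule_vimage[OF T assms(2) f C]])
        (auto simp: t ft sm(3) D(4))
    then have "?f V \<in> homog C d" "V \<in> carrier ?T" using V(1) by auto
    then show ?thesis using proj V(2) by (simp add: cocycle_lift_def)
  qed
qed

text \<open>
  Writing \<open>x = x\<^sub>0 + x\<^sub>1\<close> and \<open>y = y\<^sub>0 + y\<^sub>1\<close>, the symbols of arguments of equal degree make up the even
  part of \<open>\<langle>x, y\<rangle>\<close>, those of arguments of different degrees the odd part.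
\<close>

lemma cyclic_quotient_decompose:
  assumes "superalgebra R L" "U \<in> carrier (cyclic_quotient R L)"
  shows "\<exists>V \<in> homog (cyclic_quotient R L) 0. \<exists>W \<in> homog (cyclic_quotient R L) 1.
    U = V \<oplus>\<^bsub>cyclic_quotient R L\<^esub> W"
  using assms
proof (induction rule: cyclic_quotient_induct)
  let ?Q = "cyclic_quotient R L" and ?s = "symb R L"
  note Q = cyclic_quotient_module[OF assms(1)]
  interpret Q: module R ?Q by (rule Q)
  note hc = submodule_closed[OF Q homog_cyclic_submodule[OF assms(1)]]
  note sm = supermodule_facts[OF superalgebra_facts(1)[OF assms(1)]]
  note D = two_cocycleD[OF symb_two_cocycle[OF assms(1)]]
  note bil = bilinear_map_linear[OF D(1)]
  {
    case (symb x y)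
    obtain x0 x1 y0 y1 where x: "x0 \<in> homog L 0" "x1 \<in> homog L 1" "x = x0 \<oplus>\<^bsub>L\<^esub> x1"
      and y: "y0 \<in> homog L 0" "y1 \<in> homog L 1" "y = y0 \<oplus>\<^bsub>L\<^esub> y1"
      using sm(4)[OF symb(1)] sm(4)[OF symb(2)] by metis
    note c = sm(3)[OF x(1)] sm(3)[OF x(2)] sm(3)[OF y(1)] sm(3)[OF y(2)]
    have "?s x y = (?s x0 y0 \<oplus>\<^bsub>?Q\<^esub> ?s x1 y1) \<oplus>\<^bsub>?Q\<^esub> (?s x0 y1 \<oplus>\<^bsub>?Q\<^esub> ?s x1 y0)"
      using D(3) linear_map_add[OF bil(1)] linear_map_add[OF bil(2)] c symb
      unfolding x(3) y(3) by (simp add: Q.M.a_ac)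
    moreover have "?s x0 y0 \<oplus>\<^bsub>?Q\<^esub> ?s x1 y1 \<in> homog ?Q 0" "?s x0 y1 \<oplus>\<^bsub>?Q\<^esub> ?s x1 y0 \<in> homog ?Q 1"
      using hc(3) D(4)[OF x(1) y(1)] D(4)[OF x(2) y(2)] D(4)[OF x(1) y(2)] D(4)[OF x(2) y(1)]
      by simp_all
    ultimately show ?case by blast
  next
    case (add U V)
    then obtain U0 U1 V0 V1 where U: "U0 \<in> homog ?Q 0" "U1 \<in> homog ?Q 1" "U = U0 \<oplus>\<^bsub>?Q\<^esub> U1"
      and V: "V0 \<in> homog ?Q 0" "V1 \<in> homog ?Q 1" "V = V0 \<oplus>\<^bsub>?Q\<^esub> V1" by metis
    note c = hc(1)[OF U(1)] hc(1)[OF U(2)] hc(1)[OF V(1)] hc(1)[OF V(2)]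
    have "U \<oplus>\<^bsub>?Q\<^esub> V = (U0 \<oplus>\<^bsub>?Q\<^esub> V0) \<oplus>\<^bsub>?Q\<^esub> (U1 \<oplus>\<^bsub>?Q\<^esub> V1)"
      using c unfolding U(3) V(3) by (simp add: Q.M.a_ac)
    then show ?case using hc(3)[OF U(1) V(1)] hc(3)[OF U(2) V(2)] by blast
  }
qed

lemma cyclic_quotient_map_eqI:
  assumes "superalgebra R L" "linear_map R (cyclic_quotient R L) P f"
    "linear_map R (cyclic_quotient R L) P g"
    "\<And>x y. x \<in> carrier L \<Longrightarrow> y \<in> carrier L \<Longrightarrow> f (symb R L x y) = g (symb R L x y)"
    "U \<in> carrier (cyclic_quotient R L)"
  shows "f U = g U"
  using assms(1,5)
  by (induction rule: cyclic_quotient_induct)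
    (simp_all add: assms(4) linear_map_add[OF assms(2)] linear_map_add[OF assms(3)])

text \<open>
  The functor \<open>uce\<close> on morphisms, \<open>\<langle>x, y\<rangle> \<mapsto> \<langle>g x, g y\<rangle>\<close>.
\<close>

definition cyclic_map ::
  "('k, 'r) ring_scheme \<Rightarrow> ('k, 'b, 'y) supermodule_scheme \<Rightarrow> ('a \<Rightarrow> 'b) \<Rightarrow>
   ('a \<times> 'a \<Rightarrow> 'k) set set \<Rightarrow> ('b \<times> 'b \<Rightarrow> 'k) set set"
  where "cyclic_map R L' g =
    cocycle_lift R (cyclic_quotient R L') (\<lambda>x y. symb R L' (g x) (g y))"

lemma
  assumes "superalgebra R L" "superalgebra R L'" "g \<in> lie_hom R L L'"
  shows cyclic_map_linear:
      "linear_map R (cyclic_quotient R L) (cyclic_quotient R L') (cyclic_map R L' g)"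
    and cyclic_map_symb: "x \<in> carrier L \<Longrightarrow> y \<in> carrier L \<Longrightarrow>
      cyclic_map R L' g (symb R L x y) = symb R L' (g x) (g y)"
proof -
  note c = two_cocycle_pullback[OF superalgebra_facts(1)[OF assms(1)] assms(3)
      symb_two_cocycle[OF assms(2)]]
  show "linear_map R (cyclic_quotient R L) (cyclic_quotient R L') (cyclic_map R L' g)"
    unfolding cyclic_map_def
    by (rule cocycle_lift_linear[OF assms(1) cyclic_quotient_module[OF assms(2)] c])
  show "x \<in> carrier L \<Longrightarrow> y \<in> carrier L \<Longrightarrow>
      cyclic_map R L' g (symb R L x y) = symb R L' (g x) (g y)"
    unfolding cyclic_map_def
    by (rule cocycle_lift_symb[OF assms(1) cyclic_quotient_module[OF assms(2)] c])
qed

lemma cyclic_map_comp: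
  assumes "superalgebra R L" "superalgebra R L'" "superalgebra R L''"
    "g \<in> lie_hom R L L'" "g' \<in> lie_hom R L' L''" "g'' \<in> lie_hom R L L''"
    "\<And>x. x \<in> carrier L \<Longrightarrow> g'' x = g' (g x)" "U \<in> carrier (cyclic_quotient R L)"
  shows "cyclic_map R L'' g'' U = cyclic_map R L'' g' (cyclic_map R L' g U)"
  by (rule cyclic_quotient_map_eqI[OF assms(1) cyclic_map_linear[OF assms(1,3,6)]
        linear_map_comp[OF cyclic_map_linear[OF assms(1,2,4)] cyclic_map_linear[OF assms(2,3,5)]]
        _ assms(8)])
    (simp add: cyclic_map_symb[OF assms(1,3,6)] cyclic_map_symb[OF assms(1,2,4)]
        cyclic_map_symb[OF assms(2,3,5)] lie_homD(2)[OF assms(4)] assms(7))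

section \<open>Extensions by cocycles\<close>

lemma cocycle_extension_simps [simp]:
  "carrier (cocycle_extension L C \<tau>) = carrier L \<times> carrier C"
  "u \<otimes>\<^bsub>cocycle_extension L C \<tau>\<^esub> v = (fst u \<otimes>\<^bsub>L\<^esub> fst v, \<tau> (fst u) (fst v))"
  "\<zero>\<^bsub>cocycle_extension L C \<tau>\<^esub> = (\<zero>\<^bsub>L\<^esub>, \<zero>\<^bsub>C\<^esub>)"
  "u \<oplus>\<^bsub>cocycle_extension L C \<tau>\<^esub> v = (fst u \<oplus>\<^bsub>L\<^esub> fst v, snd u \<oplus>\<^bsub>C\<^esub> snd v)"
  "r \<odot>\<^bsub>cocycle_extension L C \<tau>\<^esub> u = (r \<odot>\<^bsub>L\<^esub> fst u, r \<odot>\<^bsub>C\<^esub> snd u)"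
  "homog (cocycle_extension L C \<tau>) d = homog L d \<times> homog C d"
  by (simp_all add: cocycle_extension_def)

lemma fst_linear: "linear_map R (cocycle_extension L C \<tau>) L fst"
  and snd_linear: "linear_map R (cocycle_extension L C \<tau>) C snd"
  by (auto simp: linear_map_def)

lemma Pair_linear:
  assumes "linear_map R M L f" "linear_map R M C g"
  shows "linear_map R M (cocycle_extension L C \<tau>) (\<lambda>x. (f x, g x))"
  using assms by (auto simp: linear_map_def Pi_iff)

lemma cocycle_extension_module:
  assumes "module R L" "module R C"
  shows "module R (cocycle_extension L C \<tau>)"
proof -
  interpret L: module R L by fact
  interpret C: module R C by fact
  let ?E = "cocycle_extension L C \<tau>"
  show ?thesis
  proof (rule moduleI[OF L.R.is_cring])
    show "abelian_group ?E"
    proof (rule abelian_groupI)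
      fix u assume "u \<in> carrier ?E"
      then show "\<exists>v \<in> carrier ?E. v \<oplus>\<^bsub>?E\<^esub> u = \<zero>\<^bsub>?E\<^esub>"
        by (intro bexI[of _ "(\<ominus>\<^bsub>L\<^esub> fst u, \<ominus>\<^bsub>C\<^esub> snd u)"])
          (auto simp: L.M.l_neg C.M.l_neg)
    qed (auto simp: L.M.a_ac C.M.a_ac)
  qed (auto simp: L.smult_l_distr L.smult_r_distr L.smult_assoc1
      C.smult_l_distr C.smult_r_distr C.smult_assoc1)
qed

lemma ksign_cocycle_extension:
  assumes "module R L" "module R C" "module R (cocycle_extension L C \<tau>)"
    "u \<in> carrier L \<times> carrier C"
  shows "ksign (cocycle_extension L C \<tau>) d u = (ksign L d (fst u), ksign C d (snd u))"
  using linear_map_ksign[OF assms(3,1) fst_linear] linear_map_ksign[OF assms(3,2) snd_linear] assms(4)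
  by (simp add: prod_eq_iff)

text \<open>
  With \<open>\<sigma>\<close> the bracket of \<open>L\<close> this produces both the product of the extension and the cocycle behind the
  comparison map.
\<close>

lemma two_cocycle_Pair:
  assumes "superalgebra R L" "supermodule R L'" "supermodule R C" "two_cocycle R L L' \<sigma>" "two_cocycle R L C \<tau>"
  shows "two_cocycle R L (cocycle_extension L' C \<rho>) (\<lambda>x y. (\<sigma> x y, \<tau> x y))"
proof -
  note sa = superalgebra_facts[OF assms(1)]
  note c = supermodule_facts(3)[OF sa(1)]
  note m = supermodule_facts(1)[OF assms(2)] supermodule_facts(1)[OF assms(3)]
  note k = ksign_cocycle_extension[OF m cocycle_extension_module[OF m]]
  note S = two_cocycleD[OF assms(4)] and T = two_cocycleD[OF assms(5)]
  show ?thesis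
  proof (rule two_cocycleI)
    show "bilinear_map R L L (cocycle_extension L' C \<rho>) (\<lambda>x y. (\<sigma> x y, \<tau> x y))"
      by (intro bilinear_mapI Pair_linear bilinear_map_linear[OF S(1)] bilinear_map_linear[OF T(1)])
  qed (simp_all add: k c sa(4) S(3-) T(3-))
qed

lemma cocycle_extension_supermodule:
  assumes "supermodule R L" "supermodule R C"
  shows "supermodule R (cocycle_extension L C \<tau>)"
proof (rule supermoduleI)
  let ?E = "cocycle_extension L C \<tau>"
  note L = supermodule_facts[OF assms(1)] and C = supermodule_facts[OF assms(2)]
  show E: "module R ?E" by (rule cocycle_extension_module[OF L(1) C(1)])
  show "submodule (homog ?E d) R ?E" for d
    using submodule_closed[OF L(1) L(2)[of d]] submodule_closed[OF C(1) C(2)[of d]]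
    by (intro submoduleI_no_minus[OF E]) auto
  show "\<exists>v \<in> homog ?E 0. \<exists>w \<in> homog ?E 1. u = v \<oplus>\<^bsub>?E\<^esub> w" if "u \<in> carrier ?E" for u
    using L(4)[of "fst u"] C(4)[of "snd u"] that by (fastforce simp: prod_eq_iff)
  show "u = \<zero>\<^bsub>?E\<^esub>" if "u \<in> homog ?E 0" "u \<in> homog ?E 1" for u
    using that L(5) C(5) by auto
qed

text \<open>
  The product of the extension depends on the first components only: it is the pullback along
  the projection of the \<open>(L \<oplus> C)\<close>-valued cocycle \<open>([x, y], \<tau>(x, y))\<close> on \<open>L\<close>.
\<close>

lemma cocycle_extension_central:
  assumes "lie_superalgebra R L" "supermodule R C" "two_cocycle R L C \<tau>"
  shows "central_extension R (cocycle_extension L C \<tau>) fst L"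
proof -
  let ?E = "cocycle_extension L C \<tau>"
  have sL: "supermodule R L" "two_cocycle R L L (mult L)"
    using assms(1) by (auto simp: lie_superalgebra_iff)
  note saL = lie_superalgebra_superalgebra[OF assms(1)]
  note L = supermodule_facts[OF sL(1)] and C = supermodule_facts[OF assms(2)]
  note E = cocycle_extension_supermodule[OF sL(1) assms(2)]
  have fst: "fst \<in> lie_hom R ?E L" by (rule lie_homI[OF fst_linear]) auto
  have "two_cocycle R ?E ?E (\<lambda>u v. (fst u \<otimes>\<^bsub>L\<^esub> fst v, \<tau> (fst u) (fst v)))"
    by (rule two_cocycle_pullback[OF E fst two_cocycle_Pair[OF saL sL(1) assms(2) sL(2) assms(3)]])
  then have lie: "lie_superalgebra R ?E"
    using E unfolding lie_superalgebra_iff by (simp add: cocycle_extension_def)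
  have "\<zero>\<^bsub>C\<^esub> \<in> carrier C" using submodule_closed(2)[OF C(1,2)] C(3) by blast
  then have "fst ` carrier ?E = carrier L" by auto
  moreover have "a_kernel ?E L fst \<subseteq> lie_center ?E"
  proof
    fix u assume "u \<in> a_kernel ?E L fst"
    then have u: "u \<in> carrier ?E" "fst u = \<zero>\<^bsub>L\<^esub>" by (auto simp: a_kernel_def')
    have "\<zero>\<^bsub>L\<^esub> \<otimes>\<^bsub>L\<^esub> x = \<zero>\<^bsub>L\<^esub>" "\<tau> \<zero>\<^bsub>L\<^esub> x = \<zero>\<^bsub>C\<^esub>" if "x \<in> carrier L" for x
      using linear_map_zero[OF L(1,1) bilinear_map_linear(1)[OF two_cocycleD(1)[OF sL(2)] that]]
        linear_map_zero[OF L(1) C(1) bilinear_map_linear(1)[OF two_cocycleD(1)[OF assms(3)] that]]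
      by simp_all
    then show "u \<in> lie_center ?E" using u by (auto simp: lie_center_def)
  qed
  ultimately show "central_extension R ?E fst L"
    using assms(1) lie fst by (simp add: central_extension_def)
qed

text \<open>
  Conversely, the coefficients are the image of the extension under the second projection, and the
  cocycle is the second component of the product.
\<close>

lemma
  assumes "lie_superalgebra R L" "lie_superalgebra R (cocycle_extension L C \<tau>)"
  shows cocycle_extension_coefficients: "supermodule R C"
    and cocycle_extension_cocycle: "two_cocycle R L C \<tau>"
proof -
  let ?E = "cocycle_extension L C \<tau>"
  have sL: "supermodule R L" "two_cocycle R L L (mult L)"
    and sE: "supermodule R ?E" "two_cocycle R ?E ?E (mult ?E)"
    using assms by (auto simp: lie_superalgebra_iff)
  note saL = superalgebra_facts[OF lie_superalgebra_superalgebra[OF assms(1)]]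
  note L = supermodule_facts[OF sL(1)] and E = supermodule_facts[OF sE(1)]
  have L0: "\<zero>\<^bsub>L\<^esub> \<in> homog L d" "\<zero>\<^bsub>L\<^esub> \<in> carrier L" for d
    using submodule_closed(2)[OF L(1,2)] L(3) by blast+
  have C0: "\<zero>\<^bsub>C\<^esub> \<in> homog C d" "\<zero>\<^bsub>C\<^esub> \<in> carrier C" for d
    using submodule_closed(2)[OF E(1,2), of d] E(3)[of "\<zero>\<^bsub>?E\<^esub>" d] by auto
  have "snd ` carrier ?E = carrier C" using L0 by force
  then have mC: "module R C"
    by (rule module_of_surjection[OF E(1) snd_linear]) simp
  show C: "supermodule R C"
  proof (rule supermoduleI[OF mC])
    have "snd ` homog ?E d = homog C d" for d using L0(1)[of d] by force
    then show "submodule (homog C d) R C" for d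
      using submodule_image[OF E(1) mC snd_linear E(2)] by metis
    show "\<exists>y \<in> homog C 0. \<exists>z \<in> homog C 1. x = y \<oplus>\<^bsub>C\<^esub> z" if "x \<in> carrier C" for x
      using E(4)[of "(\<zero>\<^bsub>L\<^esub>, x)"] that L0(2) by fastforce
    show "x = \<zero>\<^bsub>C\<^esub>" if "x \<in> homog C 0" "x \<in> homog C 1" for x
      using E(5)[of "(\<zero>\<^bsub>L\<^esub>, x)"] that L0(1) by simp
  qed
  note T = two_cocycleD[OF sE(2)]
  note k = ksign_cocycle_extension[OF L(1) mC E(1)]
  have "linear_map R L ?E (\<lambda>x. (x, \<zero>\<^bsub>C\<^esub>))"
  proof -
    interpret C: module R C by (rule mC)
    show ?thesis by (auto simp: linear_map_def)
  qed
  note b = bilinear_map_comp[OF this T(1)]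
  have "bilinear_map R L L C (\<lambda>x y. snd ((x, \<zero>\<^bsub>C\<^esub>) \<otimes>\<^bsub>?E\<^esub> (y, \<zero>\<^bsub>C\<^esub>)))"
    by (intro bilinear_mapI linear_map_comp[OF bilinear_map_linear(1)[OF b] snd_linear]
        linear_map_comp[OF bilinear_map_linear(2)[OF b] snd_linear])
  then have bil: "bilinear_map R L L C \<tau>" by simp
  note c = bilinear_map_closed[OF bil]
  show "two_cocycle R L C \<tau>"
  proof (rule two_cocycleI[OF bil])
    show "\<tau> x y \<in> homog C (a + b)" if "x \<in> homog L a" "y \<in> homog L b" for a b x y
      using T(4)[of "(x, \<zero>\<^bsub>C\<^esub>)" a "(y, \<zero>\<^bsub>C\<^esub>)" b] that C0 by simp
    show "\<tau> x y \<oplus>\<^bsub>C\<^esub> ksign C (a * b) (\<tau> y x) = \<zero>\<^bsub>C\<^esub>"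
      if "x \<in> homog L a" "y \<in> homog L b" for a b x y
      using T(5)[of "(x, \<zero>\<^bsub>C\<^esub>)" a "(y, \<zero>\<^bsub>C\<^esub>)" b] that C0 by (simp add: k c L(3) saL(4))
    show "\<tau> x x = \<zero>\<^bsub>C\<^esub>" if "x \<in> homog L 0" for x
      using T(6)[of "(x, \<zero>\<^bsub>C\<^esub>)"] that C0 by simp
    show "ksign C (a * c') (\<tau> x (y \<otimes>\<^bsub>L\<^esub> z)) \<oplus>\<^bsub>C\<^esub> ksign C (b * a) (\<tau> y (z \<otimes>\<^bsub>L\<^esub> x))
        \<oplus>\<^bsub>C\<^esub> ksign C (c' * b) (\<tau> z (x \<otimes>\<^bsub>L\<^esub> y)) = \<zero>\<^bsub>C\<^esub>"
      if "x \<in> homog L a" "y \<in> homog L b" "z \<in> homog L c'" for a b c' x y z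
      using T(7)[of "(x, \<zero>\<^bsub>C\<^esub>)" a "(y, \<zero>\<^bsub>C\<^esub>)" b "(z, \<zero>\<^bsub>C\<^esub>)" c'] that C0
      by (simp add: k c L(3) saL(4))
  qed
qed

section \<open>Comparing uce with the extension by a cocycle\<close>

lemma uce_simps [simp]:
  "carrier (uce R L) = carrier (cyclic_quotient R L)"
  "\<zero>\<^bsub>uce R L\<^esub> = \<zero>\<^bsub>cyclic_quotient R L\<^esub>"
  "add (uce R L) = add (cyclic_quotient R L)" "smult (uce R L) = smult (cyclic_quotient R L)"
  "homog (uce R L) = homog (cyclic_quotient R L)"
  "U \<otimes>\<^bsub>uce R L\<^esub> V = symb R L (uce_map R L U) (uce_map R L V)"
  by (simp_all add: uce_def)

lemma
  assumes "lie_superalgebra R L"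
  shows uce_map_linear: "linear_map R (cyclic_quotient R L) L (uce_map R L)"
    and uce_map_symb: "x \<in> carrier L \<Longrightarrow> y \<in> carrier L \<Longrightarrow> uce_map R L (symb R L x y) = x \<otimes>\<^bsub>L\<^esub> y"
    and uce_map_lie_hom: "uce_map R L \<in> lie_hom R (uce R L) L"
proof -
  have sL: "supermodule R L" "two_cocycle R L L (mult L)"
    using assms by (auto simp: lie_superalgebra_iff)
  note L = supermodule_facts[OF sL(1)]
  note sa = lie_superalgebra_superalgebra[OF assms]
  show lin: "linear_map R (cyclic_quotient R L) L (uce_map R L)"
    and symb: "\<And>x y. x \<in> carrier L \<Longrightarrow> y \<in> carrier L \<Longrightarrow> uce_map R L (symb R L x y) = x \<otimes>\<^bsub>L\<^esub> y"
    unfolding uce_map_eq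
    using cocycle_lift_linear[OF sa L(1) sL(2)] cocycle_lift_symb[OF sa L(1) sL(2)] by auto
  show "uce_map R L \<in> lie_hom R (uce R L) L"
  proof (rule lie_homI)
    show "linear_map R (uce R L) L (uce_map R L)" using lin by (simp add: linear_map_def)
    show "uce_map R L U \<in> homog L d" if "U \<in> homog (uce R L) d" for U d
      using cocycle_lift_homog[OF sa L(1) sL(2) L(2)] that unfolding uce_map_eq by simp
  qed (simp add: symb linear_map_closed[OF lin])
qed

text \<open>
  The product of \<open>uce L\<close> is the pullback of the universal cocycle along the canonical map to \<open>L\<close>, so it
  satisfies the Lie identities.  What remains is the grading: the homogeneous parts are images in a
  quotient and might overlap, which the second hypothesis excludes.
\<close>

lemma uce_lie_superalgebra:
  assumes "lie_superalgebra R L"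
    "\<And>U. U \<in> homog (cyclic_quotient R L) 0 \<Longrightarrow> U \<in> homog (cyclic_quotient R L) 1 \<Longrightarrow>
      U = \<zero>\<^bsub>cyclic_quotient R L\<^esub>"
  shows "lie_superalgebra R (uce R L)"
proof -
  let ?Q = "cyclic_quotient R L" and ?U = "uce R L"
  note sa = lie_superalgebra_superalgebra[OF assms(1)]
  have Q: "supermodule R ?Q"
    by (rule supermoduleI[OF cyclic_quotient_module[OF sa] homog_cyclic_submodule[OF sa]
          cyclic_quotient_decompose[OF sa] assms(2)])
  have U: "module R ?U" by (rule module_cong[OF cyclic_quotient_module[OF sa]]) simp_all
  have id: "linear_map R ?Q ?U (\<lambda>u. u)" by (simp add: linear_map_def)
  have sU: "supermodule R ?U"
    using submodule_image[OF cyclic_quotient_module[OF sa] U id homog_cyclic_submodule[OF sa]]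
      cyclic_quotient_decompose[OF sa] assms(2)
    by (intro supermoduleI[OF U]) simp_all
  have "two_cocycle R L ?U (symb R L)"
    by (rule two_cocycle_postcomp[OF superalgebra_facts(1)[OF sa] sa cyclic_quotient_module[OF sa] U id
          _ symb_two_cocycle[OF sa]]) simp
  from two_cocycle_pullback[OF sU uce_map_lie_hom[OF assms(1)] this]
  show ?thesis using sU unfolding lie_superalgebra_iff by (simp add: uce_def)
qed

abbreviation uce_to_extension ::
  "('k, 'r) ring_scheme \<Rightarrow> ('k, 'a, 'x) supermodule_scheme \<Rightarrow> ('k, 'c, 'y) supermodule_scheme \<Rightarrow>
   ('a \<Rightarrow> 'a \<Rightarrow> 'c) \<Rightarrow> ('a \<times> 'a \<Rightarrow> 'k) set set \<Rightarrow> 'a \<times> 'c"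
  where "uce_to_extension R L C \<tau> \<equiv>
    cocycle_lift R (cocycle_extension L C \<tau>) (\<lambda>x y. (x \<otimes>\<^bsub>L\<^esub> y, \<tau> x y))"

lemma
  assumes L: "lie_superalgebra R L" and C: "supermodule R C" and tau: "two_cocycle R L C \<tau>"
  shows uce_to_extension_linear: "linear_map R (cyclic_quotient R L) (cocycle_extension L C \<tau>)
      (uce_to_extension R L C \<tau>)"
    and uce_to_extension_symb: "x \<in> carrier L \<Longrightarrow> y \<in> carrier L \<Longrightarrow>
      uce_to_extension R L C \<tau> (symb R L x y)
      = (x \<otimes>\<^bsub>L\<^esub> y, \<tau> x y)"
    and uce_to_extension_homog: "U \<in> homog (cyclic_quotient R L) d \<Longrightarrow>
      uce_to_extension R L C \<tau> U
      \<in> homog (cocycle_extension L C \<tau>) d"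
proof -
  have sL: "supermodule R L" "two_cocycle R L L (mult L)"
    using L by (auto simp: lie_superalgebra_iff)
  note sa = lie_superalgebra_superalgebra[OF L]
  note E = supermodule_facts[OF cocycle_extension_supermodule[OF sL(1) C]]
  note cE = two_cocycle_Pair[OF sa sL(1) C sL(2) tau, where \<rho> = \<tau>]
  show "linear_map R (cyclic_quotient R L) (cocycle_extension L C \<tau>)
      (uce_to_extension R L C \<tau>)"
    by (rule cocycle_lift_linear[OF sa E(1) cE])
  show "x \<in> carrier L \<Longrightarrow> y \<in> carrier L \<Longrightarrow>
      uce_to_extension R L C \<tau> (symb R L x y)
      = (x \<otimes>\<^bsub>L\<^esub> y, \<tau> x y)"
    by (rule cocycle_lift_symb[OF sa E(1) cE])
  show "U \<in> homog (cyclic_quotient R L) d \<Longrightarrow>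
      uce_to_extension R L C \<tau> U
      \<in> homog (cocycle_extension L C \<tau>) d"
    by (rule cocycle_lift_homog[OF sa E(1) cE E(2)])
qed

text \<open>
  Degrees are preserved by the comparison map, so an element that is both even and odd is sent to
  zero; this is how injectivity provides the grading.  Surjectivity is used for the canonical map,
  whose image lies in the span of all brackets.
\<close>

lemma uce_iso_extension:
  assumes L: "lie_superalgebra R L" and C: "supermodule R C" and tau: "two_cocycle R L C \<tau>"
    and bij: "bij_betw (uce_to_extension R L C \<tau>)
      (carrier (cyclic_quotient R L)) (carrier (cocycle_extension L C \<tau>))"
  shows "central_extension_iso R L (uce R L) (uce_map R L) (cocycle_extension L C \<tau>) fst
      (uce_to_extension R L C \<tau>)"
    and "perfect R L"
proof -
  let ?E = "cocycle_extension L C \<tau>" and ?Q = "cyclic_quotient R L"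
  let ?h = "uce_to_extension R L C \<tau>"
  have sL: "supermodule R L" "two_cocycle R L L (mult L)"
    using L by (auto simp: lie_superalgebra_iff)
  note sa = lie_superalgebra_superalgebra[OF L]
  note fL = supermodule_facts[OF sL(1)]
  note E = supermodule_facts[OF cocycle_extension_supermodule[OF sL(1) C, where \<tau> = \<tau>]]
  note h = uce_to_extension_linear[OF L C tau]
  note hs = uce_to_extension_symb[OF L C tau]
  note hd = uce_to_extension_homog[OF L C tau]
  note Q = cyclic_quotient_module[OF sa]
  note u = uce_map_linear[OF L]
  have fst_h: "fst (?h U) = uce_map R L U" if "U \<in> carrier ?Q" for U
    by (rule cyclic_quotient_map_eqI[OF sa linear_map_comp[OF h fst_linear] u _ that])
      (simp add: hs uce_map_symb[OF L])
  have hmult: "?h (U \<otimes>\<^bsub>uce R L\<^esub> V) = ?h U \<otimes>\<^bsub>?E\<^esub> ?h V"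
    if "U \<in> carrier ?Q" "V \<in> carrier ?Q" for U V
    using that by (simp add: hs fst_h linear_map_closed[OF u])
  have lie: "lie_superalgebra R (uce R L)"
  proof (rule uce_lie_superalgebra[OF L])
    fix U assume U: "U \<in> homog ?Q 0" "U \<in> homog ?Q 1"
    have "?h U = \<zero>\<^bsub>?E\<^esub>" using E(5) hd[OF U(1)] hd[OF U(2)] by blast
    also have "\<dots> = ?h \<zero>\<^bsub>?Q\<^esub>" by (rule linear_map_zero[OF Q E(1) h, symmetric])
    finally show "U = \<zero>\<^bsub>?Q\<^esub>"
      using bij_betw_imp_inj_on[OF bij] submodule_closed(1)[OF Q homog_cyclic_submodule[OF sa]]
        submodule_closed(2)[OF Q homog_cyclic_submodule[OF sa]] U(1)
      by (meson inj_onD)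
  qed
  have h_hom: "?h \<in> lie_hom R (uce R L) ?E"
  proof (rule lie_homI)
    show "linear_map R (uce R L) ?E ?h" using h by (simp add: linear_map_def)
  qed (use hmult hd in \<open>simp_all del: cocycle_extension_simps uce_simps(6)\<close>)
  have ext: "central_extension R ?E fst L" by (rule cocycle_extension_central[OF L C tau])
  have surj: "uce_map R L ` carrier ?Q = carrier L"
  proof -
    have "uce_map R L ` carrier ?Q = fst ` (?h ` carrier ?Q)"
      unfolding image_image by (rule image_cong[OF refl]) (simp add: fst_h)
    also have "\<dots> = fst ` carrier ?E" using bij by (simp only: bij_betw_imp_surj_on)
    also have "\<dots> = carrier L" using ext by (simp only: central_extension_def)
    finally show ?thesis .
  qed
  have "a_kernel (uce R L) L (uce_map R L) \<subseteq> lie_center (uce R L)"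
  proof
    fix U assume "U \<in> a_kernel (uce R L) L (uce_map R L)"
    then have U: "U \<in> carrier ?Q" "uce_map R L U = \<zero>\<^bsub>L\<^esub>" by (auto simp: a_kernel_def')
    have "symb R L \<zero>\<^bsub>L\<^esub> x = \<zero>\<^bsub>?Q\<^esub>" if "x \<in> carrier L" for x
      using linear_map_zero[OF fL(1) Q
          bilinear_map_linear(1)[OF two_cocycleD(1)[OF symb_two_cocycle[OF sa]] that]] .
    then show "U \<in> lie_center (uce R L)"
      using U linear_map_closed[OF u] by (auto simp: lie_center_def)
  qed
  then have "central_extension R (uce R L) (uce_map R L) L"
    using L lie uce_map_lie_hom[OF L] surj by (simp add: central_extension_def)
  then show "central_extension_iso R L (uce R L) (uce_map R L) ?E fst ?h"
    using ext h_hom bij fst_h unfolding central_extension_iso_def by simp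
  have gen: "{x \<otimes>\<^bsub>L\<^esub> y | x y. x \<in> carrier L \<and> y \<in> carrier L} \<subseteq> carrier L"
    using superalgebra_facts(4)[OF sa] by auto
  note dm = mod_span_submodule[OF fL(1) gen, folded derived_def]
  have "uce_map R L U \<in> derived R L" if "U \<in> carrier ?Q" for U
    using sa that
  proof (induction rule: cyclic_quotient_induct)
    case (symb x y)
    then show ?case
      unfolding uce_map_symb[OF L symb] derived_def by (intro subsetD[OF mod_span_superset]) blast
  next
    case (add U V)
    then show ?case
      using submodule_closed(3)[OF fL(1) dm] by (simp add: linear_map_add[OF u])
  qed
  then have "carrier L \<subseteq> derived R L" unfolding surj[symmetric] by (rule image_subsetI)
  moreover have "derived R L \<subseteq> carrier L" using submodule_closed(1)[OF fL(1) dm] by (rule subsetI)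
  ultimately show "perfect R L" by (simp add: perfect_def)
qed

text \<open>
  Both sides are linear in \<open>U\<close>, and they agree on symbols because \<open>g\<close> respects the brackets and the
  cocycles.
\<close>

lemma uce_to_extension_natural:
  assumes "lie_superalgebra R L" "lie_superalgebra R L'" "supermodule R C"
    "two_cocycle R L C \<tau>" "two_cocycle R L' C \<tau>'" "g \<in> lie_hom R L L'"
    "\<And>x y. x \<in> carrier L \<Longrightarrow> y \<in> carrier L \<Longrightarrow> \<tau>' (g x) (g y) = \<tau> x y"
    "U \<in> carrier (cyclic_quotient R L)"
  shows "uce_to_extension R L' C \<tau>' (cyclic_map R L' g U)
    = map_prod g id (uce_to_extension R L C \<tau> U)"
proof -
  note sa = lie_superalgebra_superalgebra[OF assms(1)]
    and sa' = lie_superalgebra_superalgebra[OF assms(2)]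
  note g = lie_homD[OF assms(6)]
  have lin: "linear_map R (cocycle_extension L C \<tau>) (cocycle_extension L' C \<tau>') (map_prod g id)"
    using g(1) by (auto simp: linear_map_def Pi_iff)
  show ?thesis
    by (rule cyclic_quotient_map_eqI[OF sa
          linear_map_comp[OF cyclic_map_linear[OF sa sa' assms(6)] uce_to_extension_linear[OF assms(2,3,5)]]
          linear_map_comp[OF uce_to_extension_linear[OF assms(1,3,4)] lin] _ assms(8)])
      (simp add: cyclic_map_symb[OF sa sa' assms(6)] uce_to_extension_symb[OF assms(2,3,5)]
        uce_to_extension_symb[OF assms(1,3,4)] g assms(7))
qed

section \<open>Direct limits\<close>

locale lie_directed_limit =
  fixes R :: "('k, 'r) ring_scheme" and I :: "'i set" and leq :: "'i \<Rightarrow> 'i \<Rightarrow> bool"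
    and L :: "'i \<Rightarrow> ('k, 'a, 'x) supermodule_scheme" and f :: "'i \<Rightarrow> 'i \<Rightarrow> 'a \<Rightarrow> 'a"
  assumes directed: "directed_set I leq" and system: "lie_directed_system R I leq L f"
begin

abbreviation \<phi> :: "'i \<Rightarrow> 'a \<Rightarrow> ('i \<times> 'a) set"
  where "\<phi> \<equiv> lim_inj I leq L f"

abbreviation Lim :: "('k, ('i \<times> 'a) set) supermodule"
  where "Lim \<equiv> direct_limit I leq L f"

lemma index: "I \<noteq> {}" "i \<in> I \<Longrightarrow> leq i i"
  "i \<in> I \<Longrightarrow> j \<in> I \<Longrightarrow> l \<in> I \<Longrightarrow> leq i j \<Longrightarrow> leq j l \<Longrightarrow> leq i l"
  using directed unfolding directed_set_def reflp_on_def transp_on_def by blast+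

lemma upper_bound:
  assumes "i \<in> I" "j \<in> I"
  obtains l where "l \<in> I" "leq i l" "leq j l"
  using directed assms unfolding directed_set_def by blast

lemma lie: "i \<in> I \<Longrightarrow> lie_superalgebra R (L i)"
  using system unfolding lie_directed_system_def by blast

lemma f_hom: "i \<in> I \<Longrightarrow> j \<in> I \<Longrightarrow> leq i j \<Longrightarrow> f j i \<in> lie_hom R (L i) (L j)"
  using system unfolding lie_directed_system_def by blast

lemma f_id: "i \<in> I \<Longrightarrow> x \<in> carrier (L i) \<Longrightarrow> f i i x = x"
  using system unfolding lie_directed_system_def by blast

lemma f_comp:
  "i \<in> I \<Longrightarrow> j \<in> I \<Longrightarrow> l \<in> I \<Longrightarrow> leq i j \<Longrightarrow> leq j l \<Longrightarrow> x \<in> carrier (L i) \<Longrightarrow>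
    f l j (f j i x) = f l i x"
  using system unfolding lie_directed_system_def by metis

lemma f_closed: "i \<in> I \<Longrightarrow> j \<in> I \<Longrightarrow> leq i j \<Longrightarrow> x \<in> carrier (L i) \<Longrightarrow> f j i x \<in> carrier (L j)"
  by (rule lie_homD(2)[OF f_hom])

lemma stage:
  assumes "i \<in> I"
  shows "superalgebra R (L i)" "supermodule R (L i)" "module R (L i)"
    "two_cocycle R (L i) (L i) (mult (L i))"
  using lie[OF assms] lie_superalgebra_superalgebra supermodule_facts(1)
  by (auto simp: lie_superalgebra_iff)

lemma mem_phi:
  "(j, y) \<in> \<phi> i x \<longleftrightarrow>
    j \<in> I \<and> y \<in> carrier (L j) \<and> (\<exists>l \<in> I. leq i l \<and> leq j l \<and> f l i x = f l j y)"
  by (simp add: lim_inj_def)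

text \<open>
  This is what makes identification in the limit transitive: the stages at which two identifications
  happen can be replaced by a common later one.
\<close>

lemma equal_further:
  assumes "i \<in> I" "j \<in> I" "l \<in> I" "m \<in> I" "leq i l" "leq j l" "leq l m"
    "x \<in> carrier (L i)" "y \<in> carrier (L j)" "f l i x = f l j y"
  shows "f m i x = f m j y"
  using f_comp[OF assms(1,3,4,5,7,8)] f_comp[OF assms(2,3,4,6,7,9)] assms(10) by simp

lemma phi_sub:
  assumes "i \<in> I" "j \<in> I" "l \<in> I" "leq i l" "leq j l"
    "x \<in> carrier (L i)" "y \<in> carrier (L j)" "f l i x = f l j y"
  shows "\<phi> i x \<subseteq> \<phi> j y"
proof
  fix p assume p: "p \<in> \<phi> i x"
  obtain k z where pkz: "p = (k, z)" by (cases p)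
  then obtain l' where k: "k \<in> I" "z \<in> carrier (L k)"
    and l': "l' \<in> I" "leq i l'" "leq k l'" "f l' i x = f l' k z"
    using p mem_phi by auto
  obtain m where m: "m \<in> I" "leq l m" "leq l' m" using upper_bound[OF assms(3) l'(1)] .
  have "f m j y = f m i x"
    using equal_further[OF assms(1,2,3) m(1) assms(4,5) m(2) assms(6-8)] by simp
  also have "\<dots> = f m k z"
    by (rule equal_further[OF assms(1) k(1) l'(1) m(1) l'(2,3) m(3) assms(6) k(2) l'(4)])
  finally show "p \<in> \<phi> j y"
    unfolding pkz mem_phi using k m l' index(3)[OF assms(2,3) m(1) assms(5) m(2)]
      index(3)[OF k(1) l'(1) m(1) l'(3) m(3)] by blast
qed

lemma phi_eq_iff:
  assumes "i \<in> I" "j \<in> I" "x \<in> carrier (L i)" "y \<in> carrier (L j)"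
  shows "\<phi> i x = \<phi> j y \<longleftrightarrow> (\<exists>l \<in> I. leq i l \<and> leq j l \<and> f l i x = f l j y)"
proof
  assume "\<phi> i x = \<phi> j y"
  moreover have "(j, y) \<in> \<phi> j y" unfolding mem_phi using assms index(2) by blast
  ultimately show "\<exists>l \<in> I. leq i l \<and> leq j l \<and> f l i x = f l j y"
    using mem_phi by blast
next
  assume "\<exists>l \<in> I. leq i l \<and> leq j l \<and> f l i x = f l j y"
  then obtain l where l: "l \<in> I" "leq i l" "leq j l" "f l i x = f l j y" by blast
  show "\<phi> i x = \<phi> j y"
    using phi_sub[OF assms(1,2) l(1,2,3) assms(3,4) l(4)]
      phi_sub[OF assms(2,1) l(1,3,2) assms(4,3) l(4)[symmetric]] by (rule equalityI)
qed

lemma phi_f: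
  assumes "i \<in> I" "j \<in> I" "leq i j" "x \<in> carrier (L i)"
  shows "\<phi> j (f j i x) = \<phi> i x"
  unfolding phi_eq_iff[OF assms(2,1) f_closed[OF assms] assms(4)]
  using f_id[OF assms(2) f_closed[OF assms]] assms index(2) by (intro bexI[of _ j]) simp_all

lemma carrier_Lim: "carrier Lim = (\<Union>i \<in> I. \<phi> i ` carrier (L i))"
  by (simp add: direct_limit_def Let_def)

lemma homog_Lim: "homog Lim d = (\<Union>i \<in> I. \<phi> i ` homog (L i) d)"
  by (simp add: direct_limit_def Let_def)

lemma phi_closed: "i \<in> I \<Longrightarrow> x \<in> carrier (L i) \<Longrightarrow> \<phi> i x \<in> carrier Lim"
  unfolding carrier_Lim by blast

lemma phi_homog: "i \<in> I \<Longrightarrow> x \<in> homog (L i) d \<Longrightarrow> \<phi> i x \<in> homog Lim d"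
  unfolding homog_Lim by blast

text \<open>
  The operations of the limit are unions over all representatives.  All classes in such a union
  agree, because an operation that commutes with the transition maps does not depend on the stage.
\<close>

lemma limit_operation:
  assumes closed: "\<And>l x y. l \<in> I \<Longrightarrow> x \<in> carrier (L l) \<Longrightarrow> y \<in> carrier (L l) \<Longrightarrow> op l x y \<in> carrier (L l)"
    and nat: "\<And>l m x y. l \<in> I \<Longrightarrow> m \<in> I \<Longrightarrow> leq l m \<Longrightarrow> x \<in> carrier (L l) \<Longrightarrow> y \<in> carrier (L l) \<Longrightarrow>
      f m l (op l x y) = op m (f m l x) (f m l y)"
    and i: "i \<in> I" and x: "x \<in> carrier (L i)" and y: "y \<in> carrier (L i)"
  shows "\<Union>{\<phi> l (op l (f l p u) (f l q v)) | p u q v l.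
      (p, u) \<in> \<phi> i x \<and> (q, v) \<in> \<phi> i y \<and> l \<in> I \<and> leq p l \<and> leq q l} = \<phi> i (op i x y)"
    (is "\<Union>?S = _")
proof -
  have "X = \<phi> i (op i x y)" if "X \<in> ?S" for X
  proof -
    from that obtain p u q v l where X: "X = \<phi> l (op l (f l p u) (f l q v))"
      and pu: "(p, u) \<in> \<phi> i x" and qv: "(q, v) \<in> \<phi> i y" and l: "l \<in> I" "leq p l" "leq q l"
      by blast
    from pu obtain a where p: "p \<in> I" "u \<in> carrier (L p)"
      and a: "a \<in> I" "leq i a" "leq p a" "f a i x = f a p u" unfolding mem_phi by blast
    from qv obtain b where q: "q \<in> I" "v \<in> carrier (L q)"
      and b: "b \<in> I" "leq i b" "leq q b" "f b i y = f b q v" unfolding mem_phi by blast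
    obtain c where c: "c \<in> I" "leq a c" "leq b c" using upper_bound[OF a(1) b(1)] .
    obtain m where m: "m \<in> I" "leq c m" "leq l m" using upper_bound[OF c(1) l(1)] .
    have am: "leq a m" and bm: "leq b m"
      using index(3)[OF a(1) c(1) m(1) c(2) m(2)] index(3)[OF b(1) c(1) m(1) c(3) m(2)] .
    have im: "leq i m" using index(3)[OF i a(1) m(1) a(2) am] .
    have lu: "f l p u \<in> carrier (L l)" and lv: "f l q v \<in> carrier (L l)"
      using f_closed p q l by auto
    have "f m l (op l (f l p u) (f l q v)) = op m (f m p u) (f m q v)"
      using nat[OF l(1) m(1,3) lu lv] f_comp[OF p(1) l(1) m(1) l(2) m(3) p(2)]
        f_comp[OF q(1) l(1) m(1) l(3) m(3) q(2)] by simp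
    also have "\<dots> = op m (f m i x) (f m i y)"
      using equal_further[OF i p(1) a(1) m(1) a(2,3) am x p(2) a(4)]
        equal_further[OF i q(1) b(1) m(1) b(2,3) bm y q(2) b(4)] by simp
    also have "\<dots> = f m i (op i x y)" by (rule nat[OF i m(1) im x y, symmetric])
    finally show ?thesis unfolding X phi_eq_iff[OF l(1) i closed[OF l(1) lu lv] closed[OF i x y]]
      using m im by blast
  qed
  moreover have "\<phi> i (op i x y) \<in> ?S"
  proof -
    have "(i, x) \<in> \<phi> i x" "(i, y) \<in> \<phi> i y" "\<phi> i (op i x y) = \<phi> i (op i (f i i x) (f i i y))"
      unfolding mem_phi using i x y index(2) f_id by auto
    then show ?thesis using i index(2) by blast
  qed
  ultimately have "?S = {\<phi> i (op i x y)}" by blast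
  then show ?thesis by simp
qed

lemma phi_add:
  assumes "i \<in> I" "x \<in> carrier (L i)" "y \<in> carrier (L i)"
  shows "\<phi> i (x \<oplus>\<^bsub>L i\<^esub> y) = \<phi> i x \<oplus>\<^bsub>Lim\<^esub> \<phi> i y"
proof -
  have "x \<oplus>\<^bsub>L l\<^esub> y \<in> carrier (L l)" if "l \<in> I" "x \<in> carrier (L l)" "y \<in> carrier (L l)" for l x y
    using stage(3)[OF that(1)] that(2,3)
    by (simp add: module_def abelian_group_def abelian_monoid.a_closed)
  then show ?thesis
    using limit_operation[of "\<lambda>l. add (L l)", OF _ linear_map_add[OF lie_homD(1)[OF f_hom]] assms]
    by (simp add: direct_limit_def Let_def)
qed

lemma phi_mult:
  assumes "i \<in> I" "x \<in> carrier (L i)" "y \<in> carrier (L i)"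
  shows "\<phi> i (x \<otimes>\<^bsub>L i\<^esub> y) = \<phi> i x \<otimes>\<^bsub>Lim\<^esub> \<phi> i y"
  using limit_operation[of "\<lambda>l. mult (L l)", OF superalgebra_facts(4)[OF stage(1)]
      lie_homD(3)[OF f_hom] assms]
  by (simp add: direct_limit_def Let_def)

lemma phi_smult:
  assumes r: "r \<in> carrier R" and i: "i \<in> I" and x: "x \<in> carrier (L i)"
  shows "\<phi> i (r \<odot>\<^bsub>L i\<^esub> x) = r \<odot>\<^bsub>Lim\<^esub> \<phi> i x"
proof -
  note sc = module.smult_closed[OF stage(3) r]
  have "\<phi> p (r \<odot>\<^bsub>L p\<^esub> u) = \<phi> i (r \<odot>\<^bsub>L i\<^esub> x)" if pu: "(p, u) \<in> \<phi> i x" for p u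
  proof -
    from pu obtain a where p: "p \<in> I" "u \<in> carrier (L p)"
      and a: "a \<in> I" "leq i a" "leq p a" "f a i x = f a p u" unfolding mem_phi by blast
    have "f a p (r \<odot>\<^bsub>L p\<^esub> u) = f a i (r \<odot>\<^bsub>L i\<^esub> x)"
      using linear_map_smult[OF lie_homD(1)[OF f_hom[OF p(1) a(1,3)]] r p(2)]
        linear_map_smult[OF lie_homD(1)[OF f_hom[OF i a(1,2)]] r x] a(4) by simp
    then show ?thesis
      unfolding phi_eq_iff[OF p(1) i sc[OF p] sc[OF i x]] using a by blast
  qed
  moreover have "(i, x) \<in> \<phi> i x" unfolding mem_phi using i x index(2) by blast
  ultimately have "{\<phi> p (r \<odot>\<^bsub>L p\<^esub> u) | p u. (p, u) \<in> \<phi> i x} = {\<phi> i (r \<odot>\<^bsub>L i\<^esub> x)}" by blast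
  then show ?thesis by (simp add: direct_limit_def Let_def)
qed

lemma phi_zero:
  assumes "i \<in> I"
  shows "\<phi> i \<zero>\<^bsub>L i\<^esub> = \<zero>\<^bsub>Lim\<^esub>"
proof -
  have z: "\<zero>\<^bsub>L j\<^esub> \<in> carrier (L j)" if "j \<in> I" for j
    using stage(3)[OF that] by (simp add: module_def abelian_group_def abelian_monoid.zero_closed)
  have "\<phi> j \<zero>\<^bsub>L j\<^esub> = \<phi> i \<zero>\<^bsub>L i\<^esub>" if j: "j \<in> I" for j
  proof -
    obtain l where l: "l \<in> I" "leq i l" "leq j l" using upper_bound[OF assms j] .
    have "f l j \<zero>\<^bsub>L j\<^esub> = f l i \<zero>\<^bsub>L i\<^esub>"
      using linear_map_zero[OF stage(3) stage(3) lie_homD(1)[OF f_hom[OF j l(1,3)]]]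
        linear_map_zero[OF stage(3) stage(3) lie_homD(1)[OF f_hom[OF assms l(1,2)]]] j assms l(1)
      by simp
    then show ?thesis unfolding phi_eq_iff[OF j assms z[OF j] z[OF assms]] using l by blast
  qed
  then have "(\<Union>j \<in> I. \<phi> j \<zero>\<^bsub>L j\<^esub>) = \<phi> i \<zero>\<^bsub>L i\<^esub>" using assms by blast
  then show ?thesis by (simp add: direct_limit_def Let_def)
qed

text \<open>
  The axioms to be checked in the limit involve at most three elements; these are moved to a common
  stage, where the axiom holds.
\<close>

lemma common_stage2:
  assumes "X \<in> carrier Lim" "Y \<in> carrier Lim"
  obtains i x y where "i \<in> I" "x \<in> carrier (L i)" "y \<in> carrier (L i)" "X = \<phi> i x" "Y = \<phi> i y"
proof -
  from assms obtain p u q v where p: "p \<in> I" "u \<in> carrier (L p)" "X = \<phi> p u"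
    and q: "q \<in> I" "v \<in> carrier (L q)" "Y = \<phi> q v" unfolding carrier_Lim by blast
  obtain i where i: "i \<in> I" "leq p i" "leq q i" using upper_bound[OF p(1) q(1)] .
  show thesis
    using that[OF i(1) f_closed[OF p(1) i(1,2) p(2)] f_closed[OF q(1) i(1,3) q(2)]]
      phi_f[OF p(1) i(1,2) p(2)] phi_f[OF q(1) i(1,3) q(2)] p(3) q(3) by simp
qed

lemma common_stage3:
  assumes "X \<in> carrier Lim" "Y \<in> carrier Lim" "Z \<in> carrier Lim"
  obtains i x y z where "i \<in> I" "x \<in> carrier (L i)" "y \<in> carrier (L i)" "z \<in> carrier (L i)"
    "X = \<phi> i x" "Y = \<phi> i y" "Z = \<phi> i z"
proof -
  from common_stage2[OF assms(1,2)] obtain p u v where p: "p \<in> I" "u \<in> carrier (L p)"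
    "v \<in> carrier (L p)" "X = \<phi> p u" "Y = \<phi> p v" .
  from assms(3) obtain q w where q: "q \<in> I" "w \<in> carrier (L q)" "Z = \<phi> q w"
    unfolding carrier_Lim by blast
  obtain i where i: "i \<in> I" "leq p i" "leq q i" using upper_bound[OF p(1) q(1)] .
  note pf = phi_f[OF p(1) i(1,2) p(2), symmetric] phi_f[OF p(1) i(1,2) p(3), symmetric]
    phi_f[OF q(1) i(1,3) q(2), symmetric]
  show thesis
    by (rule that[OF i(1) f_closed[OF p(1) i(1,2) p(2)] f_closed[OF p(1) i(1,2) p(3)]
          f_closed[OF q(1) i(1,3) q(2)]])
      (simp_all only: p(4,5) q(3) pf)
qed

lemma common_stage_homog:
  assumes "X \<in> homog Lim a" "Y \<in> homog Lim b" "Z \<in> homog Lim c"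
  obtains i x y z where "i \<in> I" "x \<in> homog (L i) a" "y \<in> homog (L i) b" "z \<in> homog (L i) c"
    "X = \<phi> i x" "Y = \<phi> i y" "Z = \<phi> i z"
proof -
  from assms obtain p u q v r w where p: "p \<in> I" "u \<in> homog (L p) a" "X = \<phi> p u"
    and q: "q \<in> I" "v \<in> homog (L q) b" "Y = \<phi> q v"
    and r: "r \<in> I" "w \<in> homog (L r) c" "Z = \<phi> r w" unfolding homog_Lim by blast
  obtain l where l: "l \<in> I" "leq p l" "leq q l" using upper_bound[OF p(1) q(1)] .
  obtain i where i: "i \<in> I" "leq l i" "leq r i" using upper_bound[OF l(1) r(1)] .
  have pq: "leq p i" "leq q i"
    using index(3)[OF p(1) l(1) i(1) l(2) i(2)] index(3)[OF q(1) l(1) i(1) l(3) i(2)] .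
  note c = supermodule_facts(3)[OF stage(2)]
  note pf = phi_f[OF p(1) i(1) pq(1) c[OF p(1,2)], symmetric]
    phi_f[OF q(1) i(1) pq(2) c[OF q(1,2)], symmetric]
    phi_f[OF r(1) i(1,3) c[OF r(1,2)], symmetric]
  show thesis
    by (rule that[OF i(1) lie_homD(4)[OF f_hom[OF p(1) i(1) pq(1)] p(2)]
          lie_homD(4)[OF f_hom[OF q(1) i(1) pq(2)] q(2)]
          lie_homD(4)[OF f_hom[OF r(1) i(1,3)] r(2)]])
      (simp_all only: p(3) q(3) r(3) pf)
qed

lemma Lim_module: "module R Lim"
proof -
  obtain o' where o: "o' \<in> I" using index(1) by blast
  have cring: "cring R" using stage(3)[OF o] by (simp add: module_def)
  note am = module.axioms(2)[OF stage(3)]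
  note ac = abelian_monoid.a_closed[OF abelian_group.axioms(1)[OF am]]
  note zc = abelian_monoid.zero_closed[OF abelian_group.axioms(1)[OF am]]
  note ic = abelian_group.a_inv_closed[OF am]
  note sc = module.smult_closed[OF stage(3)]
  show ?thesis
  proof (rule moduleI[OF cring])
    show "abelian_group Lim"
    proof (rule abelian_groupI)
      show "X \<oplus>\<^bsub>Lim\<^esub> Y \<in> carrier Lim" if "X \<in> carrier Lim" "Y \<in> carrier Lim" for X Y
      proof -
        from that obtain i x y where i: "i \<in> I" "x \<in> carrier (L i)" "y \<in> carrier (L i)"
          "X = \<phi> i x" "Y = \<phi> i y" by (rule common_stage2)
        then show ?thesis by (simp add: phi_add[symmetric] phi_closed ac)
      qed
      show "\<zero>\<^bsub>Lim\<^esub> \<in> carrier Lim" unfolding phi_zero[OF o, symmetric] by (rule phi_closed[OF o zc[OF o]])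
      show "(X \<oplus>\<^bsub>Lim\<^esub> Y) \<oplus>\<^bsub>Lim\<^esub> Z = X \<oplus>\<^bsub>Lim\<^esub> (Y \<oplus>\<^bsub>Lim\<^esub> Z)"
        if "X \<in> carrier Lim" "Y \<in> carrier Lim" "Z \<in> carrier Lim" for X Y Z
      proof -
        from that obtain i x y z where "i \<in> I" "x \<in> carrier (L i)" "y \<in> carrier (L i)"
          "z \<in> carrier (L i)" "X = \<phi> i x" "Y = \<phi> i y" "Z = \<phi> i z" by (rule common_stage3)
        then show ?thesis
          by (simp add: phi_add[symmetric] ac abelian_monoid.a_assoc[OF abelian_group.axioms(1)[OF am]])
      qed
      show "X \<oplus>\<^bsub>Lim\<^esub> Y = Y \<oplus>\<^bsub>Lim\<^esub> X" if "X \<in> carrier Lim" "Y \<in> carrier Lim" for X Y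
      proof -
        from that obtain i x y where i: "i \<in> I" "x \<in> carrier (L i)" "y \<in> carrier (L i)"
          "X = \<phi> i x" "Y = \<phi> i y" by (rule common_stage2)
        then show ?thesis
          using abelian_monoid.a_comm[OF abelian_group.axioms(1)[OF am[OF i(1)]] i(2,3)]
          by (simp add: phi_add[symmetric])
      qed
      show "\<zero>\<^bsub>Lim\<^esub> \<oplus>\<^bsub>Lim\<^esub> X = X" if "X \<in> carrier Lim" for X
      proof -
        from that obtain i x where i: "i \<in> I" "x \<in> carrier (L i)" "X = \<phi> i x"
          unfolding carrier_Lim by blast
        then show ?thesis
          using phi_add[OF i(1) zc[OF i(1)] i(2)]
          by (simp add: phi_zero abelian_monoid.l_zero[OF abelian_group.axioms(1)[OF am]])
      qed
      show "\<exists>Y \<in> carrier Lim. Y \<oplus>\<^bsub>Lim\<^esub> X = \<zero>\<^bsub>Lim\<^esub>" if "X \<in> carrier Lim" for X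
      proof -
        from that obtain i x where i: "i \<in> I" "x \<in> carrier (L i)" "X = \<phi> i x"
          unfolding carrier_Lim by blast
        have "\<phi> i (\<ominus>\<^bsub>L i\<^esub> x) \<oplus>\<^bsub>Lim\<^esub> X = \<zero>\<^bsub>Lim\<^esub>"
          using phi_add[OF i(1) ic[OF i(1,2)] i(2)] abelian_group.l_neg[OF am[OF i(1)] i(2)]
            phi_zero[OF i(1)] i(3) by simp
        then show ?thesis using phi_closed[OF i(1) ic[OF i(1,2)]] by blast
      qed
    qed
    fix r s X Y
    assume r: "r \<in> carrier R" "s \<in> carrier R" and X: "X \<in> carrier Lim" and Y: "Y \<in> carrier Lim"
    from X Y obtain i x y where i: "i \<in> I" "x \<in> carrier (L i)" "y \<in> carrier (L i)"
      "X = \<phi> i x" "Y = \<phi> i y" by (rule common_stage2)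
    interpret S: module R "L i" by (rule stage(3)[OF i(1)])
    note s = phi_smult[OF _ i(1), symmetric] phi_add[OF i(1), symmetric]
    show "(r \<oplus>\<^bsub>R\<^esub> s) \<odot>\<^bsub>Lim\<^esub> X = r \<odot>\<^bsub>Lim\<^esub> X \<oplus>\<^bsub>Lim\<^esub> s \<odot>\<^bsub>Lim\<^esub> X"
      using r i(2,3) unfolding i(4,5) by (simp add: s S.smult_l_distr)
    show "r \<odot>\<^bsub>Lim\<^esub> (X \<oplus>\<^bsub>Lim\<^esub> Y) = r \<odot>\<^bsub>Lim\<^esub> X \<oplus>\<^bsub>Lim\<^esub> r \<odot>\<^bsub>Lim\<^esub> Y"
      using r i(2,3) unfolding i(4,5) by (simp add: s S.smult_r_distr)
    show "(r \<otimes>\<^bsub>R\<^esub> s) \<odot>\<^bsub>Lim\<^esub> X = r \<odot>\<^bsub>Lim\<^esub> (s \<odot>\<^bsub>Lim\<^esub> X)"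
      using r i(2,3) unfolding i(4,5) by (simp add: s S.smult_assoc1)
  next
    fix X assume "X \<in> carrier Lim"
    then obtain i x where i: "i \<in> I" "x \<in> carrier (L i)" "X = \<phi> i x"
      unfolding carrier_Lim by blast
    show "\<one>\<^bsub>R\<^esub> \<odot>\<^bsub>Lim\<^esub> X = X"
      unfolding i(3) phi_smult[OF monoid.one_closed[OF ring.is_monoid[OF cring.axioms(1)[OF cring]]] i(1,2), symmetric]
        module.smult_one[OF stage(3)[OF i(1)] i(2)] ..
    fix r assume r: "r \<in> carrier R"
    show "r \<odot>\<^bsub>Lim\<^esub> X \<in> carrier Lim"
      unfolding i(3) phi_smult[OF r i(1,2), symmetric] by (rule phi_closed[OF i(1) sc[OF i(1) r i(2)]])
  qed
qed

lemma phi_linear: "i \<in> I \<Longrightarrow> linear_map R (L i) Lim (\<phi> i)"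
  unfolding linear_map_def using phi_closed phi_add phi_smult by blast

lemma Lim_supermodule: "supermodule R Lim"
proof (rule supermoduleI[OF Lim_module])
  obtain o' where o: "o' \<in> I" using index(1) by blast
  note c = supermodule_facts(3)[OF stage(2)]
  note h = submodule_closed[OF stage(3) supermodule_facts(2)[OF stage(2)]]
  show "submodule (homog Lim d) R Lim" for d
  proof (rule submoduleI_no_minus[OF Lim_module])
    show "homog Lim d \<subseteq> carrier Lim" unfolding homog_Lim carrier_Lim using c by blast
    show "\<zero>\<^bsub>Lim\<^esub> \<in> homog Lim d"
      unfolding phi_zero[OF o, symmetric] by (rule phi_homog[OF o h(2)[OF o o]])
    show "X \<oplus>\<^bsub>Lim\<^esub> Y \<in> homog Lim d" if "X \<in> homog Lim d" "Y \<in> homog Lim d" for X Y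
    proof -
      from common_stage_homog[OF that that(1)] obtain i x y where i: "i \<in> I" "x \<in> homog (L i) d"
        "y \<in> homog (L i) d" "X = \<phi> i x" "Y = \<phi> i y" .
      show ?thesis
        unfolding i(4,5) phi_add[OF i(1) c[OF i(1,2)] c[OF i(1,3)], symmetric]
        by (rule phi_homog[OF i(1) h(3)[OF i(1,1,2,3)]])
    qed
    show "r \<odot>\<^bsub>Lim\<^esub> X \<in> homog Lim d" if r: "r \<in> carrier R" and "X \<in> homog Lim d" for r X
    proof -
      from that(2) obtain i x where i: "i \<in> I" "x \<in> homog (L i) d" "X = \<phi> i x"
        unfolding homog_Lim by blast
      show ?thesis
        unfolding i(3) phi_smult[OF r i(1) c[OF i(1,2)], symmetric]
        by (rule phi_homog[OF i(1) h(4)[OF i(1,1) r i(2)]])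
    qed
  qed
  show "\<exists>Y \<in> homog Lim 0. \<exists>Z \<in> homog Lim 1. X = Y \<oplus>\<^bsub>Lim\<^esub> Z" if "X \<in> carrier Lim" for X
  proof -
    from that obtain i x where i: "i \<in> I" "x \<in> carrier (L i)" "X = \<phi> i x"
      unfolding carrier_Lim by blast
    obtain y z where yz: "y \<in> homog (L i) 0" "z \<in> homog (L i) 1" "x = y \<oplus>\<^bsub>L i\<^esub> z"
      using supermodule_facts(4)[OF stage(2)[OF i(1)] i(2)] by blast
    then have "X = \<phi> i y \<oplus>\<^bsub>Lim\<^esub> \<phi> i z" using phi_add[OF i(1) c[OF i(1)] c[OF i(1)]] i(3) by simp
    then show ?thesis using phi_homog[OF i(1)] yz(1,2) by blast
  qed
  \<comment> \<open>An even and an odd representative become equal at some stage, where both must be zero.\<close>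
  show "X = \<zero>\<^bsub>Lim\<^esub>" if X: "X \<in> homog Lim 0" "X \<in> homog Lim 1" for X
  proof -
    from common_stage_homog[OF X X(1)] obtain i x y where i: "i \<in> I" "x \<in> homog (L i) 0"
      "y \<in> homog (L i) 1" "X = \<phi> i x" "X = \<phi> i y" .
    then obtain l where l: "l \<in> I" "leq i l" "f l i x = f l i y"
      using phi_eq_iff[OF i(1,1) c[OF i(1,2)] c[OF i(1,3)]] by metis
    have "f l i x = \<zero>\<^bsub>L l\<^esub>"
      using supermodule_facts(5)[OF stage(2)[OF l(1)]] lie_homD(4)[OF f_hom[OF i(1) l(1,2)] i(2)]
        lie_homD(4)[OF f_hom[OF i(1) l(1,2)] i(3)] l(3) by simp
    then show ?thesis using phi_f[OF i(1) l(1,2) c[OF i(1,2)]] phi_zero[OF l(1)] i(4) by simp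
  qed
qed

text \<open>
  Each cocycle identity involves at most three elements, hence can be checked at one stage.  Applied
  to the bracket this gives the Lie identities of the limit, applied to \<open>\<tau>\<^sub>I\<close> it gives the cocycle
  by which the limit is extended.
\<close>

lemma limit_two_cocycle:
  assumes "\<And>i. i \<in> I \<Longrightarrow> two_cocycle R (L i) C (\<tau> i)"
    "\<And>i x y. i \<in> I \<Longrightarrow> x \<in> carrier (L i) \<Longrightarrow> y \<in> carrier (L i) \<Longrightarrow> \<sigma> (\<phi> i x) (\<phi> i y) = \<tau> i x y"
  shows "two_cocycle R Lim C \<sigma>"
proof -
  note c = supermodule_facts(3)[OF stage(2)]
  note s = assms(2)
  note T = two_cocycleD[OF assms(1)]
  note mc = superalgebra_facts(4)[OF stage(1)]
  note ac = abelian_monoid.a_closed[OF abelian_group.axioms(1)[OF module.axioms(2)[OF stage(3)]]]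
  note sc = module.smult_closed[OF stage(3)]
  show ?thesis
  proof (rule two_cocycleI)
    have closed: "\<sigma> X Y \<in> carrier C" if "X \<in> carrier Lim" "Y \<in> carrier Lim" for X Y
    proof -
      from that obtain i x y where "i \<in> I" "x \<in> carrier (L i)" "y \<in> carrier (L i)"
        "X = \<phi> i x" "Y = \<phi> i y" by (rule common_stage2)
      then show ?thesis by (simp add: s T(3))
    qed
    have "\<sigma> (X \<oplus>\<^bsub>Lim\<^esub> Y) Z = \<sigma> X Z \<oplus>\<^bsub>C\<^esub> \<sigma> Y Z \<and> \<sigma> Z (X \<oplus>\<^bsub>Lim\<^esub> Y) = \<sigma> Z X \<oplus>\<^bsub>C\<^esub> \<sigma> Z Y"
      if "X \<in> carrier Lim" "Y \<in> carrier Lim" "Z \<in> carrier Lim" for X Y Z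
    proof -
      from that obtain i x y z where "i \<in> I" "x \<in> carrier (L i)" "y \<in> carrier (L i)"
        "z \<in> carrier (L i)" "X = \<phi> i x" "Y = \<phi> i y" "Z = \<phi> i z" by (rule common_stage3)
      then show ?thesis
        by (simp add: s ac phi_add[symmetric] linear_map_add[OF bilinear_map_linear(1)[OF T(1)]]
          linear_map_add[OF bilinear_map_linear(2)[OF T(1)]])
    qed
    moreover have "\<sigma> (r \<odot>\<^bsub>Lim\<^esub> X) Y = r \<odot>\<^bsub>C\<^esub> \<sigma> X Y \<and> \<sigma> X (r \<odot>\<^bsub>Lim\<^esub> Y) = r \<odot>\<^bsub>C\<^esub> \<sigma> X Y"
      if "r \<in> carrier R" "X \<in> carrier Lim" "Y \<in> carrier Lim" for r X Y
    proof -
      note r = that(1)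
      from that(2,3) obtain i x y where "i \<in> I" "x \<in> carrier (L i)" "y \<in> carrier (L i)"
        "X = \<phi> i x" "Y = \<phi> i y" by (rule common_stage2)
      then show ?thesis using r
        by (simp add: s sc phi_smult[symmetric] linear_map_smult[OF bilinear_map_linear(1)[OF T(1)]]
          linear_map_smult[OF bilinear_map_linear(2)[OF T(1)]])
    qed
    ultimately show "bilinear_map R Lim Lim C \<sigma>"
      using closed unfolding bilinear_map_def by blast
  next
    fix a b X Y assume "X \<in> homog Lim a" "Y \<in> homog Lim b"
    from common_stage_homog[OF this this(1)] obtain i x y where i: "i \<in> I" "x \<in> homog (L i) a"
      "y \<in> homog (L i) b" "X = \<phi> i x" "Y = \<phi> i y" .
    note i' = s[OF i(1) c[OF i(1,2)] c[OF i(1,3)]] s[OF i(1) c[OF i(1,3)] c[OF i(1,2)]]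
    show "\<sigma> X Y \<in> homog C (a + b)" unfolding i(4,5) i' by (rule T(4)[OF i(1-3)])
    show "\<sigma> X Y \<oplus>\<^bsub>C\<^esub> ksign C (a * b) (\<sigma> Y X) = \<zero>\<^bsub>C\<^esub>"
      unfolding i(4,5) i' by (rule T(5)[OF i(1-3)])
  next
    fix X assume "X \<in> homog Lim 0"
    then obtain i x where i: "i \<in> I" "x \<in> homog (L i) 0" "X = \<phi> i x" unfolding homog_Lim by blast
    show "\<sigma> X X = \<zero>\<^bsub>C\<^esub>"
      unfolding i(3) s[OF i(1) c[OF i(1,2)] c[OF i(1,2)]] by (rule T(6)[OF i(1,2)])
  next
    fix a b d X Y Z assume "X \<in> homog Lim a" "Y \<in> homog Lim b" "Z \<in> homog Lim d"
    from common_stage_homog[OF this] obtain i x y z where i: "i \<in> I" "x \<in> homog (L i) a"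
      "y \<in> homog (L i) b" "z \<in> homog (L i) d" "X = \<phi> i x" "Y = \<phi> i y" "Z = \<phi> i z" .
    note c' = c[OF i(1,2)] c[OF i(1,3)] c[OF i(1,4)]
    show "ksign C (a * d) (\<sigma> X (Y \<otimes>\<^bsub>Lim\<^esub> Z)) \<oplus>\<^bsub>C\<^esub> ksign C (b * a) (\<sigma> Y (Z \<otimes>\<^bsub>Lim\<^esub> X))
        \<oplus>\<^bsub>C\<^esub> ksign C (d * b) (\<sigma> Z (X \<otimes>\<^bsub>Lim\<^esub> Y)) = \<zero>\<^bsub>C\<^esub>"
      unfolding i(5-7) using T(7)[OF i(1-4)] c'
      by (simp add: phi_mult[OF i(1), symmetric] s[OF i(1)] mc[OF i(1)])
  qed
qed

lemma Lim_lie: "lie_superalgebra R Lim"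
proof -
  have "two_cocycle R (L i) Lim (\<lambda>x y. \<phi> i (x \<otimes>\<^bsub>L i\<^esub> y))" if "i \<in> I" for i
    by (rule two_cocycle_postcomp[OF stage(2)[OF that] stage(1)[OF that] stage(3)[OF that] Lim_module
          phi_linear[OF that] phi_homog[OF that] stage(4)[OF that]])
  then have "two_cocycle R Lim Lim (mult Lim)"
    by (rule limit_two_cocycle) (simp_all add: phi_mult)
  then show ?thesis using Lim_supermodule by (simp add: lie_superalgebra_iff)
qed

lemma phi_hom: "i \<in> I \<Longrightarrow> \<phi> i \<in> lie_hom R (L i) Lim"
  by (rule lie_homI[OF phi_linear phi_mult phi_homog])

text \<open>
  An element of the quotient is a finite sum of symbols, and finitely many elements of the limit
  have representatives at one stage.
\<close>

lemma cyclic_quotient_stage: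
  assumes "U \<in> carrier (cyclic_quotient R Lim)"
  shows "\<exists>i \<in> I. \<exists>V \<in> carrier (cyclic_quotient R (L i)). U = cyclic_map R Lim (\<phi> i) V"
  using lie_superalgebra_superalgebra[OF Lim_lie] assms
proof (induction rule: cyclic_quotient_induct)
  case (symb X Y)
  from common_stage2[OF symb] obtain i x y where i: "i \<in> I" "x \<in> carrier (L i)"
    "y \<in> carrier (L i)" "X = \<phi> i x" "Y = \<phi> i y" .
  have "symb R Lim X Y = cyclic_map R Lim (\<phi> i) (symb R (L i) x y)"
    using cyclic_map_symb[OF stage(1)[OF i(1)] lie_superalgebra_superalgebra[OF Lim_lie] phi_hom[OF i(1)] i(2,3)]
      i(4,5) by simp
  then show ?case using i(1) two_cocycleD(3)[OF symb_two_cocycle[OF stage(1)[OF i(1)]] i(2,3)] by blast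
next
  case (add U V)
  note sL = lie_superalgebra_superalgebra[OF Lim_lie]
  from add obtain p U' q V' where p: "p \<in> I" "U' \<in> carrier (cyclic_quotient R (L p))"
      "U = cyclic_map R Lim (\<phi> p) U'"
    and q: "q \<in> I" "V' \<in> carrier (cyclic_quotient R (L q))" "V = cyclic_map R Lim (\<phi> q) V'" by blast
  obtain i where i: "i \<in> I" "leq p i" "leq q i" using upper_bound[OF p(1) q(1)] .
  let ?m = "cyclic_map R Lim (\<phi> i)"
  let ?U = "cyclic_map R (L i) (f i p) U'" and ?V = "cyclic_map R (L i) (f i q) V'"
  note fp = f_hom[OF p(1) i(1,2)] and fq = f_hom[OF q(1) i(1,3)]
  have c: "?U \<in> carrier (cyclic_quotient R (L i))" "?V \<in> carrier (cyclic_quotient R (L i))"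
    by (rule linear_map_closed[OF cyclic_map_linear[OF stage(1)[OF p(1)] stage(1)[OF i(1)] fp] p(2)])
      (rule linear_map_closed[OF cyclic_map_linear[OF stage(1)[OF q(1)] stage(1)[OF i(1)] fq] q(2)])
  have "U = ?m ?U"
    unfolding p(3)
    by (rule cyclic_map_comp[OF stage(1)[OF p(1)] stage(1)[OF i(1)] sL fp phi_hom[OF i(1)]
          phi_hom[OF p(1)] phi_f[OF p(1) i(1,2), symmetric] p(2)])
  moreover have "V = ?m ?V"
    unfolding q(3)
    by (rule cyclic_map_comp[OF stage(1)[OF q(1)] stage(1)[OF i(1)] sL fq phi_hom[OF i(1)]
          phi_hom[OF q(1)] phi_f[OF q(1) i(1,3), symmetric] q(2)])
  ultimately have "U \<oplus>\<^bsub>cyclic_quotient R Lim\<^esub> V = ?m (?U \<oplus>\<^bsub>cyclic_quotient R (L i)\<^esub> ?V)"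
    using linear_map_add[OF cyclic_map_linear[OF stage(1)[OF i(1)] sL phi_hom[OF i(1)]] c] by simp
  moreover have "?U \<oplus>\<^bsub>cyclic_quotient R (L i)\<^esub> ?V \<in> carrier (cyclic_quotient R (L i))"
    by (rule abelian_monoid.a_closed[OF abelian_group.axioms(1)[OF
          module.axioms(2)[OF cyclic_quotient_module[OF stage(1)[OF i(1)]]]] c])
  ultimately show ?case using i(1) by blast
qed

text \<open>
  Surjectivity comes from the stages at once, by naturality for \<open>\<phi> i\<close>.  For injectivity, an element of
  the kernel is represented at some stage \<open>i\<close>, and one has to pass to a later stage \<open>j\<close>, since \<open>\<phi> i\<close>
  need not be injective.
\<close>

theorem limit_comparison_bij:
  assumes C: "supermodule R C"
    and tau: "\<And>i. i \<in> I \<Longrightarrow> two_cocycle R (L i) C (\<tau> i)"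
    and sigma: "\<And>i x y. i \<in> I \<Longrightarrow> x \<in> carrier (L i) \<Longrightarrow> y \<in> carrier (L i) \<Longrightarrow>
      \<sigma> (\<phi> i x) (\<phi> i y) = \<tau> i x y"
    and transition: "\<And>i j x y. i \<in> I \<Longrightarrow> j \<in> I \<Longrightarrow> leq i j \<Longrightarrow> x \<in> carrier (L i) \<Longrightarrow>
      y \<in> carrier (L i) \<Longrightarrow> \<tau> j (f j i x) (f j i y) = \<tau> i x y"
    and bij: "\<And>i. i \<in> I \<Longrightarrow>
      bij_betw (uce_to_extension R (L i) C (\<tau> i))
        (carrier (cyclic_quotient R (L i))) (carrier (cocycle_extension (L i) C (\<tau> i)))"
  shows "bij_betw (uce_to_extension R Lim C \<sigma>)
      (carrier (cyclic_quotient R Lim)) (carrier (cocycle_extension Lim C \<sigma>))"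
proof -
  define h where "h i = uce_to_extension R (L i) C (\<tau> i)" for i
  let ?Q = "\<lambda>i. cyclic_quotient R (L i)" and ?E = "\<lambda>i. cocycle_extension (L i) C (\<tau> i)"
  let ?QL = "cyclic_quotient R Lim" and ?EL = "cocycle_extension Lim C \<sigma>"
  let ?H = "uce_to_extension R Lim C \<sigma>"
  note sL = lie_superalgebra_superalgebra[OF Lim_lie]
  have sig: "two_cocycle R Lim C \<sigma>" by (rule limit_two_cocycle[OF tau sigma])
  note H = uce_to_extension_linear[OF Lim_lie C sig]
  have h: "linear_map R (?Q i) (?E i) (h i)" if "i \<in> I" for i
    unfolding h_def by (rule uce_to_extension_linear[OF lie[OF that] C tau[OF that]])
  note QL = cyclic_quotient_module[OF sL]
  have EL: "module R ?EL"
    by (rule cocycle_extension_module[OF Lim_module supermodule_facts(1)[OF C]])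
  have natural_H: "?H (cyclic_map R Lim (\<phi> i) V) = map_prod (\<phi> i) id (h i V)"
    if "i \<in> I" "V \<in> carrier (?Q i)" for i V
    unfolding h_def
    by (rule uce_to_extension_natural[OF lie[OF that(1)] Lim_lie C tau[OF that(1)] sig
          phi_hom[OF that(1)] sigma[OF that(1)] that(2)])
  have natural_h: "h j (cyclic_map R (L j) (f j i) V) = map_prod (f j i) id (h i V)"
    if "i \<in> I" "j \<in> I" "leq i j" "V \<in> carrier (?Q i)" for i j V
    unfolding h_def
    by (rule uce_to_extension_natural[OF lie[OF that(1)] lie[OF that(2)] C tau[OF that(1)]
          tau[OF that(2)] f_hom[OF that(1-3)] transition[OF that(1-3)] that(4)])
  have kernel: "U = \<zero>\<^bsub>?QL\<^esub>" if U: "U \<in> carrier ?QL" "?H U = \<zero>\<^bsub>?EL\<^esub>" for U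
  proof -
    from cyclic_quotient_stage[OF U(1)] obtain i V where i: "i \<in> I" "V \<in> carrier (?Q i)"
      "U = cyclic_map R Lim (\<phi> i) V" by blast
    have hV: "fst (h i V) \<in> carrier (L i)" using linear_map_closed[OF h[OF i(1)] i(2)] by auto
    have "map_prod (\<phi> i) id (h i V) = (\<zero>\<^bsub>Lim\<^esub>, \<zero>\<^bsub>C\<^esub>)"
      using U(2) natural_H[OF i(1,2)] i(3) by simp
    then have z: "\<phi> i (fst (h i V)) = \<phi> i \<zero>\<^bsub>L i\<^esub>" "snd (h i V) = \<zero>\<^bsub>C\<^esub>"
      unfolding phi_zero[OF i(1)] by (simp_all add: prod_eq_iff)
    have zc: "\<zero>\<^bsub>L i\<^esub> \<in> carrier (L i)"
      using submodule_closed(2)[OF stage(3)[OF i(1)] module.carrier_is_submodule[OF stage(3)[OF i(1)]]] .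
    \<comment> \<open>The \<open>L\<close>-component of \<open>h i V\<close> vanishes in the limit, hence already at some stage \<open>j\<close>.\<close>
    from z(1) obtain j where j: "j \<in> I" "leq i j" "f j i (fst (h i V)) = f j i \<zero>\<^bsub>L i\<^esub>"
      using phi_eq_iff[OF i(1,1) hV zc] by blast
    note fj = f_hom[OF i(1) j(1,2)]
    let ?W = "cyclic_map R (L j) (f j i) V"
    note Wlin = cyclic_map_linear[OF stage(1)[OF i(1)] stage(1)[OF j(1)] fj]
    have W: "?W \<in> carrier (?Q j)" by (rule linear_map_closed[OF Wlin i(2)])
    note Qj = cyclic_quotient_module[OF stage(1)[OF j(1)]]
    have zQ: "\<zero>\<^bsub>?Q j\<^esub> \<in> carrier (?Q j)"
      using submodule_closed(2)[OF Qj module.carrier_is_submodule[OF Qj]] .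
    have "h j ?W = (\<zero>\<^bsub>L j\<^esub>, \<zero>\<^bsub>C\<^esub>)"
      using natural_h[OF i(1) j(1,2) i(2)] j(3) z(2)
        linear_map_zero[OF stage(3)[OF i(1)] stage(3)[OF j(1)] lie_homD(1)[OF fj]]
      by (simp add: prod_eq_iff)
    also have "\<dots> = h j \<zero>\<^bsub>?Q j\<^esub>"
      using linear_map_zero[OF Qj cocycle_extension_module[OF stage(3)[OF j(1)] supermodule_facts(1)[OF C]] h[OF j(1)]]
      by simp
    finally have "?W = \<zero>\<^bsub>?Q j\<^esub>"
      using inj_onD[OF bij_betw_imp_inj_on[OF bij[OF j(1), folded h_def]] _ W zQ] by blast
    moreover have "U = cyclic_map R Lim (\<phi> j) ?W"
      unfolding i(3)
      by (rule cyclic_map_comp[OF stage(1)[OF i(1)] stage(1)[OF j(1)] sL fj phi_hom[OF j(1)]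
            phi_hom[OF i(1)] phi_f[OF i(1) j(1,2), symmetric] i(2)])
    ultimately show ?thesis
      using linear_map_zero[OF Qj QL cyclic_map_linear[OF stage(1)[OF j(1)] sL phi_hom[OF j(1)]]] by simp
  qed
  have inj: "inj_on ?H (carrier ?QL)"
  proof (rule inj_onI)
    fix U V assume UV: "U \<in> carrier ?QL" "V \<in> carrier ?QL" "?H U = ?H V"
    have QLg: "abelian_group ?QL" and ELg: "abelian_group ?EL"
      using module.axioms(2)[OF QL] module.axioms(2)[OF EL] .
    note iV = abelian_group.a_inv_closed[OF QLg UV(2)]
    have "?H (U \<oplus>\<^bsub>?QL\<^esub> \<ominus>\<^bsub>?QL\<^esub> V) = \<zero>\<^bsub>?EL\<^esub>"
      unfolding linear_map_add[OF H UV(1) iV] linear_map_minus[OF QL EL H UV(2)] UV(3)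
      by (rule abelian_group.r_neg[OF ELg linear_map_closed[OF H UV(2)]])
    then have "U \<oplus>\<^bsub>?QL\<^esub> \<ominus>\<^bsub>?QL\<^esub> V = \<zero>\<^bsub>?QL\<^esub>"
      by (rule kernel[OF abelian_monoid.a_closed[OF abelian_group.axioms(1)[OF QLg] UV(1) iV]])
    then show "U = V"
      using abelian_group.minus_equality[OF QLg _ iV UV(1)] abelian_group.minus_minus[OF QLg UV(2)] by simp
  qed
  have "carrier ?EL \<subseteq> ?H ` carrier ?QL"
  proof
    fix e assume "e \<in> carrier ?EL"
    then obtain i x c where i: "i \<in> I" "x \<in> carrier (L i)" "c \<in> carrier C" "e = (\<phi> i x, c)"
      unfolding cocycle_extension_simps(1) carrier_Lim by blast
    have "(x, c) \<in> h i ` carrier (?Q i)"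
      using bij_betw_imp_surj_on[OF bij[OF i(1), folded h_def]] i(2,3) by simp
    then obtain V where V: "V \<in> carrier (?Q i)" "(x, c) = h i V" by blast
    have "e = ?H (cyclic_map R Lim (\<phi> i) V)"
      unfolding natural_H[OF i(1) V(1)] V(2)[symmetric] i(4) by simp
    then show "e \<in> ?H ` carrier ?QL"
      using linear_map_closed[OF cyclic_map_linear[OF stage(1)[OF i(1)] sL phi_hom[OF i(1)]] V(1)]
      by blast
  qed
  moreover have "?H ` carrier ?QL \<subseteq> carrier ?EL" using linear_map_closed[OF H] by (rule image_subsetI)
  ultimately show ?thesis using inj unfolding bij_betw_def by blast
qed

end

section \<open>The direct limit of the special linear Lie superalgebras\<close>

theorem corollary2p4:
  fixes k :: "('k, 'r) ring_scheme"
    and A :: "('k, 'a, 'x) supermodule_scheme"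
    and I :: "'i set" and leq :: "'i \<Rightarrow> 'i \<Rightarrow> bool"
    and m n :: "'i \<Rightarrow> nat"
    and f :: "'i \<Rightarrow> 'i \<Rightarrow> (nat \<Rightarrow> nat \<Rightarrow> 'a) \<Rightarrow> (nat \<Rightarrow> nat \<Rightarrow> 'a)"
    and tau_I :: "('i \<times> (nat \<Rightarrow> nat \<Rightarrow> 'a)) set \<Rightarrow> ('i \<times> (nat \<Rightarrow> nat \<Rightarrow> 'a)) set
      \<Rightarrow> ('a \<times> 'a \<Rightarrow> 'k) set set"
  assumes "cring k"
    and "comm_superalgebra k A"
    and "directed_set I leq"
    and "lie_directed_system k I leq (\<lambda>i. sl k (m i) (n i) A) f"
    and "\<And>i. i \<in> I \<Longrightarrow> m i + n i \<ge> 5"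
    and "\<And>i. i \<in> I \<Longrightarrow> \<exists>h.
      central_extension_iso k (sl k (m i) (n i) A)
        (uce k (sl k (m i) (n i) A)) (uce_map k (sl k (m i) (n i) A))
        (cocycle_extension (sl k (m i) (n i) A) (HC1 k A) (tau k (m i) (n i) A)) fst h \<and>
      (\<forall>x \<in> carrier (sl k (m i) (n i) A). \<forall>y \<in> carrier (sl k (m i) (n i) A).
         h (symb k (sl k (m i) (n i) A) x y)
         = (x \<otimes>\<^bsub>sl k (m i) (n i) A\<^esub> y, tau k (m i) (n i) A x y))"
    and "is_tau_lim k A I leq m n f tau_I"
  shows "lie_superalgebra k (sl_lim k A I leq m n f)
    \<and> perfect k (sl_lim k A I leq m n f)
    \<and> two_cocycle k (sl_lim k A I leq m n f) (HC1 k A) tau_I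
    \<and> (\<exists>h. central_extension_iso k (sl_lim k A I leq m n f)
          (uce k (sl_lim k A I leq m n f)) (uce_map k (sl_lim k A I leq m n f))
          (cocycle_extension (sl_lim k A I leq m n f) (HC1 k A) tau_I) fst h)"
proof -
  define L where "L i = sl k (m i) (n i) A" for i
  define C where "C = HC1 k A"
  define \<tau> where "\<tau> i = tau k (m i) (n i) A" for i
  interpret lie_directed_limit k I leq L f
    using assms(3,4) by unfold_locales (simp_all add: L_def[abs_def])
  have lim: "sl_lim k A I leq m n f = Lim" by (simp add: sl_lim_def L_def[abs_def])
  have inj: "sl_inj k A I leq m n f = \<phi>" by (simp add: fun_eq_iff sl_inj_def L_def[abs_def])
  have ex: "\<exists>h. central_extension_iso k (L i) (uce k (L i)) (uce_map k (L i))
      (cocycle_extension (L i) C (\<tau> i)) fst h \<and>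
      (\<forall>x \<in> carrier (L i). \<forall>y \<in> carrier (L i). h (symb k (L i) x y) = (x \<otimes>\<^bsub>L i\<^esub> y, \<tau> i x y))"
    if "i \<in> I" for i
    using assms(6)[OF that] unfolding L_def C_def \<tau>_def .
  have ext: "lie_superalgebra k (cocycle_extension (L i) C (\<tau> i))" if "i \<in> I" for i
    using ex[OF that] unfolding central_extension_iso_def central_extension_def by blast
  \<comment> \<open>The properties of \<open>HC\<^sub>1\<close> and of the cocycles \<open>\<tau> i\<close> are contained in the assumption that the right-hand
      sides at the stages are Lie superalgebras.\<close>
  have C: "supermodule k C"
    using index(1) cocycle_extension_coefficients[OF lie ext] by blast
  have tau: "two_cocycle k (L i) C (\<tau> i)" if "i \<in> I" for i
    by (rule cocycle_extension_cocycle[OF lie[OF that] ext[OF that]])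
  have tau_I: "tau_I (\<phi> p x) (\<phi> q y) = \<tau> l (f l p x) (f l q y)"
    if "p \<in> I" "q \<in> I" "l \<in> I" "leq p l" "leq q l" "x \<in> carrier (L p)" "y \<in> carrier (L q)"
    for p q l x y
    using assms(7) that unfolding is_tau_lim_def inj L_def \<tau>_def by blast
  have sigma: "tau_I (\<phi> i x) (\<phi> i y) = \<tau> i x y"
    if "i \<in> I" "x \<in> carrier (L i)" "y \<in> carrier (L i)" for i x y
    using tau_I[OF that(1,1,1) index(2) index(2) that(2,3)] that by (simp add: f_id)
  \<comment> \<open>The defining equation of \<open>\<tau>\<^sub>I\<close> for the upper bounds \<open>i\<close> and \<open>j\<close> of \<open>i\<close>.\<close>
  have transition: "\<tau> j (f j i x) (f j i y) = \<tau> i x y"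
    if "i \<in> I" "j \<in> I" "leq i j" "x \<in> carrier (L i)" "y \<in> carrier (L i)" for i j x y
    using tau_I[OF that(1,1,2,3,3,4,5)] sigma[OF that(1,4,5)] by simp
  \<comment> \<open>The given isomorphism has the values of the comparison map on symbols, hence equals it.\<close>
  have bij: "bij_betw (uce_to_extension k (L i) C (\<tau> i))
        (carrier (cyclic_quotient k (L i))) (carrier (cocycle_extension (L i) C (\<tau> i)))"
    if i: "i \<in> I" for i
  proof -
    obtain h where h: "h \<in> lie_hom k (uce k (L i)) (cocycle_extension (L i) C (\<tau> i))"
      "bij_betw h (carrier (cyclic_quotient k (L i))) (carrier (cocycle_extension (L i) C (\<tau> i)))"
      "\<And>x y. x \<in> carrier (L i) \<Longrightarrow> y \<in> carrier (L i) \<Longrightarrow> h (symb k (L i) x y) = (x \<otimes>\<^bsub>L i\<^esub> y, \<tau> i x y)"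
      using ex[OF i] unfolding central_extension_iso_def uce_simps by blast
    have lin: "linear_map k (cyclic_quotient k (L i)) (cocycle_extension (L i) C (\<tau> i)) h"
      using lie_homD(1)[OF h(1)] unfolding linear_map_def uce_simps .
    have "uce_to_extension k (L i) C (\<tau> i) U = h U"
      if U: "U \<in> carrier (cyclic_quotient k (L i))" for U
      by (rule cyclic_quotient_map_eqI[OF stage(1)[OF i]
            uce_to_extension_linear[OF lie[OF i] C tau[OF i]] lin _ U])
        (simp add: uce_to_extension_symb[OF lie[OF i] C tau[OF i]] h(3))
    then show ?thesis using h(2) by (simp cong: bij_betw_cong)
  qed
  have cocycle: "two_cocycle k Lim C tau_I" by (rule limit_two_cocycle[OF tau sigma])
  note iso = uce_iso_extension[OF Lim_lie C cocycle limit_comparison_bij[OF C tau sigma transition bij]]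
  show ?thesis
    unfolding lim using Lim_lie iso cocycle unfolding C_def by blast
qed

end
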